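(* Let $n\ge 2$ and $c\ge 0$ be integers with $n-c\ge 2$. Let $M=\{F=0\}$ be a germ at $0\in\mathbb{C}^n$ of a real analytic Levi-flat hypersurface, where $F$ is a germ at $0$ of a real-valued real-analytic function of the form $$F(z_1,\ldots,z_n)=\operatorname{Re}(z_1^2+\cdots+z_{n-c}^2)+H(z_1,\ldots,z_n,\bar z_1,\ldots,\bar z_n),$$ and $H$ is a germ at $0\in\mathbb{C}^n$ of a real-analytic function satisfying: (i) $H$ is real-valued, i.e. $H(z,\bar z)=\overline{H(z,\bar z)}$; (ii) $\frac{\partial H}{\partial z_j}(z,\bar z)=\frac{\partial H}{\partial \bar z_j}(z,\bar z)=0$ identically near $0$ for all $j$ with $n-c+1\le j\le n$; (iii) $H(z,\bar z)=O(|z|^3)$ as $z\to 0$. Then there exists a germ of biholomorphism $\Phi:(\mathbb{C}^n,0)\to(\mathbb{C}^n,0)$ such that $$D\Phi(0)=\begin{pmatrix}\operatorname{id}_{n-c} & \star\\ 0 & \operatorname{id}_c\end{pmatrix},$$ where $\operatorname{id}_{n-c}\in \operatorname{GL}(n-c,\mathbb{C})$ and $\operatorname{id}_c\in\operatorname{GL}(c,\mathbb{C})$ are identity matrices and $\star$ is some $(n-c)\times c$ complex matrix, and, as germs at $0$, $$\Phi^{-1}(M)=\{(x_1,\ldots,x_n)\in(\mathbb{C}^n,0):\operatorname{Re}(x_1^2+\cdots+x_{n-c}^2)=0\}.$$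
   Context: All functions, sets and maps are germs at $0\in\mathbb{C}^n$, and $z=(z_1,\ldots,z_n)$. The derivatives $\partial/\partial z_j$ and $\partial/\partial\bar z_j$ are the Wirtinger derivatives. Writing $H(z,\bar z)$ only records that $H$ is given by a convergent power series in $z_1,\dots,z_n,\bar z_1,\dots,\bar z_n$. The block decomposition of $D\Phi(0)$ is with respect to $\mathbb{C}^n=\mathbb{C}^{n-c}\times\mathbb{C}^{c}$ (first $n-c$ coordinates, then last $c$ coordinates); when $c=0$ it reads $D\Phi(0)=\operatorname{id}_n$. $\Phi^{-1}(M)$ denotes the germ of $\{x:\Phi(x)\in M\}$. Levi-flat: let $M=\{F=0\}$ be a germ at $0\in\mathbb{C}^n$ of a real-analytic hypersurface (real codimension one), with $F$ real-valued and real-analytic. Its singular set is $\operatorname{Sing}(M)=\{F=0\}\cap\{dF=0\}$ and its regular part is $M^*=M\setminus\operatorname{Sing}(M)$. The Levi distribution on $M^*$ is the distribution of complex hyperplanes $L_p=\ker(\partial F(p))\subset T_pM^*=\ker(dF(p))$, $p\in M^*$. $M$ is called Levi-flat if $L$ is integrable in the sense of Frobenius; equivalently, $\partial F(p)\wedge\bar\partial F(p)\wedge\partial\bar\partial F(p)=0$ for all $p\in M$. *)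

theory Defs
  imports "HOL-Analysis.Analysis" "HOL-Library.Landau_Symbols"
begin

text \<open>
  Germs at the origin are handled through representatives: functions and sets are defined
  everywhere, and every condition is only required near 0 (filter \<^term>\<open>nhds 0\<close>, or some
  open neighbourhood of 0). The number of coordinates is the cardinality of the index type.
\<close>

definition germ_eq :: "'a::{topological_space, zero} set \<Rightarrow> 'a set \<Rightarrow> bool" where
  "germ_eq A B \<longleftrightarrow> (\<forall>\<^sub>F x in nhds 0. x \<in> A \<longleftrightarrow> x \<in> B)"


text \<open>
  Real-analyticity near \<^term>\<open>p\<close>: a convergent power series in \<open>z - p\<close> and its conjugate.
  The summation is unconditional, over all pairs of multi-indices.
\<close>

definition real_analytic_at :: "(complex^'n \<Rightarrow> complex) \<Rightarrow> complex^'n \<Rightarrow> bool" where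
  "real_analytic_at f p \<longleftrightarrow>
     (\<exists>r>0. \<exists>a :: ('n \<Rightarrow> nat) \<Rightarrow> ('n \<Rightarrow> nat) \<Rightarrow> complex. \<forall>z\<in>ball p r.
        ((\<lambda>(\<alpha>, \<beta>). a \<alpha> \<beta> * (\<Prod>i\<in>UNIV. (z $ i - p $ i) ^ \<alpha> i)
                          * (\<Prod>i\<in>UNIV. cnj (z $ i - p $ i) ^ \<beta> i)) has_sum f z) UNIV)"


text \<open>Wirtinger derivatives; \<^term>\<open>axis i \<i>\<close> is the direction of the imaginary part of \<open>z\<^sub>i\<close>.\<close>

definition wirtinger :: "(complex^'n \<Rightarrow> complex) \<Rightarrow> 'n \<Rightarrow> complex^'n \<Rightarrow> complex" where
  "wirtinger f i p =
     (frechet_derivative f (at p) (axis i 1) - \<i> * frechet_derivative f (at p) (axis i \<i>)) / 2"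

definition wirtinger_bar :: "(complex^'n \<Rightarrow> complex) \<Rightarrow> 'n \<Rightarrow> complex^'n \<Rightarrow> complex" where
  "wirtinger_bar f i p =
     (frechet_derivative f (at p) (axis i 1) + \<i> * frechet_derivative f (at p) (axis i \<i>)) / 2"


definition holomorphic_map_on ::
    "(complex^'n \<Rightarrow> complex^'m) \<Rightarrow> (complex^'n) set \<Rightarrow> bool" where
  "holomorphic_map_on f S \<longleftrightarrow>
     (\<forall>z\<in>S. \<exists>A :: complex^'n^'m. (f has_derivative (\<lambda>h. A *v h)) (at z))"

definition biholomorphic_germ :: "(complex^'n \<Rightarrow> complex^'n) \<Rightarrow> bool" where
  "biholomorphic_germ \<Phi> \<longleftrightarrow> \<Phi> 0 = 0 \<and>
     (\<exists>U V \<Psi>. open U \<and> open V \<and> 0 \<in> U \<and> 0 \<in> V \<and> homeomorphism U V \<Phi> \<Psi> \<and>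
        holomorphic_map_on \<Phi> U \<and> holomorphic_map_on \<Psi> V)"


text \<open>Meant for open subsets of Euclidean spaces, where it is the usual notion of class \<open>C\<^sup>k\<close>.\<close>

primrec Ck_on :: "nat \<Rightarrow> 'a::real_normed_vector set \<Rightarrow> ('a \<Rightarrow> 'b::real_normed_vector) \<Rightarrow> bool" where
  "Ck_on 0 S f \<longleftrightarrow> continuous_on S f"
| "Ck_on (Suc k) S f \<longleftrightarrow>
     f differentiable_on S \<and> (\<forall>v. Ck_on k S (\<lambda>x. frechet_derivative f (at x) v))"

definition smooth_on :: "'a::real_normed_vector set \<Rightarrow> ('a \<Rightarrow> 'b::real_normed_vector) \<Rightarrow> bool" where
  "smooth_on S f \<longleftrightarrow> (\<forall>k. Ck_on k S f)"

definition lie_bracket ::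
    "('a::real_normed_vector \<Rightarrow> 'a) \<Rightarrow> ('a \<Rightarrow> 'a) \<Rightarrow> 'a \<Rightarrow> 'a" where
  "lie_bracket X Y p = frechet_derivative Y (at p) (X p) - frechet_derivative X (at p) (Y p)"


definition sing_part :: "(complex^'n \<Rightarrow> real) \<Rightarrow> (complex^'n) set" where
  "sing_part F = {p. F p = 0} \<inter> {p. frechet_derivative F (at p) = (\<lambda>_. 0)}"

definition reg_part :: "(complex^'n \<Rightarrow> real) \<Rightarrow> (complex^'n) set" where
  "reg_part F = {p. F p = 0} - sing_part F"

text \<open>
  The kernel of \<open>\<partial>F(p) = \<Sum>\<^sub>i (\<partial>F/\<partial>z\<^sub>i)(p) dz\<^sub>i\<close>. Real tangent vectors are identified with elements of
  the complex vector space, so this is the maximal complex subspace of the kernel of \<open>dF(p)\<close>.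
\<close>

definition levi_distribution :: "(complex^'n \<Rightarrow> real) \<Rightarrow> complex^'n \<Rightarrow> (complex^'n) set" where
  "levi_distribution F p =
     {v. (\<Sum>i\<in>UNIV. wirtinger (\<lambda>z. complex_of_real (F z)) i p * v $ i) = 0}"

text \<open>
  Levi-flatness of the germ at 0 of \<open>{F = 0}\<close>: near 0 the Levi distribution on the regular part is
  involutive. Local sections are represented by smooth vector fields on open subsets \<open>V\<close> of the
  ambient space. Near a regular point every smooth section extends to such a field, and on the
  regular part the bracket of two extensions tangent to it is the bracket of the sections.
\<close>

definition levi_flat_germ :: "(complex^'n \<Rightarrow> real) \<Rightarrow> bool" where
  "levi_flat_germ F \<longleftrightarrow>
     (\<exists>U. open U \<and> 0 \<in> U \<and> (\<forall>p\<in>U. real_analytic_at (\<lambda>z. complex_of_real (F z)) p) \<and>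
        (\<forall>V X Y. open V \<longrightarrow> V \<subseteq> U \<longrightarrow> smooth_on V X \<longrightarrow> smooth_on V Y \<longrightarrow>
           (\<forall>q \<in> V \<inter> reg_part F. X q \<in> levi_distribution F q \<and> Y q \<in> levi_distribution F q) \<longrightarrow>
           (\<forall>q \<in> V \<inter> reg_part F. lie_bracket X Y q \<in> levi_distribution F q)))"

end

(*
  Complexify F to a holomorphic function F (z, w), with w in place of the conjugate of z, and rescale so
  that it is a tiny perturbation of QQ (z, w) = (q z + q w) / 2, where q is the sum of the first n - c
  squares. Since n - c >= 2, there are null vectors n1, n2 of q on which its bilinear form does not
  vanish, and F (z, n1 + s n2) is nearly affine in s; its root s = t z is holomorphic in z. The Levi
  condition says exactly that t is constant on each Segre variety {z. F (z, w) = 0}. Writing ts w for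
  cnj (t (cnj w)), the function f z = t z - ts (n1 + t z n2) therefore satisfies f z + cnj (f (cnj w)) = 0
  on the zero set of F near (n2, n1), and by analytic continuation in the scale r also at (r z, r w)
  whenever F (r z, r w) = 0 with (z, w) near (n2, n1). Letting r tend to 0 shows that f is, up to an
  imaginary constant and a real factor, q + O(3), and the holomorphic Morse lemma straightens f to q. In
  these coordinates F vanishes wherever Re q does, by continuation along the quadric; the converse
  inclusion follows because F - Re q varies too little to vanish off the cone.
*)

theory Submission
  imports Defs "HOL-Complex_Analysis.Complex_Analysis"
begin

text \<open>The obstacle is the singular point 0: integrability speaks only where dF is nonzero, so
  a first integral built near Z0 = (n2, n1) need not extend to 0. The line w = n1 + s n2 gets around
  this. On it QQ (z, w) = (q z + s) / 2 has slope 1/2 in s for every z, so t is holomorphic on a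
  full ball about 0, although its constancy on Segre varieties is only checked near Z0. The
  resulting relation for f therefore starts at scale r = 1, and a convex disc of scales with 0 on
  its boundary carries it towards 0. The dilation Z -> e Z, with division by e^2, fixes QQ and
  multiplies the cubic error by e. Hence one small parameter \<eta> feeds all estimates; the
  numerals are generous rational bounds, not sharp values. In Morse coordinates the relation gives
  only one inclusion near Z0: zeros of the transformed function lie on the quadric. Both sets are
  graphs in the same direction over the same base, so they coincide there, which is the seed for the
  continuation along the quadric.\<close>

no_notation fps_nth (infixl "$" 75)

section \<open>Complex structures\<close>

text \<open>Euclidean spaces with an isometric complex structure. One class covers C, C^n, C^n x C^n
  and products with parameter spaces, so holomorphy can be defined once, as a real Frechet
  derivative commuting with J.\<close>

class cvec = euclidean_space +
  fixes J :: "'a \<Rightarrow> 'a"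
  assumes J_add: "J (x + y) = J x + J y"
    and J_scaleR: "J (scaleR r x) = scaleR r (J x)"
    and J_J [simp]: "J (J x) = - x"
    and inner_J: "inner (J x) (J y) = inner x y"

instantiation complex :: cvec
begin
definition "J_complex x = \<i> * (x::complex)"
instance
  by standard (auto simp: J_complex_def algebra_simps inner_complex_def)
end

instantiation vec :: (cvec, finite) cvec
begin
definition "J_vec x = (\<chi> i. J (x $ i))"
instance
  by standard (auto simp: J_vec_def vec_eq_iff J_add J_scaleR inner_vec_def inner_J)
end

instantiation prod :: (cvec, cvec) cvec
begin
definition "J_prod x = (J (fst x), J (snd x))"
instance
  by standard (auto simp: J_prod_def J_add J_scaleR inner_prod_def inner_J)
end

lemma linear_J: "linear (J :: 'a::cvec \<Rightarrow> 'a)"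
  by (rule linearI) (auto simp: J_add J_scaleR)

lemma bounded_linear_J: "bounded_linear (J :: 'a::cvec \<Rightarrow> 'a)"
  using linear_J linear_conv_bounded_linear by blast

lemma J_zero [simp]: "J 0 = (0::'a::cvec)"
  and J_minus [simp]: "J (- x) = - J (x::'a::cvec)"
  and J_diff: "J (x - y) = J x - J (y::'a::cvec)"
  using linear_0[OF linear_J] linear_neg[OF linear_J] linear_diff[OF linear_J] by auto

lemma inner_J_self [simp]: "inner x (J x) = 0" for x :: "'a::cvec"
proof -
  have "inner (J x) (J (J x)) = inner x (J x)" by (rule inner_J)
  then show ?thesis by (simp add: inner_commute)
qed

lemma norm_J [simp]: "norm (J x) = norm (x::'a::cvec)"
  by (simp add: norm_eq_sqrt_inner inner_J)

definition cscale :: "complex \<Rightarrow> 'a::cvec \<Rightarrow> 'a" (infixr "*\<^sub>C" 75)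
  where "s *\<^sub>C v = Re s *\<^sub>R v + Im s *\<^sub>R J v"

lemma cscale_add_right: "s *\<^sub>C (u + v) = s *\<^sub>C u + s *\<^sub>C v"
  by (simp add: cscale_def J_add scaleR_add_right)

lemma cscale_add_left: "(s + t) *\<^sub>C v = s *\<^sub>C v + t *\<^sub>C v"
  by (simp add: cscale_def algebra_simps)

lemma cscale_assoc [simp]: "s *\<^sub>C t *\<^sub>C v = (s * t) *\<^sub>C v"
  by (simp add: cscale_def J_add J_scaleR algebra_simps)

lemma cscale_1 [simp]: "1 *\<^sub>C v = v"
  and cscale_0 [simp]: "0 *\<^sub>C v = 0"
  and cscale_zero [simp]: "s *\<^sub>C 0 = 0"
  and cscale_ii: "\<i> *\<^sub>C v = J v"
  and cscale_of_real: "complex_of_real r *\<^sub>C v = r *\<^sub>R v"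
  by (simp_all add: cscale_def)

lemma cscale_minus_left [simp]: "(- s) *\<^sub>C v = - (s *\<^sub>C v)"
  and cscale_minus_right [simp]: "s *\<^sub>C (- v) = - (s *\<^sub>C v)"
  by (simp_all add: cscale_def)

lemma cscale_diff_right: "s *\<^sub>C (u - v) = s *\<^sub>C u - s *\<^sub>C v"
  using cscale_add_right[of s u "- v"] by simp

lemma norm_cscale [simp]: "norm (s *\<^sub>C v) = cmod s * norm v"
proof -
  have "(norm (s *\<^sub>C v))\<^sup>2 = inner (s *\<^sub>C v) (s *\<^sub>C v)" by (simp add: dot_square_norm)
  also have "\<dots> = ((Re s)\<^sup>2 + (Im s)\<^sup>2) * inner v v"
    unfolding cscale_def
    by (simp add: inner_add_left inner_add_right inner_J inner_commute[of "J v" v] power2_eq_square algebra_simps)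
  also have "\<dots> = (cmod s * norm v)\<^sup>2"
    by (simp add: cmod_def power_mult_distrib dot_square_norm)
  finally show ?thesis by (simp add: power2_eq_iff_nonneg)
qed

lemma cscale_complex [simp]: "s *\<^sub>C (z::complex) = s * z"
  by (simp add: cscale_def J_complex_def complex_eq_iff)

lemma cscale_vec_nth [simp]: "(s *\<^sub>C v) $ i = s *\<^sub>C (v $ i)"
  by (simp add: cscale_def J_vec_def)

lemma fst_cscale [simp]: "fst (s *\<^sub>C v) = s *\<^sub>C fst v"
  and snd_cscale [simp]: "snd (s *\<^sub>C v) = s *\<^sub>C snd v"
  and cscale_Pair: "s *\<^sub>C (a, b) = (s *\<^sub>C a, s *\<^sub>C b)"
  by (simp_all add: cscale_def J_prod_def)

lemma J_Pair: "J (a, b) = (J a, J b)"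
  by (simp add: J_prod_def)

lemma bounded_linear_cscale_right: "bounded_linear (\<lambda>v. s *\<^sub>C v)"
  unfolding cscale_def
  by (intro bounded_linear_add bounded_linear_compose[OF bounded_linear_scaleR_right] bounded_linear_J bounded_linear_ident)

lemma bounded_linear_cscale_left: "bounded_linear (\<lambda>s. s *\<^sub>C v)"
  unfolding cscale_def
  by (intro bounded_linear_add bounded_linear_compose[OF bounded_linear_scaleR_left] bounded_linear_Re bounded_linear_Im)

lemma continuous_on_cscale [continuous_intros]:
  "continuous_on S f \<Longrightarrow> continuous_on S g \<Longrightarrow> continuous_on S (\<lambda>x. f x *\<^sub>C g x)"
  unfolding cscale_def
  by (intro continuous_intros bounded_linear.continuous_on[OF bounded_linear_J])

lemma tendsto_cscale [tendsto_intros]: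
  "(f \<longlongrightarrow> a) F \<Longrightarrow> (g \<longlongrightarrow> b) F \<Longrightarrow> ((\<lambda>x. f x *\<^sub>C g x) \<longlongrightarrow> a *\<^sub>C b) F"
  unfolding cscale_def
  by (intro tendsto_intros bounded_linear.tendsto[OF bounded_linear_J])

definition clinear :: "('a::cvec \<Rightarrow> 'b::cvec) \<Rightarrow> bool"
  where "clinear D \<longleftrightarrow> linear D \<and> (\<forall>v. D (J v) = J (D v))"

lemma clinear_linear: "clinear D \<Longrightarrow> linear D"
  and clinear_J: "clinear D \<Longrightarrow> D (J v) = J (D v)"
  by (auto simp: clinear_def)

lemma clinear_bounded_linear: "clinear D \<Longrightarrow> bounded_linear D"
  using clinear_linear linear_conv_bounded_linear by blast

lemma clinear_add: "clinear D \<Longrightarrow> D (u + v) = D u + D v"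
  and clinear_diff: "clinear D \<Longrightarrow> D (u - v) = D u - D v"
  and clinear_zero: "clinear D \<Longrightarrow> D 0 = 0"
  and clinear_minus: "clinear D \<Longrightarrow> D (- v) = - D v"
  and clinear_scaleR: "clinear D \<Longrightarrow> D (r *\<^sub>R v) = r *\<^sub>R D v"
  by (auto simp: clinear_def linear_add linear_diff linear_0 linear_neg linear_cmul)

lemma clinear_cscale: "clinear D \<Longrightarrow> D (s *\<^sub>C v) = s *\<^sub>C D v"
  by (simp add: cscale_def clinear_add clinear_scaleR clinear_J)

lemma clinear_compose: "clinear D \<Longrightarrow> clinear E \<Longrightarrow> clinear (\<lambda>v. E (D v))"
  unfolding clinear_def using linear_compose[of D E] by (auto simp: o_def)

lemma clinear_id: "clinear (\<lambda>v. v)"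
  and clinear_const_zero: "clinear (\<lambda>v. 0)"
  and clinear_fst: "clinear fst"
  and clinear_snd: "clinear snd"
  and clinear_vec_nth: "clinear (\<lambda>v. v $ i)"
  and clinear_cscale_left: "clinear (\<lambda>s. s *\<^sub>C w)"
  and clinear_cscale_right: "clinear (\<lambda>v. s *\<^sub>C v)"
proof -
  show "clinear (\<lambda>s. s *\<^sub>C w)"
    unfolding clinear_def J_complex_def cscale_ii[symmetric] cscale_assoc
    using bounded_linear.linear[OF bounded_linear_cscale_left] by blast
  show "clinear (\<lambda>v. s *\<^sub>C v)"
    unfolding clinear_def cscale_ii[symmetric] cscale_assoc
    using bounded_linear.linear[OF bounded_linear_cscale_right] by (simp add: mult.commute)
qed (auto simp: clinear_def J_prod_def J_vec_def linear_iff)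

lemma clinear_add_fun: "clinear D \<Longrightarrow> clinear E \<Longrightarrow> clinear (\<lambda>v. D v + E v)"
  unfolding clinear_def using linear_compose_add[of D E] by (auto simp: J_add)

lemma clinear_Pair: "clinear D \<Longrightarrow> clinear E \<Longrightarrow> clinear (\<lambda>v. (D v, E v))"
  unfolding clinear_def by (auto simp: J_prod_def linear_iff)

section \<open>Holomorphic maps\<close>

text \<open>The Cauchy-Riemann equations in coordinate-free form. Analytic consequences are drawn
  from one-variable theory by restricting to complex lines.\<close>

definition holo :: "('a::cvec \<Rightarrow> 'b::cvec) \<Rightarrow> 'a set \<Rightarrow> bool"
  where "holo f S \<longleftrightarrow> (\<forall>z\<in>S. \<exists>D. (f has_derivative D) (at z) \<and> clinear D)"

abbreviation fd :: "('a::real_normed_vector \<Rightarrow> 'b::real_normed_vector) \<Rightarrow> 'a \<Rightarrow> 'a \<Rightarrow> 'b"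
  where "fd f z \<equiv> frechet_derivative f (at z)"

lemma holoI: "(\<And>z. z \<in> S \<Longrightarrow> (f has_derivative D z) (at z)) \<Longrightarrow> (\<And>z. z \<in> S \<Longrightarrow> clinear (D z)) \<Longrightarrow> holo f S"
  unfolding holo_def by blast

lemma fd_eq: "(f has_derivative D) (at z) \<Longrightarrow> fd f z = D"
  by (rule frechet_derivative_at[symmetric])

lemma holo_has_derivative: "holo f S \<Longrightarrow> z \<in> S \<Longrightarrow> (f has_derivative fd f z) (at z)"
  and holo_clinear: "holo f S \<Longrightarrow> z \<in> S \<Longrightarrow> clinear (fd f z)"
  unfolding holo_def using fd_eq by metis+

lemmas holo_fd_add = clinear_add[OF holo_clinear]
lemmas holo_fd_cscale = clinear_cscale[OF holo_clinear]
lemmas holo_fd_J = clinear_J[OF holo_clinear]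
lemmas holo_fd_zero = clinear_zero[OF holo_clinear]
lemmas holo_fd_minus = clinear_minus[OF holo_clinear]

lemma holo_subset: "holo f S \<Longrightarrow> T \<subseteq> S \<Longrightarrow> holo f T"
  unfolding holo_def by blast

lemma holo_continuous_on: "holo f S \<Longrightarrow> continuous_on S f"
  by (meson continuous_at_imp_continuous_on has_derivative_continuous holo_has_derivative)

lemma holo_differentiable: "holo f S \<Longrightarrow> z \<in> S \<Longrightarrow> f differentiable (at z)"
  by (meson holo_has_derivative differentiable_def)

lemma has_derivative_cong_open:
  assumes "open S" "z \<in> S" "\<And>x. x \<in> S \<Longrightarrow> f x = g x"
  shows "(f has_derivative D) (at z) \<longleftrightarrow> (g has_derivative D) (at z)"
  using assms has_derivative_transform_within_open[of f D z UNIV S g]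
    has_derivative_transform_within_open[of g D z UNIV S f] by auto

lemma fd_cong:
  assumes "open S" "z \<in> S" "\<And>x. x \<in> S \<Longrightarrow> f x = g x"
  shows "fd f z = fd g z"
  unfolding frechet_derivative_def using has_derivative_cong_open[OF assms] by simp

lemma holo_cong:
  assumes "open S" "\<And>x. x \<in> S \<Longrightarrow> f x = g x"
  shows "holo f S \<longleftrightarrow> holo g S"
  using has_derivative_cong_open[OF assms(1), of _ f g] assms(2) unfolding holo_def by metis

lemma holo_compose:
  assumes "holo g T" "holo f S" "\<And>z. z \<in> S \<Longrightarrow> f z \<in> T"
  shows "holo (\<lambda>z. g (f z)) S"
proof (rule holoI)
  fix z assume z: "z \<in> S"
  show "((\<lambda>z. g (f z)) has_derivative (\<lambda>v. fd g (f z) (fd f z v))) (at z)"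
    by (rule has_derivative_compose[OF holo_has_derivative[OF assms(2) z] holo_has_derivative[OF assms(1) assms(3)[OF z]]])
  show "clinear (\<lambda>v. fd g (f z) (fd f z v))"
    by (rule clinear_compose[OF holo_clinear[OF assms(2) z] holo_clinear[OF assms(1) assms(3)[OF z]]])
qed

lemma fd_compose:
  assumes "f differentiable (at z)" "g differentiable (at (f z))"
  shows "fd (\<lambda>z. g (f z)) z v = fd g (f z) (fd f z v)"
  using fd_eq[OF has_derivative_compose[of f "fd f z" z UNIV g "fd g (f z)"]] assms
  by (simp add: frechet_derivative_works)

lemma holo_clinear_map: "clinear D \<Longrightarrow> holo D S"
  by (rule holoI[of _ _ "\<lambda>_. D"])
    (auto simp: bounded_linear_imp_has_derivative clinear_bounded_linear)

lemma fd_clinear_map: "clinear D \<Longrightarrow> fd D z = D"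
  by (rule fd_eq) (auto simp: bounded_linear_imp_has_derivative clinear_bounded_linear)

lemma holo_const: "holo (\<lambda>z. c) S"
  by (rule holoI[of _ _ "\<lambda>_ _. 0"]) (auto simp: clinear_const_zero)

lemma holo_id: "holo (\<lambda>z. z) S"
  by (rule holo_clinear_map[OF clinear_id])

lemma holo_add:
  assumes "holo f S" "holo g S"
  shows "holo (\<lambda>z. f z + g z) S"
  by (rule holoI[where D = "\<lambda>z v. fd f z v + fd g z v"])
    (auto intro!: has_derivative_add holo_has_derivative[OF assms(1)] holo_has_derivative[OF assms(2)]
       clinear_add_fun holo_clinear[OF assms(1)] holo_clinear[OF assms(2)])

lemma holo_linear_image: "clinear D \<Longrightarrow> holo f S \<Longrightarrow> holo (\<lambda>z. D (f z)) S"
  by (rule holo_compose[OF holo_clinear_map[of D UNIV]]) auto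

lemma holo_cscale_const: "holo f S \<Longrightarrow> holo (\<lambda>z. s *\<^sub>C f z) S"
  by (rule holo_linear_image[OF clinear_cscale_right])

lemma holo_minus: "holo f S \<Longrightarrow> holo (\<lambda>z. - f z) S"
  using holo_cscale_const[of f S "-1"] by simp

lemma holo_diff: "holo f S \<Longrightarrow> holo g S \<Longrightarrow> holo (\<lambda>z. f z - g z) S"
  using holo_add[of f S "\<lambda>z. - g z"] holo_minus by fastforce

lemma holo_fst: "holo f S \<Longrightarrow> holo (\<lambda>z. fst (f z)) S"
  and holo_snd: "holo f S \<Longrightarrow> holo (\<lambda>z. snd (f z)) S"
  and holo_nth: "holo h S \<Longrightarrow> holo (\<lambda>z. h z $ i) S"
  by (rule holo_linear_image[OF clinear_fst] holo_linear_image[OF clinear_snd] holo_linear_image[OF clinear_vec_nth], assumption)+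

lemma holo_Pair:
  assumes "holo f S" "holo g S"
  shows "holo (\<lambda>z. (f z, g z)) S"
  by (rule holoI[where D = "\<lambda>z v. (fd f z v, fd g z v)"])
    (auto intro!: has_derivative_Pair holo_has_derivative[OF assms(1)] holo_has_derivative[OF assms(2)]
       clinear_Pair holo_clinear[OF assms(1)] holo_clinear[OF assms(2)])

lemma holo_bilinear:
  assumes "bounded_bilinear B" "\<And>u v. B (J u) v = J (B u v)" "\<And>u v. B u (J v) = J (B u v)"
    and f: "holo f S" and g: "holo g S"
  shows "holo (\<lambda>z. B (f z) (g z)) S"
proof (rule holoI[where D = "\<lambda>z v. B (f z) (fd g z v) + B (fd f z v) (g z)"])
  fix z assume z: "z \<in> S"
  show "((\<lambda>z. B (f z) (g z)) has_derivative (\<lambda>v. B (f z) (fd g z v) + B (fd f z v) (g z))) (at z)"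
    by (rule bounded_bilinear.FDERIV[OF assms(1) holo_has_derivative[OF f z] holo_has_derivative[OF g z]])
  then have "linear (\<lambda>v. B (f z) (fd g z v) + B (fd f z v) (g z))"
    by (rule has_derivative_linear)
  then show "clinear (\<lambda>v. B (f z) (fd g z v) + B (fd f z v) (g z))"
    unfolding clinear_def
    by (simp add: holo_fd_J[OF f z] holo_fd_J[OF g z] assms(2,3) J_add)
qed

lemma bounded_bilinear_cscale: "bounded_bilinear (*\<^sub>C)"
proof
  show "\<exists>K. \<forall>a b. norm (a *\<^sub>C b) \<le> norm a * norm b * K"
    by (rule exI[of _ 1]) simp
qed (simp_all add: cscale_add_left cscale_add_right, simp_all add: cscale_def J_scaleR scaleR_add_right mult.commute)

lemma holo_cscale: "holo f S \<Longrightarrow> holo g S \<Longrightarrow> holo (\<lambda>z. f z *\<^sub>C g z) S"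
  by (rule holo_bilinear[OF bounded_bilinear_cscale]) (simp_all add: cscale_ii[symmetric] mult.commute)

lemma holo_mult:
  fixes f g :: "'a::cvec \<Rightarrow> complex"
  shows "holo f S \<Longrightarrow> holo g S \<Longrightarrow> holo (\<lambda>z. f z * g z) S"
  using holo_cscale[of f S g] by simp

lemma holo_power:
  fixes f :: "'a::cvec \<Rightarrow> complex"
  shows "holo f S \<Longrightarrow> holo (\<lambda>z. f z ^ n) S"
  by (induction n) (auto intro: holo_const holo_mult)

lemma holo_sum: "(\<And>i. i \<in> A \<Longrightarrow> holo (f i) S) \<Longrightarrow> holo (\<lambda>z. \<Sum>i\<in>A. f i z) S"
  by (induction A rule: infinite_finite_induct) (auto intro: holo_const holo_add)

lemma holo_prod:
  fixes f :: "'i \<Rightarrow> 'a::cvec \<Rightarrow> complex"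
  shows "(\<And>i. i \<in> A \<Longrightarrow> holo (f i) S) \<Longrightarrow> holo (\<lambda>z. \<Prod>i\<in>A. f i z) S"
  by (induction A rule: infinite_finite_induct) (auto intro: holo_const holo_mult)

lemma holo_vec:
  fixes f :: "'a::cvec \<Rightarrow> complex ^ 'm"
  assumes "\<And>i. holo (\<lambda>z. f z $ i) S"
  shows "holo f S"
proof -
  have "holo (\<lambda>z. \<Sum>i\<in>UNIV. (f z $ i) *\<^sub>C axis i (1::complex)) S"
    by (intro holo_sum holo_cscale assms holo_const)
  moreover have "(\<Sum>i\<in>UNIV. (f z $ i) *\<^sub>C axis i (1::complex)) = f z" for z
    by (simp add: vec_eq_iff axis_def if_distrib[of "\<lambda>x. _ * x"] cong: if_cong)
  ultimately show ?thesis by simp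
qed

lemma clinear_times: "clinear ((*) (c::complex))"
  by (auto simp: clinear_def linear_iff J_complex_def algebra_simps)

lemma clinear_complex_iff: "clinear D \<longleftrightarrow> D = (*) (D 1)" for D :: "complex \<Rightarrow> complex"
proof
  assume D: "clinear D"
  show "D = (*) (D 1)"
  proof
    fix s show "D s = D 1 * s"
      using clinear_cscale[OF D, of s 1] by (simp add: mult.commute)
  qed
next
  assume "D = (*) (D 1)"
  then show "clinear D" by (metis clinear_times)
qed

lemma holo_complex_iff:
  fixes f :: "complex \<Rightarrow> complex"
  assumes "open S"
  shows "holo f S \<longleftrightarrow> f holomorphic_on S"
proof
  assume "holo f S"
  then show "f holomorphic_on S"
    unfolding holomorphic_on_def holo_def field_differentiable_def has_field_derivative_def
    using clinear_complex_iff has_derivative_at_withinI by (metis (full_types))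
next
  assume f: "f holomorphic_on S"
  show "holo f S"
  proof (rule holoI[where D = "\<lambda>z. (*) (deriv f z)"])
    fix z assume "z \<in> S"
    then show "(f has_derivative (*) (deriv f z)) (at z)"
      using holomorphic_derivI[OF f assms] by (simp add: has_field_derivative_def)
    show "clinear ((*) (deriv f z))" by (rule clinear_times)
  qed
qed

lemma holo_inverse:
  fixes f :: "'a::cvec \<Rightarrow> complex"
  assumes "holo f S" "\<And>z. z \<in> S \<Longrightarrow> f z \<noteq> 0"
  shows "holo (\<lambda>z. inverse (f z)) S"
proof (rule holo_compose[of inverse "- {0}"])
  show "holo inverse (- {0::complex})"
    by (subst holo_complex_iff) (auto intro: holomorphic_intros)
qed (use assms in auto)

lemma holo_divide:
  fixes f :: "'a::cvec \<Rightarrow> complex"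
  assumes "holo f S" "holo g S" "\<And>z. z \<in> S \<Longrightarrow> g z \<noteq> 0"
  shows "holo (\<lambda>z. f z / g z) S"
  using holo_mult[OF assms(1) holo_inverse[OF assms(2,3)]] by (simp add: divide_inverse)

section \<open>Complex lines, Cauchy estimates and uniform limits\<close>

lemma open_line:
  assumes "open S"
  shows "open {s. z + s *\<^sub>C v \<in> S}"
proof -
  have "continuous_on UNIV (\<lambda>s. z + s *\<^sub>C v)"
    by (intro continuous_intros)
  then have "open ((\<lambda>s. z + s *\<^sub>C v) -` S)"
    using assms open_vimage by blast
  then show ?thesis by (simp add: vimage_def)
qed

lemma has_derivative_line: "((\<lambda>s. z + s *\<^sub>C v) has_derivative (\<lambda>s. s *\<^sub>C v)) (at s)"
  using bounded_linear_imp_has_derivative[OF bounded_linear_cscale_left]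
  by (auto intro!: derivative_eq_intros)

lemma line_field_derivative:
  fixes f :: "'a::cvec \<Rightarrow> complex"
  assumes "holo f S" "z + s *\<^sub>C v \<in> S"
  shows "((\<lambda>s. f (z + s *\<^sub>C v)) has_field_derivative fd f (z + s *\<^sub>C v) v) (at s)"
proof -
  have "((\<lambda>s. f (z + s *\<^sub>C v)) has_derivative (\<lambda>t. fd f (z + s *\<^sub>C v) (t *\<^sub>C v))) (at s)"
    by (rule has_derivative_compose[OF has_derivative_line holo_has_derivative[OF assms]])
  then show ?thesis
    using holo_fd_cscale[OF assms] by (simp add: has_field_derivative_def mult_commute_abs)
qed

lemma line_holomorphic:
  fixes f :: "'a::cvec \<Rightarrow> complex"
  assumes "holo f S" "\<And>s. s \<in> T \<Longrightarrow> z + s *\<^sub>C v \<in> S"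
  shows "(\<lambda>s. f (z + s *\<^sub>C v)) holomorphic_on T"
  unfolding holomorphic_on_def field_differentiable_def
  using line_field_derivative[OF assms(1) assms(2)] has_field_derivative_at_within by blast

text \<open>Cauchy's inequality on the disc of all x + s v with |s| at most r / (2 norm v). Halving
  the radius keeps the closed disc inside the open ball and is the source of the factor 2.\<close>

lemma holo_fd_bound:
  fixes f :: "'a::cvec \<Rightarrow> complex"
  assumes f: "holo f (ball x r)" and B: "\<And>y. y \<in> ball x r \<Longrightarrow> cmod (f y) \<le> B" and r: "r > 0"
  shows "cmod (fd f x v) \<le> 2 * B / r * norm v"
proof (cases "v = 0")
  case True
  then show ?thesis using holo_fd_zero[OF f] r by simp
next
  case False
  define \<rho> where "\<rho> = r / (2 * norm v)"
  have \<rho>: "\<rho> > 0" using False r by (simp add: \<rho>_def)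
  have in_ball: "x + s *\<^sub>C v \<in> ball x r" if "cmod s \<le> \<rho>" for s
  proof -
    have "cmod s * norm v \<le> \<rho> * norm v" using that by (intro mult_right_mono) auto
    also have "\<dots> < r" using False r by (simp add: \<rho>_def)
    finally show ?thesis by (simp add: dist_norm)
  qed
  define h where "h = (\<lambda>s. f (x + s *\<^sub>C v))"
  have hol: "h holomorphic_on cball 0 \<rho>"
    unfolding h_def by (rule line_holomorphic[OF f]) (use in_ball in auto)
  have "norm ((deriv ^^ 1) h 0) \<le> fact 1 * B / \<rho> ^ 1"
  proof (rule Cauchy_inequality)
    show "h holomorphic_on ball 0 \<rho>" using hol holomorphic_on_subset ball_subset_cball by blast
    show "continuous_on (cball 0 \<rho>) h" using hol holomorphic_on_imp_continuous_on by blast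
    show "cmod (h s) \<le> B" if "cmod (0 - s) = \<rho>" for s
      unfolding h_def by (rule B[OF in_ball]) (use that in auto)
  qed (rule \<rho>)
  moreover have "deriv h 0 = fd f x v"
    unfolding h_def using DERIV_imp_deriv[OF line_field_derivative[OF f, of x 0 v]] r by simp
  ultimately show ?thesis using False r by (simp add: \<rho>_def field_simps)
qed

text \<open>Weierstrass's theorem. By \<open>holo_fd_bound\<close> the derivatives are uniformly
  Cauchy near each point, so \<open>has_derivative_sequence\<close> differentiates the limit;
  commuting with J survives pointwise limits.\<close>

lemma holo_uniform_limit:
  fixes f :: "nat \<Rightarrow> 'a::cvec \<Rightarrow> complex"
  assumes S: "open S" and f: "\<And>k. holo (f k) S" and lim: "uniform_limit S f g sequentially"
  shows "holo g S"
  unfolding holo_def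
proof
  fix z assume "z \<in> S"
  then obtain r where r: "r > 0" and sub: "ball z (2 * r) \<subseteq> S"
    using S openE[of S z] by (metis mult.commute half_gt_zero nonzero_eq_divide_eq zero_neq_numeral)
  have ball_sub: "ball x r \<subseteq> S" if "x \<in> ball z r" for x
  proof -
    have "ball x r \<subseteq> ball z (2 * r)"
    proof
      fix y assume "y \<in> ball x r"
      then show "y \<in> ball z (2 * r)"
        using that dist_triangle[of z y x] by simp
    qed
    then show ?thesis using sub by blast
  qed
  have xS: "x \<in> S" if "x \<in> ball z r" for x
    using ball_sub[OF that] r by auto
  have cauchy: "\<exists>N. \<forall>k\<ge>N. \<forall>l\<ge>N. \<forall>x\<in>ball z r. \<forall>v. cmod (fd (f k) x v - fd (f l) x v) \<le> e * norm v"
    if e: "e > 0" for e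
  proof -
    obtain N where N: "\<And>k x. k \<ge> N \<Longrightarrow> x \<in> S \<Longrightarrow> dist (f k x) (g x) < e * r / 4"
      using uniform_limitD[OF lim, of "e * r / 4"] e r unfolding eventually_sequentially by auto
    have "cmod (fd (f k) x v - fd (f l) x v) \<le> e * norm v"
      if "k \<ge> N" "l \<ge> N" "x \<in> ball z r" for k l x v
    proof -
      have "holo (\<lambda>y. f k y - f l y) (ball x r)"
        by (rule holo_subset[OF holo_diff[OF f f] ball_sub[OF that(3)]])
      moreover have "cmod (f k y - f l y) \<le> e * r / 2" if "y \<in> ball x r" for y
        using N[of k y] N[of l y] \<open>k \<ge> N\<close> \<open>l \<ge> N\<close> that ball_sub[OF \<open>x \<in> ball z r\<close>]
          dist_triangle2[of "f k y" "f l y" "g y"] by (fastforce simp: dist_norm)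
      ultimately have "cmod (fd (\<lambda>y. f k y - f l y) x v) \<le> 2 * (e * r / 2) / r * norm v"
        using r by (rule holo_fd_bound) 
      moreover have "fd (\<lambda>y. f k y - f l y) x = (\<lambda>v. fd (f k) x v - fd (f l) x v)"
        by (rule fd_eq) (intro has_derivative_diff holo_has_derivative[OF f] xS that)
      ultimately show ?thesis using r by simp
    qed
    then show ?thesis by blast
  qed
  have conv: "convergent (\<lambda>k. fd (f k) x v)" if "x \<in> ball z r" for x v
  proof (rule Cauchy_convergent, rule metric_CauchyI)
    fix e :: real assume e: "e > 0"
    have v: "e / (2 * (norm v + 1)) > 0" using e by (simp add: add_nonneg_pos)
    have "e / (2 * (norm v + 1)) * norm v < e"
    proof -
      have "e * norm v < e * (2 * (norm v + 1))"
        using e norm_ge_zero[of v] by (intro mult_strict_left_mono) (simp_all add: add_pos_nonneg add_nonneg_pos)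
      then show ?thesis
        using norm_ge_zero[of v] by (simp add: pos_divide_less_eq add_nonneg_pos)
    qed
    then show "\<exists>M. \<forall>m\<ge>M. \<forall>n\<ge>M. dist (fd (f m) x v) (fd (f n) x v) < e"
      using cauchy[OF v] that unfolding dist_norm by (meson order.strict_trans1)
  qed
  define g' where "g' x v = lim (\<lambda>k. fd (f k) x v)" for x v
  have g': "(\<lambda>k. fd (f k) x v) \<longlonglongrightarrow> g' x v" if "x \<in> ball z r" for x v
    using conv[OF that] by (simp add: g'_def convergent_LIMSEQ_iff)
  have "\<exists>h. \<forall>x\<in>ball z r. (\<lambda>n. f n x) \<longlonglongrightarrow> h x \<and> (h has_derivative g' x) (at x within ball z r)"
  proof (rule has_derivative_sequence)
    show "convex (ball z r)" by simp
    show "(f n has_derivative fd (f n) x) (at x within ball z r)" if "x \<in> ball z r" for n x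
      by (rule has_derivative_at_withinI[OF holo_has_derivative[OF f xS[OF that]]])
    show "\<forall>\<^sub>F n in sequentially. \<forall>x\<in>ball z r. \<forall>h. cmod (fd (f n) x h - g' x h) \<le> e * norm h" if e: "e > 0" for e
    proof -
      obtain N where N: "\<forall>k\<ge>N. \<forall>l\<ge>N. \<forall>x\<in>ball z r. \<forall>v. cmod (fd (f k) x v - fd (f l) x v) \<le> e * norm v"
        using cauchy[OF e] by blast
      have "cmod (fd (f k) x v - g' x v) \<le> e * norm v" if "k \<ge> N" "x \<in> ball z r" for k x v
      proof (rule tendsto_upperbound)
        show "(\<lambda>l. cmod (fd (f k) x v - fd (f l) x v)) \<longlonglongrightarrow> cmod (fd (f k) x v - g' x v)"
          by (intro tendsto_intros g' that)
        show "\<forall>\<^sub>F l in sequentially. cmod (fd (f k) x v - fd (f l) x v) \<le> e * norm v"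
          unfolding eventually_sequentially by (intro exI[of _ N]) (use N that in auto)
      qed simp
      then show ?thesis unfolding eventually_sequentially by blast
    qed
    show "z \<in> ball z r" using r by simp
    show "(\<lambda>n. f n z) \<longlonglongrightarrow> g z" by (rule tendsto_uniform_limitI[OF lim \<open>z \<in> S\<close>])
  qed
  then obtain h where h: "\<And>x. x \<in> ball z r \<Longrightarrow> (\<lambda>n. f n x) \<longlonglongrightarrow> h x"
      "\<And>x. x \<in> ball z r \<Longrightarrow> (h has_derivative g' x) (at x within ball z r)" by blast
  have hg: "h x = g x" if "x \<in> ball z r" for x
    using LIMSEQ_unique[OF h(1)[OF that] tendsto_uniform_limitI[OF lim xS[OF that]]] .
  have zr: "z \<in> ball z r" using r by simp
  have "(h has_derivative g' z) (at z)"
    using h(2)[OF zr] at_within_open[OF zr] by simp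
  then have der: "(g has_derivative g' z) (at z)"
    using has_derivative_cong_open[OF open_ball zr, of h g] hg by blast
  moreover have "clinear (g' z)"
    unfolding clinear_def
  proof (intro conjI allI)
    show "linear (g' z)" using der has_derivative_linear by blast
    fix v
    have "(\<lambda>k. \<i> * fd (f k) z v) \<longlonglongrightarrow> \<i> * g' z v" by (intro tendsto_intros g' zr)
    then have "(\<lambda>k. fd (f k) z (J v)) \<longlonglongrightarrow> \<i> * g' z v"
      using holo_fd_J[OF f \<open>z \<in> S\<close>] by (simp add: J_complex_def)
    then show "g' z (J v) = J (g' z v)"
      using LIMSEQ_unique[OF g'[OF zr]] by (simp add: J_complex_def)
  qed
  ultimately show "\<exists>D. (g has_derivative D) (at z) \<and> clinear D" by blast
qed

lemma mem_ball_add: "c + x \<in> ball c r \<longleftrightarrow> norm x < r"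
  by (simp add: dist_norm)

text \<open>The remainder constant involves only \<rho>, B and n: each point of the half disc is the
  centre of a disc of radius \<rho> / 4 inside the domain, on which Cauchy's inequality bounds the
  derivative of order n + 1.\<close>

lemma taylor_disc:
  assumes h: "h holomorphic_on ball 0 \<rho>" and \<rho>: "\<rho> > 0"
    and B: "\<And>s. s \<in> ball 0 \<rho> \<Longrightarrow> cmod (h s) \<le> B" and s: "cmod s \<le> \<rho> / 2"
  shows "cmod (h s - (\<Sum>i\<le>n. (deriv ^^ i) h 0 * s ^ i / fact i))
    \<le> fact (Suc n) * B / (\<rho> / 4) ^ Suc n * cmod s ^ Suc n / fact n"
proof -
  let ?S = "cball 0 (\<rho> / 2) :: complex set"
  have sub: "cball x (\<rho> / 4) \<subseteq> ball 0 \<rho>" if "x \<in> ?S" for x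
  proof
    fix y assume "y \<in> cball x (\<rho> / 4)"
    then show "y \<in> ball 0 \<rho>" using that \<rho> dist_triangle[of 0 y x] by simp
  qed
  have "cmod ((deriv ^^ 0) h s - (\<Sum>i\<le>n. (deriv ^^ i) h 0 * (s - 0) ^ i / fact i))
    \<le> (fact (Suc n) * B / (\<rho> / 4) ^ Suc n) * cmod (s - 0) ^ Suc n / fact n"
  proof (rule complex_Taylor[where S = ?S])
    show "((deriv ^^ i) h has_field_derivative (deriv ^^ Suc i) h x) (at x within ?S)" if "x \<in> ?S" for i x
    proof -
      have "(deriv ^^ i) h holomorphic_on ball 0 \<rho>"
        by (rule holomorphic_higher_deriv[OF h open_ball])
      then have "((deriv ^^ i) h has_field_derivative deriv ((deriv ^^ i) h) x) (at x)"
        by (rule holomorphic_derivI) (use that \<rho> in auto)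
      then show ?thesis by (simp add: has_field_derivative_at_within)
    qed
    show "cmod ((deriv ^^ Suc n) h x) \<le> fact (Suc n) * B / (\<rho> / 4) ^ Suc n" if "x \<in> ?S" for x
    proof (rule Cauchy_inequality)
      show "h holomorphic_on ball x (\<rho> / 4)"
        using h sub[OF that] ball_subset_cball by (meson holomorphic_on_subset order_trans)
      show "continuous_on (cball x (\<rho> / 4)) h"
        using h sub[OF that] by (meson holomorphic_on_subset holomorphic_on_imp_continuous_on)
      show "cmod (h y) \<le> B" if "cmod (x - y) = \<rho> / 4" for y
        using B sub[OF \<open>x \<in> ?S\<close>] that by (auto simp: dist_norm subset_iff)
    qed (use \<rho> in simp)
  qed (use s \<rho> in auto)
  then show ?thesis by simp
qed

lemma holo_locally_bounded:
  fixes f :: "'a::cvec \<Rightarrow> complex"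
  assumes "open S" "holo f S" "z \<in> S"
  obtains r B where "r > 0" "ball z r \<subseteq> S" "\<And>x. x \<in> ball z r \<Longrightarrow> cmod (f x) \<le> B"
proof -
  obtain r1 where r1: "r1 > 0" "ball z r1 \<subseteq> S" using assms openE by blast
  have "isCont f z"
    using holo_has_derivative[OF assms(2,3)] has_derivative_continuous by blast
  then obtain d where d: "d > 0" "\<And>x. dist x z < d \<Longrightarrow> dist (f x) (f z) < 1"
    unfolding continuous_at_eps_delta using zero_less_one by blast
  show ?thesis
  proof
    show "min r1 d > 0" "ball z (min r1 d) \<subseteq> S" using r1 d by auto
    show "cmod (f x) \<le> cmod (f z) + 1" if "x \<in> ball z (min r1 d)" for x
      using d(2)[of x] that norm_triangle_ineq2[of "f x" "f z"] by (simp add: dist_norm norm_minus_commute)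
  qed
qed

text \<open>The difference quotients are themselves holomorphic and converge locally uniformly.\<close>

lemma holo_fd:
  fixes f :: "'a::cvec \<Rightarrow> complex"
  assumes S: "open S" and f: "holo f S"
  shows "holo (\<lambda>z. fd f z v) S"
proof (cases "v = 0")
  case True
  have "holo (\<lambda>z. fd f z v) S \<longleftrightarrow> holo (\<lambda>z. 0::complex) S"
    by (rule holo_cong[OF S]) (simp add: True holo_fd_zero[OF f])
  then show ?thesis by (simp add: holo_const)
next
  case v: False
  show ?thesis
    unfolding holo_def
  proof
    fix z assume "z \<in> S"
    obtain r B where r: "r > 0" "ball z r \<subseteq> S" and B: "\<And>x. x \<in> ball z r \<Longrightarrow> cmod (f x) \<le> B"
      using holo_locally_bounded[OF S f \<open>z \<in> S\<close>] by blast
    define \<rho> where "\<rho> = r / (2 * norm v)"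
    have \<rho>: "\<rho> > 0" using r v by (simp add: \<rho>_def)
    define C where "C = fact (Suc 1) * B / (\<rho> / 4) ^ Suc 1"
    have in_ball: "x + s *\<^sub>C v \<in> ball z r" if "x \<in> ball z (r / 2)" "cmod s < \<rho>" for x s
    proof -
      have "cmod s * norm v < \<rho> * norm v" using that v by simp
      then have "cmod s * norm v < r / 2" using v by (simp add: \<rho>_def)
      then show ?thesis
        using that norm_triangle_ineq[of "x - z" "s *\<^sub>C v"]
        by (auto simp: dist_norm norm_minus_commute algebra_simps)
    qed
    \<comment> \<open>First-order Taylor expansion along the direction v. The constant C is the same
      for all x in the smaller ball, which makes the difference quotients converge
      uniformly.\<close>
    have est: "cmod ((f (x + s *\<^sub>C v) - f x) / s - fd f x v) \<le> C * cmod s"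
      if x: "x \<in> ball z (r / 2)" and s: "cmod s \<le> \<rho> / 2" "s \<noteq> 0" for x s
    proof -
      define h where "h = (\<lambda>s. f (x + s *\<^sub>C v))"
      have "cmod (h s - (\<Sum>i\<le>1. (deriv ^^ i) h 0 * s ^ i / fact i)) \<le> C * cmod s ^ Suc 1 / fact 1"
        unfolding C_def
      proof (rule taylor_disc[OF _ \<rho> _ s(1)])
        show "h holomorphic_on ball 0 \<rho>"
          unfolding h_def by (rule line_holomorphic[OF f]) (use in_ball[OF x] r in auto)
        show "cmod (h t) \<le> B" if "t \<in> ball 0 \<rho>" for t
          unfolding h_def by (rule B[OF in_ball[OF x]]) (use that in auto)
      qed
      moreover have "deriv h 0 = fd f x v"
        unfolding h_def
        using DERIV_imp_deriv[OF line_field_derivative[OF f, of x 0 v]] in_ball[OF x, of 0] \<rho> r by auto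
      ultimately have "cmod (h s - h 0 - fd f x v * s) \<le> C * (cmod s * cmod s)"
        by (simp add: diff_diff_eq)
      then have "cmod ((h s - h 0 - fd f x v * s) / s) \<le> C * cmod s"
        using s(2) by (simp add: norm_divide field_simps)
      also have "(h s - h 0 - fd f x v * s) / s = (h s - h 0) / s - fd f x v"
        using s(2) by (simp add: field_simps)
      finally show ?thesis by (simp add: h_def)
    qed
    \<comment> \<open>Shifting the index by K keeps every step \<sigma> k within the radius \<rho> /
      2 that \<open>est\<close> allows.\<close>
    obtain K :: nat where K: "real K > 2 / \<rho>" using reals_Archimedean2 by blast
    define \<sigma> :: "nat \<Rightarrow> complex" where "\<sigma> k = of_real (1 / real (Suc k + K))" for k
    have \<sigma>: "cmod (\<sigma> k) \<le> \<rho> / 2" "\<sigma> k \<noteq> 0" "cmod (\<sigma> k) \<le> 1 / real (Suc k)" for k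
    proof -
      have "1 / real (Suc k + K) \<le> \<rho> / 2"
        using K \<rho> by (simp add: field_simps) (smt (verit) mult_nonneg_nonneg of_nat_0_le_iff)
      then show "cmod (\<sigma> k) \<le> \<rho> / 2" by (simp only: \<sigma>_def norm_of_real) simp
      show "\<sigma> k \<noteq> 0" by (simp only: \<sigma>_def of_real_eq_0_iff) simp
      show "cmod (\<sigma> k) \<le> 1 / real (Suc k)"
        by (simp only: \<sigma>_def norm_of_real) (simp add: field_simps)
    qed
    have "holo (\<lambda>x. fd f x v) (ball z (r / 2))"
    proof (rule holo_uniform_limit[OF open_ball])
      show "holo (\<lambda>x. (f (x + \<sigma> k *\<^sub>C v) - f x) / \<sigma> k) (ball z (r / 2))" for k
      proof (intro holo_divide holo_diff holo_const)
        show "holo (\<lambda>x. f (x + \<sigma> k *\<^sub>C v)) (ball z (r / 2))"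
          by (rule holo_compose[OF f]) (use holo_add[OF holo_id holo_const] in_ball r \<sigma>[of k] \<rho> in \<open>force\<close>)+
        show "holo f (ball z (r / 2))"
          by (rule holo_subset[OF f]) (use r in auto)
      qed (rule \<sigma>)
      show "uniform_limit (ball z (r / 2)) (\<lambda>k x. (f (x + \<sigma> k *\<^sub>C v) - f x) / \<sigma> k) (\<lambda>x. fd f x v) sequentially"
      proof (rule uniform_limitI)
        fix e :: real assume e: "e > 0"
        have "(\<lambda>k. \<bar>C\<bar> * (1 / real (Suc k))) \<longlonglongrightarrow> \<bar>C\<bar> * 0"
          by (intro tendsto_intros LIMSEQ_Suc[OF lim_1_over_n])
        then have "\<forall>\<^sub>F k in sequentially. \<bar>C\<bar> * (1 / real (Suc k)) < e"
          using e order_tendstoD(2) by fastforce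
        then show "\<forall>\<^sub>F k in sequentially. \<forall>x\<in>ball z (r / 2). dist ((f (x + \<sigma> k *\<^sub>C v) - f x) / \<sigma> k) (fd f x v) < e"
        proof eventually_elim
          case (elim k)
          show ?case
          proof
            fix x assume x: "x \<in> ball z (r / 2)"
            have "cmod ((f (x + \<sigma> k *\<^sub>C v) - f x) / \<sigma> k - fd f x v) \<le> C * cmod (\<sigma> k)"
              by (rule est[OF x \<sigma>(1,2)])
            also have "\<dots> \<le> \<bar>C\<bar> * cmod (\<sigma> k)" by (intro mult_right_mono) auto
            also have "\<dots> \<le> \<bar>C\<bar> * (1 / real (Suc k))" by (intro mult_left_mono \<sigma>) auto
            finally show "dist ((f (x + \<sigma> k *\<^sub>C v) - f x) / \<sigma> k) (fd f x v) < e"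
              using elim by (simp add: dist_norm)
          qed
        qed
      qed
    qed
    then show "\<exists>D. ((\<lambda>z. fd f z v) has_derivative D) (at z) \<and> clinear D"
      unfolding holo_def using r by (meson centre_in_ball half_gt_zero)
  qed
qed

lemma fd_nth:
  assumes "f differentiable (at z)"
  shows "fd (\<lambda>z. f z $ i) z v = fd f z v $ i"
proof -
  have "((\<lambda>z. f z $ i) has_derivative (\<lambda>v. fd f z v $ i)) (at z)"
    using assms bounded_linear.has_derivative[OF bounded_linear_vec_nth] frechet_derivative_works by blast
  then show ?thesis using fd_eq by metis
qed

lemma holo_fd_vec:
  fixes f :: "'a::cvec \<Rightarrow> complex ^ 'm"
  assumes S: "open S" and f: "holo f S"
  shows "holo (\<lambda>z. fd f z v) S"
proof (rule holo_vec)
  fix i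
  have "holo (\<lambda>z. fd (\<lambda>z. f z $ i) z v) S"
    by (rule holo_fd[OF S holo_nth[OF f]])
  then show "holo (\<lambda>z. fd f z v $ i) S"
    using holo_cong[OF S, of "\<lambda>z. fd (\<lambda>z. f z $ i) z v" "\<lambda>z. fd f z v $ i"] fd_nth holo_differentiable[OF f] by blast
qed

section \<open>Identity theorems\<close>

text \<open>Restrict to the complex line through p and z. Convexity of S makes the admissible
  parameters convex, hence connected, so one-variable continuation leads from the parameters near 0
  to the parameter 1.\<close>

lemma holo_identity:
  fixes f :: "'a::cvec \<Rightarrow> complex"
  assumes f: "holo f S" and S: "open S" "convex S" and W: "open W" "W \<subseteq> S" "p \<in> W"
    and zero: "\<And>z. z \<in> W \<Longrightarrow> f z = 0" and z: "z \<in> S"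
  shows "f z = 0"
proof -
  define T where "T = {s. p + s *\<^sub>C (z - p) \<in> S}"
  define T0 where "T0 = {s. p + s *\<^sub>C (z - p) \<in> W}"
  have "(\<lambda>s. f (p + s *\<^sub>C (z - p))) 1 = 0"
  proof (rule analytic_continuation_open[where s = T0 and s' = T and g = "\<lambda>_. 0" and f = "\<lambda>s. f (p + s *\<^sub>C (z - p))"])
    show "open T0" "open T" unfolding T_def T0_def by (rule open_line W S)+
    show "T0 \<noteq> {}" using W by (auto simp: T0_def intro!: exI[of _ 0])
    have "convex T"
    proof (rule convexI)
      fix x y :: complex and u v :: real
      assume *: "x \<in> T" "y \<in> T" "0 \<le> u" "0 \<le> v" "u + v = 1"
      then have "u *\<^sub>R (p + x *\<^sub>C (z - p)) + v *\<^sub>R (p + y *\<^sub>C (z - p)) \<in> S"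
        using S(2) by (intro convexD) (auto simp: T_def)
      also have "u *\<^sub>R (p + x *\<^sub>C (z - p)) + v *\<^sub>R (p + y *\<^sub>C (z - p))
        = (u + v) *\<^sub>R p + (u *\<^sub>R x + v *\<^sub>R y) *\<^sub>C (z - p)"
        by (simp add: cscale_def algebra_simps)
      finally show "u *\<^sub>R x + v *\<^sub>R y \<in> T" using * by (simp add: T_def)
    qed
    then show "connected T" by (rule convex_connected)
    show "T0 \<subseteq> T" using W by (auto simp: T_def T0_def)
    show "(\<lambda>s. f (p + s *\<^sub>C (z - p))) holomorphic_on T"
      by (rule line_holomorphic[OF f]) (simp add: T_def)
    show "f (p + s *\<^sub>C (z - p)) = 0" if "s \<in> T0" for s
      using that zero by (simp add: T0_def)
    show "1 \<in> T" using z by (simp add: T_def)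
  qed auto
  then show ?thesis by simp
qed

text \<open>On the line through c + x in direction y the function vanishes at the real parameters
  near 0. These accumulate at 0, so it vanishes on the whole disc of parameters; as that disc has
  radius \<delta> > 1, it contains \<i>.\<close>

lemma holo_zero_totally_real:
  fixes f :: "'a::cvec \<Rightarrow> complex"
  assumes f: "holo f (ball c \<rho>)" and R: "subspace R"
    and zero: "\<And>x. x \<in> R \<Longrightarrow> norm x < \<rho> \<Longrightarrow> f (c + x) = 0"
    and x: "x \<in> R" and y: "y \<in> R" and xy: "norm x + norm y < \<rho>"
  shows "f (c + x + J y) = 0"
proof (cases "y = 0")
  case True
  then show ?thesis using zero[OF x] xy by simp
next
  case False
  define \<delta> where "\<delta> = (\<rho> - norm x) / norm y"
  have \<delta>: "\<delta> > 1" using False xy by (simp add: \<delta>_def field_simps)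
  have in_ball: "norm (x + s *\<^sub>C y) < \<rho>" if "cmod s < \<delta>" for s
  proof -
    have "cmod s * norm y < \<rho> - norm x" using that False by (simp add: \<delta>_def field_simps)
    then show ?thesis using norm_triangle_ineq[of x "s *\<^sub>C y"] by simp
  qed
  have "f ((c + x) + \<i> *\<^sub>C y) = 0"
  proof (rule analytic_continuation[where f = "\<lambda>s. f ((c + x) + s *\<^sub>C y)" and S = "ball 0 \<delta>"
        and U = "complex_of_real ` {-1<..<1}" and \<xi> = 0])
    show "(\<lambda>s. f ((c + x) + s *\<^sub>C y)) holomorphic_on ball 0 \<delta>"
      by (rule line_holomorphic[OF f]) (use in_ball in \<open>simp add: add.assoc mem_ball_add del: mem_ball\<close>)
    show "complex_of_real ` {-1<..<1} \<subseteq> ball 0 \<delta>" using \<delta> by auto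
    show "0 islimpt complex_of_real ` {-1<..<1}"
      unfolding islimpt_approachable
    proof (intro allI impI)
      fix e :: real assume "e > 0"
      then have "complex_of_real (min (e / 2) (1 / 2)) \<in> complex_of_real ` {-1<..<1} \<and>
          complex_of_real (min (e / 2) (1 / 2)) \<noteq> 0 \<and> dist (complex_of_real (min (e / 2) (1 / 2))) 0 < e"
        by (intro conjI imageI) (auto simp del: of_real_divide simp: min_def)
      then show "\<exists>x'\<in>complex_of_real ` {-1<..<1}. x' \<noteq> 0 \<and> dist x' 0 < e" by blast
    qed
    show "f (c + x + s *\<^sub>C y) = 0" if sU: "s \<in> complex_of_real ` {-1<..<1}" for s
    proof -
      obtain t where "s = complex_of_real t" "t \<in> {-1<..<1}" using sU by blast
      then have t: "s = complex_of_real t" "\<bar>t\<bar> < 1" by auto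
      have "x + s *\<^sub>C y \<in> R" using R x y by (simp add: t cscale_of_real subspace_add subspace_scale)
      then show ?thesis using zero[OF _ in_ball[of s]] t \<delta> by (simp add: add.assoc)
    qed
  qed (use \<delta> in auto)
  then show ?thesis by (simp add: cscale_ii)
qed

section \<open>Holomorphic fixed points\<close>

lemma holo_lipschitz:
  fixes f :: "'a::cvec \<Rightarrow> complex"
  assumes f: "holo f S" and T: "convex T" "T \<subseteq> S" and r: "r > 0"
    and ball: "\<And>x. x \<in> T \<Longrightarrow> ball x r \<subseteq> S" and B: "\<And>y. y \<in> S \<Longrightarrow> cmod (f y) \<le> B"
    and xy: "x \<in> T" "y \<in> T"
  shows "cmod (f x - f y) \<le> 2 * B / r * norm (x - y)"
proof (rule differentiable_bound[OF T(1) _ _ xy(1) xy(2)])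
  show "(f has_derivative fd f x) (at x within T)" if "x \<in> T" for x
    using holo_has_derivative[OF f] T that has_derivative_at_withinI by blast
  show "onorm (fd f x) \<le> 2 * B / r" if "x \<in> T" for x
  proof (rule onorm_le)
    show "cmod (fd f x v) \<le> 2 * B / r * norm v" for v
      by (rule holo_fd_bound[OF holo_subset[OF f ball[OF that]] B r]) (use ball[OF that] in auto)
  qed
qed

text \<open>An implicit function theorem with explicit domains. The bound \<rho> / 8 and
  \<open>holo_lipschitz\<close> give the contraction constant 2 (\<rho> / 8) / (\<rho> / 2) = 1/2 on
  the half disc. The iterates of the constant s0 are holomorphic in the parameter and converge
  uniformly at rate 2^(-k).\<close>

lemma holo_fixpoint:
  fixes h :: "'a::cvec \<times> complex \<Rightarrow> complex"
  assumes S: "open S" and h: "holo h (S \<times> ball s0 \<rho>)" and \<rho>: "\<rho> > 0"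
    and B: "\<And>Z s. Z \<in> S \<Longrightarrow> s \<in> ball s0 \<rho> \<Longrightarrow> cmod (h (Z, s) - s0) \<le> \<rho> / 8"
  obtains g where "holo g S" "\<And>Z. Z \<in> S \<Longrightarrow> cmod (g Z - s0) \<le> \<rho> / 8" "\<And>Z. Z \<in> S \<Longrightarrow> h (Z, g Z) = g Z"
    "\<And>Z s. Z \<in> S \<Longrightarrow> s \<in> ball s0 (\<rho> / 2) \<Longrightarrow> h (Z, s) = s \<Longrightarrow> s = g Z"
proof -
  have lip: "dist (h (Z, s)) (h (Z, t)) \<le> 1 / 2 * dist s t"
    if Z: "Z \<in> S" and st: "s \<in> ball s0 (\<rho> / 2)" "t \<in> ball s0 (\<rho> / 2)" for Z s t
  proof -
    have "cmod ((h (Z, s) - s0) - (h (Z, t) - s0)) \<le> 2 * (\<rho> / 8) / (\<rho> / 2) * norm (s - t)"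
    proof (rule holo_lipschitz[where S = "ball s0 \<rho>" and T = "ball s0 (\<rho> / 2)" and f = "\<lambda>s. h (Z, s) - s0"])
      show "holo (\<lambda>s. h (Z, s) - s0) (ball s0 \<rho>)"
        by (intro holo_diff holo_const holo_compose[OF h] holo_Pair holo_id) (use Z in auto)
      show "ball x (\<rho> / 2) \<subseteq> ball s0 \<rho>" if "x \<in> ball s0 (\<rho> / 2)" for x
      proof
        fix y assume "y \<in> ball x (\<rho> / 2)"
        then show "y \<in> ball s0 \<rho>" using that dist_triangle[of s0 y x] by simp
      qed
      show "cmod (h (Z, y) - s0) \<le> \<rho> / 8" if "y \<in> ball s0 \<rho>" for y
        using B Z that by auto
    qed (use \<rho> st in auto)
    then show ?thesis using \<rho> by (simp add: dist_norm)
  qed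
  have small: "cball s0 (\<rho> / 8) \<subseteq> ball s0 (\<rho> / 2)" "cball s0 (\<rho> / 8) \<subseteq> ball s0 \<rho>"
    "ball s0 (\<rho> / 2) \<subseteq> ball s0 \<rho>" using \<rho> by auto
  have h_in: "h (Z, s) \<in> cball s0 (\<rho> / 8)" if "Z \<in> S" "s \<in> ball s0 \<rho>" for Z s
    using B[OF that] by (simp add: dist_norm norm_minus_commute)
  have "\<exists>s. s \<in> cball s0 (\<rho> / 8) \<and> h (Z, s) = s" if Z: "Z \<in> S" for Z
  proof -
    have "\<exists>!s. s \<in> cball s0 (\<rho> / 8) \<and> h (Z, s) = s"
    proof (rule Banach_fix[where c = "1 / 2"])
      show "complete (cball s0 (\<rho> / 8))" by (simp add: complete_eq_closed)
      show "cball s0 (\<rho> / 8) \<noteq> {}" using \<rho> by simp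
      show "(\<lambda>s. h (Z, s)) ` cball s0 (\<rho> / 8) \<subseteq> cball s0 (\<rho> / 8)"
        using h_in[OF Z] small by blast
      show "dist (h (Z, x)) (h (Z, y)) \<le> 1 / 2 * dist x y" if "x \<in> cball s0 (\<rho> / 8)" "y \<in> cball s0 (\<rho> / 8)" for x y
        using lip[OF Z] small that by blast
    qed auto
    then show ?thesis by blast
  qed
  then obtain g where g: "\<And>Z. Z \<in> S \<Longrightarrow> g Z \<in> cball s0 (\<rho> / 8)" "\<And>Z. Z \<in> S \<Longrightarrow> h (Z, g Z) = g Z"
    by metis
  define G where "G k Z = ((\<lambda>s. h (Z, s)) ^^ k) s0" for k Z
  have G_Suc: "G (Suc k) Z = h (Z, G k Z)" and G_0: "G 0 Z = s0" for k Z
    by (simp_all add: G_def)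
  have G_in: "G k Z \<in> cball s0 (\<rho> / 8)" if "Z \<in> S" for k Z
    by (induction k) (use \<rho> h_in[OF that] small in \<open>auto simp: G_Suc G_0\<close>)
  have G_dist: "dist (G k Z) (g Z) \<le> (1 / 2) ^ k * \<rho>" if Z: "Z \<in> S" for k Z
  proof (induction k)
    case 0
    then show ?case using g(1)[OF Z] \<rho> by (simp add: G_0)
  next
    case (Suc k)
    have "dist (G (Suc k) Z) (g Z) = dist (h (Z, G k Z)) (h (Z, g Z))"
      by (simp add: G_Suc g(2)[OF Z])
    also have "\<dots> \<le> 1 / 2 * dist (G k Z) (g Z)"
      using lip[OF Z] G_in[OF Z] g(1)[OF Z] small by blast
    finally show ?case using Suc by simp
  qed
  have "holo (G k) S" for k
  proof (induction k)
    case 0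
    then show ?case by (simp add: G_0[abs_def] holo_const)
  next
    case (Suc k)
    have "G k Z \<in> ball s0 \<rho>" if "Z \<in> S" for Z using G_in[OF that] small by blast
    then show ?case
      unfolding G_Suc[abs_def]
      by (intro holo_compose[OF h] holo_Pair holo_id Suc) simp
  qed
  moreover have "uniform_limit S G g sequentially"
  proof (rule uniform_limitI)
    fix e :: real assume "e > 0"
    have "(\<lambda>k. (1 / 2) ^ k * \<rho>) \<longlonglongrightarrow> 0 * \<rho>" by (intro tendsto_intros LIMSEQ_power_zero) auto
    then have "\<forall>\<^sub>F k in sequentially. (1 / 2) ^ k * \<rho> < e"
      using \<open>e > 0\<close> order_tendstoD(2) by fastforce
    then show "\<forall>\<^sub>F k in sequentially. \<forall>Z\<in>S. dist (G k Z) (g Z) < e"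
      by eventually_elim (use G_dist in \<open>blast intro: le_less_trans\<close>)
  qed
  ultimately have "holo g S" by (rule holo_uniform_limit[OF S])
  moreover have "s = g Z" if "Z \<in> S" "s \<in> ball s0 (\<rho> / 2)" "h (Z, s) = s" for Z s
  proof -
    have "dist s (g Z) \<le> 1 / 2 * dist s (g Z)"
      using lip[OF that(1,2), of "g Z"] g[OF that(1)] small that(3) by auto
    then show ?thesis by simp
  qed
  ultimately show ?thesis
    using that[of g] g by (auto simp: dist_norm norm_minus_commute)
qed

section \<open>Second derivatives and Taylor expansion\<close>

definition hess :: "('a::cvec \<Rightarrow> complex) \<Rightarrow> 'a \<Rightarrow> 'a \<Rightarrow> 'a \<Rightarrow> complex"
  where "hess f z u v = fd (\<lambda>z. fd f z u) z v"

context
  fixes f :: "'a::cvec \<Rightarrow> complex" and S :: "'a set"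
  assumes S: "open S" and f: "holo f S"
begin

lemma hess_clinear_right: "z \<in> S \<Longrightarrow> clinear (hess f z u)"
  unfolding hess_def[abs_def] by (rule holo_clinear[OF holo_fd[OF S f]])

lemma hess_clinear_left:
  assumes z: "z \<in> S"
  shows "clinear (\<lambda>u. hess f z u v)"
proof -
  note d = holo_has_derivative[OF holo_fd[OF S f] z]
  have "hess f z (u + u') v = hess f z u v + hess f z u' v" for u u'
  proof -
    have "fd (\<lambda>z. fd f z (u + u')) z = fd (\<lambda>z. fd f z u + fd f z u') z"
      by (rule fd_cong[OF S z]) (rule holo_fd_add[OF f])
    also have "\<dots> = (\<lambda>v. fd (\<lambda>z. fd f z u) z v + fd (\<lambda>z. fd f z u') z v)"
      by (rule fd_eq[OF has_derivative_add[OF d d]])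
    finally show ?thesis by (simp add: hess_def)
  qed
  moreover have *: "hess f z (s *\<^sub>C u) v = s *\<^sub>C hess f z u v" for s u
  proof -
    have "fd (\<lambda>z. fd f z (s *\<^sub>C u)) z = fd (\<lambda>z. s *\<^sub>C fd f z u) z"
      by (rule fd_cong[OF S z]) (rule holo_fd_cscale[OF f])
    also have "\<dots> = (\<lambda>v. s *\<^sub>C fd (\<lambda>z. fd f z u) z v)"
      by (rule fd_eq[OF bounded_linear.has_derivative[OF bounded_linear_cscale_right d]])
    finally show ?thesis by (simp add: hess_def)
  qed
  ultimately show ?thesis
    unfolding clinear_def
    using *[of "complex_of_real _"] *[of \<i>] by (auto intro!: linearI simp: cscale_of_real cscale_ii simp del: cscale_complex)
qed

end

text \<open>\<open>taylor_disc\<close> with n = 2 on the line spanned by v; 192 is 3! * 4^3 /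
  2!.\<close>

lemma holo_taylor2:
  fixes f :: "'a::cvec \<Rightarrow> complex"
  assumes f: "holo f (ball 0 \<rho>)" and \<rho>: "\<rho> > 0" and B: "\<And>y. y \<in> ball 0 \<rho> \<Longrightarrow> cmod (f y) \<le> B"
    and v: "norm v \<le> \<rho> / 2"
  shows "cmod (f v - f 0 - fd f 0 v - hess f 0 v v / 2) \<le> 192 * B / \<rho> ^ 3 * norm v ^ 3"
proof (cases "v = 0")
  case True
  have 0: "0 \<in> ball 0 \<rho>" using \<rho> by simp
  show ?thesis
    using True clinear_zero[OF hess_clinear_left[OF open_ball f 0]] clinear_zero[OF hess_clinear_right[OF open_ball f 0]]
      clinear_zero[OF holo_clinear[OF f 0]] by simp
next
  case False
  have 0: "0 \<in> ball 0 \<rho>" using \<rho> by simp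
  define u where "u = (1 / norm v) *\<^sub>R v"
  have u: "norm u = 1" and vu: "v = complex_of_real (norm v) *\<^sub>C u"
    using False by (auto simp: u_def cscale_of_real)
  define h where "h = (\<lambda>s. f (0 + s *\<^sub>C u))"
  have in_ball: "0 + s *\<^sub>C u \<in> ball 0 \<rho>" if "s \<in> ball 0 \<rho>" for s
    using that by (simp add: u)
  have hol: "h holomorphic_on ball 0 \<rho>"
    unfolding h_def by (rule line_holomorphic[OF f in_ball])
  have d1: "deriv h s = fd f (0 + s *\<^sub>C u) u" if "s \<in> ball 0 \<rho>" for s
    unfolding h_def by (rule DERIV_imp_deriv[OF line_field_derivative[OF f in_ball[OF that]]])
  have "deriv (deriv h) 0 = deriv (\<lambda>s. fd f (0 + s *\<^sub>C u) u) 0"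
  proof (rule deriv_cong_ev)
    show "\<forall>\<^sub>F s in nhds 0. deriv h s = fd f (0 + s *\<^sub>C u) u"
      using eventually_nhds_in_open[OF open_ball, of 0 0 \<rho>] \<rho> d1 by (auto elim!: eventually_mono)
  qed simp
  also have "\<dots> = hess f 0 u u"
    unfolding hess_def
    using DERIV_imp_deriv[OF line_field_derivative[OF holo_fd[OF open_ball f], of 0 0 u u]] 0 by simp
  finally have d2: "deriv (deriv h) 0 = hess f 0 u u" .
  have "cmod (h (norm v) - (\<Sum>i\<le>2. (deriv ^^ i) h 0 * complex_of_real (norm v) ^ i / fact i))
    \<le> fact (Suc 2) * B / (\<rho> / 4) ^ Suc 2 * cmod (complex_of_real (norm v)) ^ Suc 2 / fact 2"
    by (rule taylor_disc[OF hol \<rho>]) (use B in_ball v in \<open>auto simp: h_def u\<close>)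
  also have "(\<Sum>i\<le>2. (deriv ^^ i) h 0 * complex_of_real (norm v) ^ i / fact i)
    = f 0 + fd f 0 v + hess f 0 v v / 2"
  proof -
    have "fd f 0 v = norm v * fd f 0 u"
      by (subst vu, subst holo_fd_cscale[OF f 0]) simp
    moreover have "hess f 0 v v = norm v * (norm v * hess f 0 u u)"
      using clinear_cscale[OF hess_clinear_left[OF open_ball f 0], of "complex_of_real (norm v)" u v]
        clinear_cscale[OF hess_clinear_right[OF open_ball f 0], of u "complex_of_real (norm v)" u] vu
      by (simp del: norm_cscale)
    ultimately show ?thesis
      using d1[of 0] \<rho> d2 by (simp add: numeral_2_eq_2 h_def power2_eq_square mult.commute)
  qed
  finally show ?thesis
    using vu by (simp add: h_def fact_numeral power_divide power3_eq_cube diff_diff_eq cscale_of_real mult_ac)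
qed

section \<open>Hadamard's lemma and square roots of holomorphic matrices\<close>

text \<open>This makes the Hadamard coefficients holomorphic. \<open>leibniz_rule\<close> wants the
  derivative as a bounded linear function that is jointly continuous in z and s, hence the passage
  through \<open>Blinfun\<close>.\<close>

lemma holo_integral:
  fixes g :: "'a::cvec \<Rightarrow> complex"
  assumes g: "holo g (ball 0 \<rho>)"
  shows "holo (\<lambda>z. integral (cbox 0 1) (\<lambda>s::real. g (s *\<^sub>R z))) (ball 0 \<rho>)"
proof -
  define D where "D z s = Blinfun (\<lambda>v. fd g (s *\<^sub>R z) (s *\<^sub>R v))" for z and s :: real
  have in_ball: "s *\<^sub>R z \<in> ball 0 \<rho>" if "z \<in> ball 0 \<rho>" "s \<in> cbox 0 1" for s and z :: 'a
  proof -
    have "\<bar>s\<bar> * norm z \<le> 1 * norm z" using that(2) by (intro mult_right_mono) auto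
    then show ?thesis using that(1) by simp
  qed
  have cl: "clinear (\<lambda>v. fd g (s *\<^sub>R z) (s *\<^sub>R v))" if "z \<in> ball 0 \<rho>" "s \<in> cbox 0 1" for s and z :: 'a
    using clinear_compose[OF clinear_cscale_right[of "complex_of_real s"] holo_clinear[OF g in_ball[OF that]]]
    by (simp add: cscale_of_real)
  have D: "blinfun_apply (D z s) v = fd g (s *\<^sub>R z) (s *\<^sub>R v)" if "z \<in> ball 0 \<rho>" "s \<in> cbox 0 1" for z :: 'a and s v
    unfolding D_def using bounded_linear_Blinfun_apply[OF clinear_bounded_linear[OF cl[OF that]]] by simp
  have contD: "continuous_on (ball 0 \<rho> \<times> cbox 0 1) (\<lambda>(z, s). D z s)"
  proof (rule continuous_on_blinfun_componentwise)
    fix i :: 'a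
    have "continuous_on (ball 0 \<rho> \<times> cbox 0 1) (\<lambda>p. snd p *\<^sub>R fd g (snd p *\<^sub>R fst p) i)"
      by (intro continuous_intros continuous_on_compose2[OF holo_continuous_on[OF holo_fd[OF open_ball g]]])
        (use in_ball in auto)
    then show "continuous_on (ball 0 \<rho> \<times> cbox 0 1) (\<lambda>p. blinfun_apply (case p of (z, s) \<Rightarrow> D z s) i)"
      by (rule continuous_on_eq) (use D in_ball in \<open>auto simp: clinear_scaleR[OF holo_clinear[OF g]]\<close>)
  qed
  show ?thesis
  proof (rule holoI)
    fix z :: 'a assume z: "z \<in> ball 0 \<rho>"
    have "((\<lambda>z. integral (cbox 0 1) (\<lambda>s::real. g (s *\<^sub>R z))) has_derivative
      blinfun_apply (integral (cbox 0 1) (D z))) (at z within ball 0 \<rho>)"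
    proof (rule leibniz_rule[OF _ _ contD z convex_ball])
      fix x :: 'a assume x: "x \<in> ball 0 \<rho>"
      show "((\<lambda>x. g (s *\<^sub>R x)) has_derivative blinfun_apply (D x s)) (at x within ball 0 \<rho>)"
        if s: "s \<in> cbox 0 1" for s
      proof -
        have "((\<lambda>x. s *\<^sub>R x) has_derivative (\<lambda>v. s *\<^sub>R v)) (at x)"
          by (auto intro!: derivative_eq_intros)
        from has_derivative_compose[OF this holo_has_derivative[OF g in_ball[OF x s]]]
        have "((\<lambda>x. g (s *\<^sub>R x)) has_derivative (\<lambda>v. fd g (s *\<^sub>R x) (s *\<^sub>R v))) (at x)" .
        moreover have "blinfun_apply (D x s) = (\<lambda>v. fd g (s *\<^sub>R x) (s *\<^sub>R v))"
          using D[OF x s] by blast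
        ultimately show ?thesis by (simp add: has_derivative_at_withinI)
      qed
      show "(\<lambda>s. g (s *\<^sub>R x)) integrable_on cbox 0 1"
        by (intro integrable_continuous continuous_on_compose2[OF holo_continuous_on[OF g]] continuous_intros)
          (use in_ball[OF x] in auto)
    qed
    then show "((\<lambda>z. integral (cbox 0 1) (\<lambda>s::real. g (s *\<^sub>R z))) has_derivative
      blinfun_apply (integral (cbox 0 1) (D z))) (at z)"
      using at_within_open[OF z open_ball] by simp
    have contDz: "continuous_on (cbox 0 1) (D z)"
    proof -
      have "continuous_on (cbox 0 1) (\<lambda>s::real. (z, s))" by (intro continuous_intros)
      moreover have "(\<lambda>s::real. (z, s)) ` cbox 0 1 \<subseteq> ball 0 \<rho> \<times> cbox 0 1" using z by auto
      ultimately show ?thesis using continuous_on_compose2[OF contD] by fastforce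
    qed
    have app: "blinfun_apply (integral (cbox 0 1) (D z)) v = integral (cbox 0 1) (\<lambda>s. blinfun_apply (D z s) v)" for v
      by (rule blinfun_apply_integral[OF integrable_continuous[OF contDz]])
    show "clinear (blinfun_apply (integral (cbox 0 1) (D z)))"
      unfolding clinear_def
    proof (intro conjI allI)
      show "linear (blinfun_apply (integral (cbox 0 1) (D z)))"
        by (simp add: bounded_linear.linear blinfun.bounded_linear_right)
      fix v
      have "integral (cbox 0 1) (\<lambda>s. blinfun_apply (D z s) (J v)) = integral (cbox 0 1) (\<lambda>s. \<i> * blinfun_apply (D z s) v)"
        by (rule integral_cong) (use D[OF z] clinear_J[OF cl[OF z]] in \<open>simp add: J_complex_def\<close>)
      then show "blinfun_apply (integral (cbox 0 1) (D z)) (J v) = J (blinfun_apply (integral (cbox 0 1) (D z)) v)"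
        unfolding app J_complex_def by (simp only: integral_mult_right)
    qed
  qed
qed

lemma vec_axis_expansion: "v = (\<Sum>i\<in>UNIV. (v $ i) *\<^sub>C axis i (1::complex))"
  by (simp add: vec_eq_iff axis_def if_distrib[of "\<lambda>x. _ * x"] cong: if_cong)

lemma clinear_sum: "clinear D \<Longrightarrow> D (\<Sum>i\<in>A. g i) = (\<Sum>i\<in>A. D (g i))"
  using clinear_linear linear_sum by blast

lemma clinear_vec_expansion:
  fixes D :: "complex^'n \<Rightarrow> complex"
  assumes "clinear D"
  shows "D v = (\<Sum>i\<in>UNIV. v $ i * D (axis i 1))"
  by (subst vec_axis_expansion, simp add: clinear_sum[OF assms] clinear_cscale[OF assms])

text \<open>The coefficient of z_i in Hadamard's expansion, which arises by integrating the
  derivative of f (s z) in s over [0, 1].\<close>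

definition hadamard :: "(complex^'n \<Rightarrow> complex) \<Rightarrow> 'n \<Rightarrow> complex^'n \<Rightarrow> complex"
  where "hadamard f i z = integral (cbox 0 1) (\<lambda>s::real. fd f (s *\<^sub>R z) (axis i 1))"

lemma holo_hadamard: "holo f (ball 0 \<rho>) \<Longrightarrow> holo (hadamard f i) (ball 0 \<rho>)"
  unfolding hadamard_def[abs_def] by (intro holo_integral holo_fd open_ball)

lemma hadamard_expansion:
  fixes f :: "complex^'n \<Rightarrow> complex"
  assumes f: "holo f (ball 0 \<rho>)" and z: "z \<in> ball 0 \<rho>"
  shows "f z = f 0 + (\<Sum>i\<in>UNIV. z $ i * hadamard f i z)"
proof -
  have in_ball: "s *\<^sub>R z \<in> ball 0 \<rho>" if "s \<in> {0..1}" for s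
  proof -
    have "\<bar>s\<bar> * norm z \<le> 1 * norm z" using that by (intro mult_right_mono) auto
    then show ?thesis using z by simp
  qed
  have "((\<lambda>s. fd f (s *\<^sub>R z) z) has_integral (f (1 *\<^sub>R z) - f (0 *\<^sub>R z))) {0..1}"
  proof (rule fundamental_theorem_of_calculus)
    fix s :: real assume s: "s \<in> {0..1}"
    have "((\<lambda>s. s *\<^sub>R z) has_derivative (\<lambda>t. t *\<^sub>R z)) (at s)"
      by (auto intro!: derivative_eq_intros)
    from has_derivative_compose[OF this holo_has_derivative[OF f in_ball[OF s]]]
    have "((\<lambda>s. f (s *\<^sub>R z)) has_derivative (\<lambda>t. fd f (s *\<^sub>R z) (t *\<^sub>R z))) (at s)" .
    then show "((\<lambda>s. f (s *\<^sub>R z)) has_vector_derivative fd f (s *\<^sub>R z) z) (at s within {0..1})"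
      using has_derivative_at_withinI
      by (auto simp: has_vector_derivative_def clinear_scaleR[OF holo_clinear[OF f in_ball[OF s]]])
  qed simp
  moreover have "((\<lambda>s. fd f (s *\<^sub>R z) z) has_integral (\<Sum>i\<in>UNIV. z $ i * hadamard f i z)) {0..1}"
  proof -
    have "((\<lambda>s. \<Sum>i\<in>UNIV. z $ i * fd f (s *\<^sub>R z) (axis i 1)) has_integral (\<Sum>i\<in>UNIV. z $ i * hadamard f i z)) {0..1}"
    proof (intro has_integral_sum has_integral_mult_right)
      fix i
      have "(\<lambda>s. fd f (s *\<^sub>R z) (axis i 1)) integrable_on cbox (0::real) 1"
        by (intro integrable_continuous continuous_on_compose2[OF holo_continuous_on[OF holo_fd[OF open_ball f]]] continuous_intros)
          (use in_ball in auto)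
      then show "((\<lambda>s. fd f (s *\<^sub>R z) (axis i 1)) has_integral hadamard f i z) {0..1}"
        unfolding hadamard_def by (simp add: integrable_integral)
    qed simp
    then show ?thesis
      by (rule has_integral_eq[rotated]) (use clinear_vec_expansion[OF holo_clinear[OF f in_ball]] in auto)
  qed
  ultimately have "f (1 *\<^sub>R z) - f (0 *\<^sub>R z) = (\<Sum>i\<in>UNIV. z $ i * hadamard f i z)"
    by (rule has_integral_unique)
  then show ?thesis by (simp add: algebra_simps)
qed

text \<open>The equation \<open>2 X + X\<^sup>2 = E\<close> makes \<open>1 + X\<close> a square root of the matrix \<open>1 + E\<close>.\<close>

lemma holo_matrix_sqrt:
  fixes E :: "'n::finite \<Rightarrow> 'n \<Rightarrow> 'a::cvec \<Rightarrow> complex"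
  assumes S: "open S" and E: "\<And>i j. holo (E i j) S" and sym: "\<And>i j z. E i j z = E j i z"
    and small: "\<And>i j z. z \<in> S \<Longrightarrow> cmod (E i j z) \<le> 1 / (2 * real CARD('n))"
  obtains X where "\<And>i j. holo (X i j) S" "\<And>i j z. z \<in> S \<Longrightarrow> X i j z = X j i z"
    "\<And>i j z. z \<in> S \<Longrightarrow> 2 * X i j z + (\<Sum>k\<in>UNIV. X i k z * X k j z) = E i j z"
    "\<And>i j z. z \<in> S \<Longrightarrow> cmod (X i j z) \<le> 1 / (2 * real CARD('n))"
    "\<And>i z. z \<in> S \<Longrightarrow> (\<And>j. E i j z = 0) \<Longrightarrow> (\<And>j. X i j z = 0)"
    "\<And>i j z z'. (\<And>i j. E i j z = E i j z') \<Longrightarrow> X i j z = X i j z'"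
proof -
  define N where "N = real CARD('n)"
  define \<delta> where "\<delta> = 1 / (2 * N)"
  have N: "N \<ge> 1" unfolding N_def using zero_less_card_finite[where 'a='n] by linarith
  have \<delta>: "\<delta> > 0" "N * \<delta> = 1 / 2" using N by (auto simp: \<delta>_def)
  \<comment> \<open>Picard iteration for X = (E - X X) / 2. Since N * \<delta> = 1/2, the entries
    stay below \<delta> and each step halves the distance between successive iterates.\<close>
  define Y :: "nat \<Rightarrow> 'n \<Rightarrow> 'n \<Rightarrow> 'a \<Rightarrow> complex"
    where "Y = rec_nat (\<lambda>i j z. 0) (\<lambda>_ X i j z. (E i j z - (\<Sum>k\<in>UNIV. X i k z * X k j z)) / 2)"
  have Y0: "Y 0 i j z = 0" and YS: "Y (Suc m) i j z = (E i j z - (\<Sum>k\<in>UNIV. Y m i k z * Y m k j z)) / 2" for m i j z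
    by (simp_all add: Y_def)
  have hol: "holo (Y m i j) S" for m i j
  proof (induction m arbitrary: i j)
    case 0
    then show ?case using holo_const[of 0 S] by (simp add: Y0[abs_def])
  next
    case (Suc m)
    then show ?case
      unfolding YS[abs_def] by (intro holo_divide holo_diff holo_sum holo_mult holo_const E) auto
  qed
  have Ysym: "Y m i j z = Y m j i z" for m i j z
  proof (induction m arbitrary: i j)
    case (Suc m)
    then show ?case by (simp add: YS sym[of i j] mult.commute)
  qed (simp add: Y0)
  have bound: "cmod (Y m i j z) \<le> \<delta>" if z: "z \<in> S" for m i j z
  proof (induction m arbitrary: i j)
    case 0
    then show ?case using \<delta> by (simp add: Y0)
  next
    case (Suc m)
    have "cmod (\<Sum>k\<in>UNIV. Y m i k z * Y m k j z) \<le> (\<Sum>k\<in>(UNIV::'n set). \<delta> * \<delta>)"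
      by (rule sum_norm_le) (auto simp: norm_mult intro!: mult_mono Suc order_less_imp_le[OF \<delta>(1)])
    also have "\<dots> = \<delta> / 2" using \<delta>(2) by (simp add: N_def[symmetric])
    finally have "cmod (E i j z - (\<Sum>k\<in>UNIV. Y m i k z * Y m k j z)) \<le> \<delta> + \<delta> / 2"
      using norm_triangle_ineq4[of "E i j z"] small[OF z, of i j] unfolding N_def[symmetric] \<delta>_def[symmetric]
      by (meson add_mono order_trans)
    then show ?case using \<delta> by (simp add: YS norm_divide)
  qed
  have step: "cmod (Y (Suc m) i j z - Y m i j z) \<le> \<delta> * (1 / 2) ^ m" if z: "z \<in> S" for m i j z
  proof (induction m arbitrary: i j)
    case 0
    then show ?case using bound[OF z, of 1 i j] by (simp add: Y0)
  next
    case (Suc m)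
    have "cmod (\<Sum>k\<in>UNIV. Y (Suc m) i k z * Y (Suc m) k j z - Y m i k z * Y m k j z)
      \<le> (\<Sum>k\<in>(UNIV::'n set). 2 * (\<delta> * (\<delta> * (1 / 2) ^ m)))"
    proof (rule sum_norm_le)
      fix k
      have "Y (Suc m) i k z * Y (Suc m) k j z - Y m i k z * Y m k j z
        = Y (Suc m) i k z * (Y (Suc m) k j z - Y m k j z) + (Y (Suc m) i k z - Y m i k z) * Y m k j z"
        by (simp add: algebra_simps)
      also have "cmod \<dots> \<le> \<delta> * (\<delta> * (1 / 2) ^ m) + (\<delta> * (1 / 2) ^ m) * \<delta>"
        using \<delta> by (intro norm_triangle_mono) (auto simp: norm_mult intro!: mult_mono bound[OF z] Suc)
      finally show "cmod (Y (Suc m) i k z * Y (Suc m) k j z - Y m i k z * Y m k j z) \<le> 2 * (\<delta> * (\<delta> * (1 / 2) ^ m))"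
        by simp
    qed
    also have "\<dots> = 2 * (N * \<delta>) * (\<delta> * (1 / 2) ^ m)" by (simp add: N_def)
    also have "\<dots> = \<delta> * (1 / 2) ^ m" by (simp add: \<delta>(2))
    finally have "cmod (((\<Sum>k\<in>UNIV. Y m i k z * Y m k j z) - (\<Sum>k\<in>UNIV. Y (Suc m) i k z * Y (Suc m) k j z)) / 2)
      \<le> \<delta> * (1 / 2) ^ Suc m"
      by (simp add: norm_divide sum_subtractf norm_minus_commute)
    moreover have "((\<Sum>k\<in>UNIV. Y m i k z * Y m k j z) - (\<Sum>k\<in>UNIV. Y (Suc m) i k z * Y (Suc m) k j z)) / 2
      = Y (Suc (Suc m)) i j z - Y (Suc m) i j z"
      unfolding YS[of "Suc m"] YS[of m i j] by (simp add: diff_divide_distrib)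
    ultimately show ?case by simp
  qed
  define X where "X i j z = (\<Sum>m. Y (Suc m) i j z - Y m i j z)" for i j z
  have lim: "uniform_limit S (\<lambda>m. Y m i j) (X i j) sequentially" for i j
  proof -
    have "uniform_limit S (\<lambda>n z. \<Sum>m<n. Y (Suc m) i j z - Y m i j z) (\<lambda>z. \<Sum>m. Y (Suc m) i j z - Y m i j z) sequentially"
      by (rule Weierstrass_m_test[where M = "\<lambda>m. \<delta> * (1 / 2) ^ m"])
        (auto intro!: step summable_mult summable_geometric)
    moreover have "(\<Sum>m<n. Y (Suc m) i j z - Y m i j z) = Y n i j z" for n z
      by (subst sum_lessThan_telescope) (simp add: Y0)
    ultimately show ?thesis by (simp add: X_def[abs_def])
  qed
  have ptw: "(\<lambda>m. Y m i j z) \<longlonglongrightarrow> X i j z" if "z \<in> S" for i j z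
    by (rule tendsto_uniform_limitI[OF lim that])
  show ?thesis
  proof
    show "holo (X i j) S" for i j
      by (rule holo_uniform_limit[OF S hol lim])
    show "X i j z = X j i z" if "z \<in> S" for i j z
      by (simp add: X_def Ysym[of _ i j])
    show "2 * X i j z + (\<Sum>k\<in>UNIV. X i k z * X k j z) = E i j z" if z: "z \<in> S" for i j z
    proof -
      have "(\<lambda>m. 2 * Y (Suc m) i j z + (\<Sum>k\<in>UNIV. Y m i k z * Y m k j z)) \<longlonglongrightarrow>
        2 * X i j z + (\<Sum>k\<in>UNIV. X i k z * X k j z)"
        by (intro tendsto_intros ptw[OF z] LIMSEQ_Suc[OF ptw[OF z]])
      moreover have "2 * Y (Suc m) i j z + (\<Sum>k\<in>UNIV. Y m i k z * Y m k j z) = E i j z" for m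
        by (simp add: YS diff_divide_distrib)
      ultimately show ?thesis by (simp add: LIMSEQ_const_iff)
    qed
    show "cmod (X i j z) \<le> 1 / (2 * real CARD('n))" if "z \<in> S" for i j z
      by (rule Lim_bounded[OF tendsto_norm[OF ptw[OF that]], of 0]) (use bound[OF that] in \<open>auto simp: \<delta>_def N_def\<close>)
    \<comment> \<open>The iteration preserves zero rows of E. In the Morse lemma this leaves the
      coordinates outside I untouched.\<close>
    show "X i j z = 0" if "z \<in> S" "\<And>j. E i j z = 0" for i j z
    proof -
      have "Y m i j z = 0" for m j
        by (induction m arbitrary: j) (simp_all add: Y0 YS that(2))
      then show ?thesis by (simp add: X_def)
    qed
    show "X i j z = X i j z'" if "\<And>i j. E i j z = E i j z'" for i j z z'
    proof -
      have "Y m i j z = Y m i j z'" for m i j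
        by (induction m arbitrary: i j) (simp_all add: Y0 YS that)
      then show ?thesis by (simp add: X_def)
    qed
  qed
qed

section \<open>Coordinate projections and the holomorphic Morse lemma\<close>

text \<open>I stands for the first n - c coordinates. That a function does not depend on the others
  is encoded as invariance under \<open>proj I\<close>, a closed condition that passes easily to
  complexifications and derivatives.\<close>

definition proj :: "'n set \<Rightarrow> complex^'n \<Rightarrow> complex^'n"
  where "proj I z = (\<chi> i. if i \<in> I then z $ i else 0)"

definition quad :: "'n::finite set \<Rightarrow> complex^'n \<Rightarrow> complex"
  where "quad I z = (\<Sum>i\<in>I. (z $ i)\<^sup>2)"

lemma clinear_proj: "clinear (proj I)"
  by (auto simp: clinear_def proj_def linear_iff vec_eq_iff J_vec_def)

lemma norm_proj: "norm (proj I z) \<le> norm z"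
  unfolding norm_vec_def L2_set_def
  by (intro real_sqrt_le_mono sum_mono) (auto simp: proj_def)

lemma proj_in_ball: "z \<in> ball 0 \<rho> \<Longrightarrow> proj I z \<in> ball 0 \<rho>"
  using norm_proj[of I z] by simp

lemma proj_idem [simp]: "proj I (proj I z) = proj I z"
  by (simp add: proj_def vec_eq_iff)

lemma proj_axis: "proj I (axis i 1) = (if i \<in> I then axis i 1 else 0)"
  by (auto simp: proj_def vec_eq_iff axis_def)

lemma quad_proj [simp]: "quad I (proj I z) = quad I z"
  by (simp add: quad_def proj_def)

lemma holo_quad: "holo (quad I) S"
  unfolding quad_def by (intro holo_sum holo_power holo_nth holo_id)

lemma quad_scale: "quad I (s *\<^sub>C z) = s\<^sup>2 * quad I z"
  by (simp add: quad_def sum_distrib_left power_mult_distrib)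

lemma fd_proj_invariant:
  fixes f :: "complex^'n \<Rightarrow> complex"
  assumes f: "holo f (ball 0 \<rho>)" and inv: "\<And>z. z \<in> ball 0 \<rho> \<Longrightarrow> f (proj I z) = f z" and z: "z \<in> ball 0 \<rho>"
  shows "fd f z v = fd f (proj I z) (proj I v)"
proof -
  have "fd f z v = fd (\<lambda>z. f (proj I z)) z v"
    by (rule fun_cong[OF fd_cong[OF open_ball z]]) (simp add: inv)
  also have "fd (\<lambda>z. f (proj I z)) z v = fd f (proj I z) (fd (proj I) z v)"
    by (rule fd_compose)
      (use holo_differentiable[OF holo_clinear_map[OF clinear_proj] UNIV_I] holo_differentiable[OF f proj_in_ball[OF z]] in auto)
  finally show ?thesis by (simp add: fd_clinear_map[OF clinear_proj])
qed

lemma scale_in_ball: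
  fixes z :: "'a::real_normed_vector"
  assumes "z \<in> ball 0 \<rho>" "s \<in> cbox (0::real) 1"
  shows "s *\<^sub>R z \<in> ball 0 \<rho>"
proof -
  have "\<bar>s\<bar> * norm z \<le> 1 * norm z" using assms(2) by (intro mult_right_mono) auto
  then show ?thesis using assms(1) by simp
qed

lemma hadamard_proj:
  fixes f :: "complex^'n \<Rightarrow> complex"
  assumes f: "holo f (ball 0 \<rho>)" and inv: "\<And>z. z \<in> ball 0 \<rho> \<Longrightarrow> f (proj I z) = f z" and z: "z \<in> ball 0 \<rho>"
  shows "hadamard f i (proj I z) = hadamard f i z" "i \<notin> I \<Longrightarrow> hadamard f i z = 0"
proof -
  have *: "fd f (s *\<^sub>R proj I z) (axis i 1) = fd f (s *\<^sub>R z) (axis i 1)"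
    "i \<notin> I \<Longrightarrow> fd f (s *\<^sub>R z) (axis i 1) = 0" if s: "s \<in> cbox 0 1" for s :: real
  proof -
    have in_ball: "s *\<^sub>R z \<in> ball 0 \<rho>" "s *\<^sub>R proj I z \<in> ball 0 \<rho>"
      using scale_in_ball[OF z s] scale_in_ball[OF proj_in_ball[OF z] s] by auto
    have [simp]: "proj I (s *\<^sub>R z) = s *\<^sub>R proj I z" for z
      by (rule clinear_scaleR[OF clinear_proj])
    show "fd f (s *\<^sub>R proj I z) (axis i 1) = fd f (s *\<^sub>R z) (axis i 1)"
      using fd_proj_invariant[OF f inv in_ball(1), of "axis i 1"] fd_proj_invariant[OF f inv in_ball(2), of "axis i 1"] by simp
    show "fd f (s *\<^sub>R z) (axis i 1) = 0" if "i \<notin> I"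
      using fd_proj_invariant[OF f inv in_ball(1), of "axis i 1"] that
        holo_fd_zero[OF f in_ball(2)] by (simp add: proj_axis)
  qed
  show "hadamard f i (proj I z) = hadamard f i z"
    unfolding hadamard_def by (rule integral_cong) (rule *)
  show "hadamard f i z = 0" if "i \<notin> I"
    unfolding hadamard_def using integral_cong[of "cbox 0 1" _ "\<lambda>_. 0::complex"] *(2)[OF _ that] by (metis (no_types, lifting) integral_0)
qed

lemma fd_zero_of_cubic:
  fixes f :: "'a::cvec \<Rightarrow> complex"
  assumes \<rho>: "\<rho> > 0" and C: "\<And>v. v \<in> ball 0 \<rho> \<Longrightarrow> cmod (f v) \<le> C * norm v ^ 3"
  shows "fd f 0 = (\<lambda>_. 0)"
proof (rule fd_eq)
  have f0: "f 0 = 0" using C[of 0] \<rho> by simp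
  have "((\<lambda>y. \<bar>C\<bar> * norm y ^ 2) \<longlongrightarrow> \<bar>C\<bar> * norm (0::'a) ^ 2) (at (0::'a))"
    by (intro tendsto_intros)
  then have "((\<lambda>y. \<bar>C\<bar> * norm y ^ 2) \<longlongrightarrow> 0) (at (0::'a))" by simp
  then have "((\<lambda>y. norm (f y) / norm y) \<longlongrightarrow> 0) (at 0)"
  proof (rule Lim_null_comparison[rotated])
    have "\<forall>\<^sub>F y in at 0. y \<in> ball 0 \<rho> - {0}"
      unfolding eventually_at_topological using \<rho> by (intro exI[of _ "ball 0 \<rho>"]) auto
    then show "\<forall>\<^sub>F y in at 0. norm (norm (f y) / norm y) \<le> \<bar>C\<bar> * norm y ^ 2"
    proof eventually_elim
      case (elim y)
      then have "norm (f y) \<le> \<bar>C\<bar> * norm y ^ 3"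
        using C[of y] by (meson DiffD1 abs_ge_self mult_right_mono norm_ge_zero order_trans zero_le_power)
      then show ?case using elim by (simp add: field_simps power2_eq_square power3_eq_cube)
    qed
  qed
  then show "(f has_derivative (\<lambda>_. 0)) (at 0)"
    unfolding has_derivative_at by (simp add: f0)
qed

lemma sum_axis: "(\<Sum>i\<in>UNIV. axis a (1::complex) $ i * g i) = g a"
  by (simp add: axis_def if_distrib[of "\<lambda>x. x * _"] cong: if_cong)

text \<open>Two Hadamard expansions write f - q as a quadratic form in z with a symmetric
  holomorphic matrix E vanishing at 0. If 1 + X is the symmetric square root of 1 + E, then \<Psi> z
  = z + X z satisfies q (\<Psi> z) = f z. As X depends on z only through E, invariance under
  \<open>proj I\<close> passes on to \<Psi>.\<close>

lemma morse_coordinates: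
  fixes f :: "complex^'n \<Rightarrow> complex"
  assumes f: "holo f (ball 0 \<rho>)" and \<rho>: "\<rho> > 0"
    and inv: "\<And>z. z \<in> ball 0 \<rho> \<Longrightarrow> f (proj I z) = f z"
    and C: "\<And>v. v \<in> ball 0 \<rho> \<Longrightarrow> cmod (f v - quad I v) \<le> C * norm v ^ 3"
  obtains r \<Psi> where "r > 0" "r \<le> \<rho>" "holo \<Psi> (ball 0 r)" "\<Psi> 0 = 0" "fd \<Psi> 0 = (\<lambda>v. v)"
    "\<And>z. z \<in> ball 0 r \<Longrightarrow> f z = quad I (\<Psi> z)"
    "\<And>z. z \<in> ball 0 r \<Longrightarrow> proj I (\<Psi> z) = \<Psi> (proj I z)"
proof -
  define e where "e z = f z - quad I z" for z
  have e: "holo e (ball 0 \<rho>)" unfolding e_def by (intro holo_diff f holo_quad)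
  have einv: "e (proj I z) = e z" if "z \<in> ball 0 \<rho>" for z
    using inv[OF that] by (simp add: e_def)
  have eC: "cmod (e v) \<le> C * norm v ^ 3" if "v \<in> ball 0 \<rho>" for v
    using C[OF that] by (simp add: e_def)
  have 0: "0 \<in> ball (0::complex^'n) \<rho>" using \<rho> by simp
  have e0: "e 0 = 0" using eC[OF 0] by simp
  define G where "G = hadamard e"
  have G: "holo (G i) (ball 0 \<rho>)" for i unfolding G_def by (rule holo_hadamard[OF e])
  have Ginv: "G i (proj I z) = G i z" "i \<notin> I \<Longrightarrow> G i z = 0" if "z \<in> ball 0 \<rho>" for i z
    unfolding G_def using hadamard_proj[OF e einv that] by auto
  have G0: "G i 0 = 0" for i
    using fd_zero_of_cubic[OF \<rho> eC] by (simp add: G_def hadamard_def)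
  define H where "H i = hadamard (G i)" for i
  have H: "holo (H i j) (ball 0 \<rho>)" for i j unfolding H_def by (rule holo_hadamard[OF G])
  have Hz: "H i j z = 0" if z: "z \<in> ball 0 \<rho>" and "i \<notin> I \<or> j \<notin> I" for i j z
  proof (cases "i \<in> I")
    case True
    then show ?thesis using hadamard_proj(2)[OF G Ginv(1) z] that unfolding H_def by blast
  next
    case False
    have "fd (G i) (s *\<^sub>R z) (axis j 1) = 0" if "s \<in> cbox 0 1" for s :: real
    proof -
      have "fd (G i) (s *\<^sub>R z) = fd (\<lambda>z. 0) (s *\<^sub>R z)"
        by (rule fd_cong[OF open_ball scale_in_ball[OF z that]]) (rule Ginv(2)[OF _ False])
      then show ?thesis by simp
    qed
    then show ?thesis
      unfolding H_def hadamard_def using integral_cong[of "cbox 0 1" _ "\<lambda>_. 0::complex"]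
      by (metis (no_types, lifting) integral_0)
  qed
  have expand: "e z = (\<Sum>i\<in>UNIV. \<Sum>j\<in>UNIV. z $ i * z $ j * H i j z)" if z: "z \<in> ball 0 \<rho>" for z
  proof -
    have "e z = (\<Sum>i\<in>UNIV. z $ i * G i z)"
      using hadamard_expansion[OF e z] by (simp add: e0 G_def)
    also have "\<dots> = (\<Sum>i\<in>UNIV. z $ i * (\<Sum>j\<in>UNIV. z $ j * H i j z))"
      using hadamard_expansion[OF G z] by (simp add: G0 H_def)
    finally show ?thesis by (simp add: sum_distrib_left mult.assoc)
  qed
  have cont: "continuous (at 0) (H i j)" for i j
    using holo_has_derivative[OF H 0] has_derivative_continuous by blast
  define b where "b v w = (\<Sum>i\<in>UNIV. \<Sum>j\<in>UNIV. v $ i * w $ j * H i j 0)" for v w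
  \<comment> \<open>e (s v) / s^2 tends to b v v, while the cubic bound makes it O(s). Only the
    quadratic form b v v is controlled this way, hence only the symmetric part of H at 0.\<close>
  have b0: "b v v = 0" for v
  proof -
    define T where "T s = (\<Sum>i\<in>UNIV. \<Sum>j\<in>UNIV. v $ i * v $ j * H i j (s *\<^sub>R v))" for s :: real
    have "((\<lambda>s. H i j (s *\<^sub>R v)) \<longlongrightarrow> H i j 0) (at_right 0)" for i j
    proof (rule isCont_tendsto_compose[OF cont])
      have "((\<lambda>s::real. s *\<^sub>R v) \<longlongrightarrow> 0 *\<^sub>R v) (at_right 0)" by (intro tendsto_intros)
      then show "((\<lambda>s::real. s *\<^sub>R v) \<longlongrightarrow> 0) (at_right 0)" by simp
    qed
    then have T: "(T \<longlongrightarrow> b v v) (at_right 0)"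
      unfolding T_def b_def by (intro tendsto_intros)
    moreover have "(T \<longlongrightarrow> 0) (at_right 0)"
    proof (rule Lim_null_comparison)
      have "((\<lambda>s::real. \<bar>C\<bar> * norm v ^ 3 * s) \<longlongrightarrow> \<bar>C\<bar> * norm v ^ 3 * 0) (at_right 0)" by (intro tendsto_intros)
      then show "((\<lambda>s::real. \<bar>C\<bar> * norm v ^ 3 * s) \<longlongrightarrow> 0) (at_right 0)" by simp
      have "\<forall>\<^sub>F s in at_right 0. s \<in> {0<..<\<rho> / (norm v + 1)}"
        using \<rho> by (intro eventually_at_right_real) (simp add: add_nonneg_pos)
      then show "\<forall>\<^sub>F s in at_right 0. cmod (T s) \<le> \<bar>C\<bar> * norm v ^ 3 * s"
      proof eventually_elim
        case (elim s)
        then have s: "s > 0" "s * (norm v + 1) < \<rho>"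
          using pos_less_divide_eq[of "norm v + 1" s \<rho>] by (auto simp: add_nonneg_pos)
        then have sv: "s *\<^sub>R v \<in> ball 0 \<rho>" by (simp add: algebra_simps)
        have "e (s *\<^sub>R v) = s\<^sup>2 * T s"
          by (subst expand[OF sv]) (simp add: T_def sum_distrib_left power2_eq_square scaleR_conv_of_real[of s "_::complex"] mult_ac)
        then have "s\<^sup>2 * cmod (T s) = cmod (e (s *\<^sub>R v))" by (simp add: norm_mult norm_power)
        also have "\<dots> \<le> C * norm (s *\<^sub>R v) ^ 3" by (rule eC[OF sv])
        also have "\<dots> \<le> \<bar>C\<bar> * norm (s *\<^sub>R v) ^ 3" by (intro mult_right_mono) auto
        also have "\<dots> = s\<^sup>2 * (\<bar>C\<bar> * norm v ^ 3 * s)" using s by (simp add: power_mult_distrib power2_eq_square power3_eq_cube)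
        finally show ?case using s by simp
      qed
    qed
    ultimately show ?thesis using tendsto_unique[OF trivial_limit_at_right_real] by blast
  qed
  have H0: "H i j 0 + H j i 0 = 0" for i j
  proof -
    have badd: "b (u + u') w = b u w + b u' w" "b w (u + u') = b w u + b w u'" for u u' w
      by (simp_all add: b_def algebra_simps sum.distrib)
    have bax: "b (axis k 1) (axis l 1) = H k l 0" for k l
    proof -
      have "b (axis k 1) (axis l 1) = (\<Sum>i\<in>UNIV. axis k 1 $ i * (\<Sum>j\<in>UNIV. axis l 1 $ j * H i j 0))"
        by (simp add: b_def sum_distrib_left mult.assoc)
      then show ?thesis by (simp add: sum_axis)
    qed
    show ?thesis
      using b0[of "axis i 1 + axis j 1"] b0[of "axis i 1"] b0[of "axis j 1"] by (simp add: badd bax add.commute)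
  qed
  \<comment> \<open>Symmetrising leaves the quadratic form unchanged and makes the matrix vanish at
    0, so its entries are small enough for \<open>holo_matrix_sqrt\<close> near 0.\<close>
  define E where "E i j z = (H i j z + H j i z) / 2" for i j z
  have E: "holo (E i j) (ball 0 \<rho>)" for i j
    unfolding E_def by (intro holo_divide holo_add H holo_const) auto
  have E0: "E i j 0 = 0" for i j using H0 by (simp add: E_def)
  have Ez: "E i j z = 0" if "z \<in> ball 0 \<rho>" "i \<notin> I \<or> j \<notin> I" for i j z
    using Hz[OF that(1)] that(2) by (auto simp: E_def)
  have Eexpand: "e z = (\<Sum>i\<in>UNIV. \<Sum>j\<in>UNIV. z $ i * z $ j * E i j z)" if z: "z \<in> ball 0 \<rho>" for z
  proof -
    have "(\<Sum>i\<in>UNIV. \<Sum>j\<in>UNIV. z $ i * z $ j * H i j z) = (\<Sum>i\<in>UNIV. \<Sum>j\<in>UNIV. z $ i * z $ j * H j i z)"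
      by (subst sum.swap) (simp add: mult.commute mult.left_commute)
    then have "2 * e z = (\<Sum>i\<in>UNIV. \<Sum>j\<in>UNIV. z $ i * z $ j * H i j z) + (\<Sum>i\<in>UNIV. \<Sum>j\<in>UNIV. z $ i * z $ j * H j i z)"
      by (simp add: expand[OF z])
    also have "\<dots> = 2 * (\<Sum>i\<in>UNIV. \<Sum>j\<in>UNIV. z $ i * z $ j * E i j z)"
      by (simp add: E_def sum_distrib_left sum.distrib[symmetric] distrib_left add_divide_distrib)
    finally show ?thesis by simp
  qed
  have "\<forall>\<^sub>F z in nhds 0. \<forall>i j. cmod (E i j z) < 1 / (2 * real CARD('n))"
  proof (intro eventually_all_finite)
    fix i j
    have "isCont (E i j) 0"
      using holo_has_derivative[OF E 0] has_derivative_continuous by blast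
    then have "((\<lambda>z. cmod (E i j z)) \<longlongrightarrow> cmod (E i j 0)) (nhds 0)"
      by (intro tendsto_norm) (simp add: continuous_within tendsto_at_iff_tendsto_nhds)
    then show "\<forall>\<^sub>F z in nhds 0. cmod (E i j z) < 1 / (2 * real CARD('n))"
      by (rule order_tendstoD) (simp add: E0)
  qed
  then obtain r0 where r0: "r0 > 0" "\<And>z i j. z \<in> ball 0 r0 \<Longrightarrow> cmod (E i j z) < 1 / (2 * real CARD('n))"
    unfolding eventually_nhds_metric by (auto simp: dist_commute)
  define r where "r = min r0 \<rho>"
  have r: "r > 0" "r \<le> \<rho>" "ball 0 r \<subseteq> ball (0::complex^'n) \<rho>" using r0 \<rho> by (auto simp: r_def)
  have 0: "0 \<in> ball (0::complex^'n) r" using r by simp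
  obtain X where X: "\<And>i j. holo (X i j) (ball 0 r)" "\<And>i j z. z \<in> ball 0 r \<Longrightarrow> X i j z = X j i z"
    "\<And>i j z. z \<in> ball 0 r \<Longrightarrow> 2 * X i j z + (\<Sum>k\<in>UNIV. X i k z * X k j z) = E i j z"
    "\<And>i z j. z \<in> ball 0 r \<Longrightarrow> (\<And>j. E i j z = 0) \<Longrightarrow> X i j z = 0"
    "\<And>i j z z'. (\<And>i j. E i j z = E i j z') \<Longrightarrow> X i j z = X i j z'"
  proof (rule holo_matrix_sqrt[where E = E, OF open_ball[of 0 r]])
    show "holo (E i j) (ball 0 r)" for i j by (rule holo_subset[OF E r(3)])
    show "E i j z = E j i z" for i j z by (simp add: E_def add.commute)
    show "cmod (E i j z) \<le> 1 / (2 * real CARD('n))" if "z \<in> ball 0 r" for i j z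
      using r0(2)[of z i j] that by (auto simp: r_def)
  qed blast
  have X0: "X i j 0 = 0" for i j by (rule X(4)[OF 0 E0])
  have XI: "X i j z = 0" if "z \<in> ball 0 r" "i \<notin> I" for i j z
    by (rule X(4)[OF that(1) Ez]) (use that r in auto)
  define \<Psi> where "\<Psi> z = (\<chi> i. z $ i + (\<Sum>j\<in>UNIV. X i j z * z $ j))" for z
  have nth: "\<Psi> z $ i = z $ i + (\<Sum>j\<in>UNIV. X i j z * z $ j)" for z i by (simp add: \<Psi>_def)
  have hol: "holo \<Psi> (ball 0 r)"
    by (rule holo_vec) (unfold nth, intro holo_add holo_sum holo_mult X holo_nth holo_id)
  have fd0: "fd \<Psi> 0 v $ i = v $ i" for v i
  proof -
    have "((\<lambda>z. z $ i + (\<Sum>j\<in>UNIV. X i j z * z $ j)) has_derivative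
      (\<lambda>v. v $ i + (\<Sum>j\<in>UNIV. X i j 0 * v $ j + fd (X i j) 0 v * 0 $ j))) (at 0)"
      by (intro has_derivative_add has_derivative_sum has_derivative_mult holo_has_derivative[OF X(1) 0]
          bounded_linear_imp_has_derivative bounded_linear_vec_nth)
    from fun_cong[OF fd_eq[OF this], of v] show ?thesis
      using fd_nth[OF holo_differentiable[OF hol 0], of i v] by (simp add: nth X0)
  qed
  show ?thesis
  proof
    show "r > 0" "r \<le> \<rho>" using r by auto
    show "holo \<Psi> (ball 0 r)" by (rule hol)
    show "\<Psi> 0 = 0" by (simp add: vec_eq_iff nth)
    show "fd \<Psi> 0 = (\<lambda>v. v)" by (simp add: fun_eq_iff vec_eq_iff fd0)
    fix z :: "complex^'n" assume z: "z \<in> ball 0 r"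
    then have z\<rho>: "z \<in> ball 0 \<rho>" using r by blast
    define x where "x i = (\<Sum>j\<in>UNIV. X i j z * z $ j)" for i
    have "quad I (\<Psi> z) = (\<Sum>i\<in>I. (z $ i)\<^sup>2 + (2 * z $ i * x i + x i * x i))"
      by (simp add: quad_def nth x_def power2_eq_square algebra_simps)
    also have "\<dots> = quad I z + (\<Sum>i\<in>I. 2 * z $ i * x i + x i * x i)"
      by (simp add: quad_def sum.distrib)
    also have "(\<Sum>i\<in>I. 2 * z $ i * x i + x i * x i) = (\<Sum>i\<in>UNIV. 2 * z $ i * x i + x i * x i)"
      by (rule sum.mono_neutral_left) (auto simp: x_def XI[OF z])
    also have "\<dots> = (\<Sum>i\<in>UNIV. \<Sum>j\<in>UNIV. 2 * (z $ i * z $ j * X i j z)) + (\<Sum>k\<in>UNIV. x k * x k)"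
      by (simp add: sum.distrib x_def sum_distrib_left mult_ac)
    also have "(\<Sum>k\<in>UNIV. x k * x k) = (\<Sum>k\<in>UNIV. \<Sum>i\<in>UNIV. \<Sum>j\<in>UNIV. z $ i * z $ j * (X i k z * X k j z))"
    proof (rule sum.cong)
      fix k
      have "x k * x k = (\<Sum>i\<in>UNIV. X k i z * z $ i) * (\<Sum>j\<in>UNIV. X k j z * z $ j)" by (simp add: x_def)
      also have "\<dots> = (\<Sum>i\<in>UNIV. \<Sum>j\<in>UNIV. z $ i * z $ j * (X i k z * X k j z))"
        unfolding sum_product by (simp add: X(2)[OF z, of k] mult_ac)
      finally show "x k * x k = (\<Sum>i\<in>UNIV. \<Sum>j\<in>UNIV. z $ i * z $ j * (X i k z * X k j z))" .
    qed simp
    also have "\<dots> = (\<Sum>i\<in>UNIV. \<Sum>j\<in>UNIV. \<Sum>k\<in>UNIV. z $ i * z $ j * (X i k z * X k j z))"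
      by (subst sum.swap, rule sum.cong[OF refl], subst sum.swap) simp
    also have "(\<Sum>i\<in>UNIV. \<Sum>j\<in>UNIV. 2 * (z $ i * z $ j * X i j z)) + \<dots>
      = (\<Sum>i\<in>UNIV. \<Sum>j\<in>UNIV. z $ i * z $ j * E i j z)"
      by (simp add: X(3)[OF z, symmetric] sum.distrib[symmetric] sum_distrib_left distrib_left mult_ac)
    also have "quad I z + \<dots> = f z"
      using Eexpand[OF z\<rho>] by (simp add: e_def diff_eq_eq add.commute)
    finally show "f z = quad I (\<Psi> z)" by simp
    have "E i j (proj I z) = E i j z" for i j
    proof -
      have "H i j (proj I z) = H i j z" for i j
        unfolding H_def by (rule hadamard_proj(1)[OF G Ginv(1) z\<rho>])
      then show ?thesis by (simp add: E_def)
    qed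
    then have Xp: "X i j (proj I z) = X i j z" for i j by (rule X(5))
    show "proj I (\<Psi> z) = \<Psi> (proj I z)"
      unfolding vec_eq_iff
    proof
      fix i
      have "(\<Sum>j\<in>UNIV. X i j z * proj I z $ j) = (\<Sum>j\<in>UNIV. X i j z * z $ j)"
        by (rule sum.cong) (auto simp: proj_def XI[OF z] X(2)[OF z, of i])
      then show "proj I (\<Psi> z) $ i = \<Psi> (proj I z) $ i"
        using XI[OF z] by (simp add: nth Xp) (simp add: proj_def nth)
    qed
  qed
qed

section \<open>Inverses of holomorphic maps\<close>

lemma clinear_inv:
  assumes "clinear D" "bij D"
  shows "clinear (inv D)"
  unfolding clinear_def
proof (intro conjI allI)
  show "linear (inv D)"
    by (rule linearI)
      (metis assms(2) bij_inv_eq_iff clinear_add[OF assms(1)], metis assms(2) bij_inv_eq_iff clinear_scaleR[OF assms(1)])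
  fix v
  have "D (J (inv D v)) = J v"
    using clinear_J[OF assms(1)] bij_inv_eq_iff[OF assms(2)] by metis
  then show "inv D (J v) = J (inv D v)"
    using assms(2) by (metis bij_inv_eq_iff)
qed

text \<open>The real inverse function theorem suffices, because the inverse of a bijective linear
  map commuting with J commutes with J. The assumption on the directional derivatives supplies the
  continuity of the derivative.\<close>

lemma holo_inverse_function:
  fixes f :: "'a::cvec \<Rightarrow> 'a"
  assumes S: "open S" "0 \<in> S" and f: "holo f S" and hol: "\<And>v. holo (\<lambda>z. fd f z v) S" and id: "fd f 0 = (\<lambda>v. v)"
  obtains U V g where "open U" "U \<subseteq> S" "0 \<in> U" "open V" "f 0 \<in> V" "homeomorphism U V f g"
    "holo g V" "fd g (f 0) = (\<lambda>v. v)"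
proof -
  define f' where "f' z = Blinfun (fd f z)" for z
  have f': "blinfun_apply (f' z) = fd f z" if "z \<in> S" for z
    unfolding f'_def by (rule bounded_linear_Blinfun_apply[OF clinear_bounded_linear[OF holo_clinear[OF f that]]])
  have contf: "continuous_on S f'"
  proof (rule continuous_on_blinfun_componentwise)
    show "continuous_on S (\<lambda>z. blinfun_apply (f' z) i)" for i
      by (rule continuous_on_eq[OF holo_continuous_on[OF hol[of i]]]) (simp add: f')
  qed
  have inv_id: "id_blinfun o\<^sub>L f' 0 = id_blinfun"
    by (rule blinfun_eqI) (simp add: f'[OF S(2)] id)
  obtain U V g g' where *: "open U" "U \<subseteq> S" "0 \<in> U" "open V" "f 0 \<in> V" "homeomorphism U V f g"
    and g': "\<And>y. y \<in> V \<Longrightarrow> (g has_derivative (g' y)) (at y)"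
    "\<And>y. y \<in> V \<Longrightarrow> g' y = inv (blinfun_apply (f' (g y)))"
    "\<And>y. y \<in> V \<Longrightarrow> bij (blinfun_apply (f' (g y)))"
  proof (rule inverse_function_theorem[OF S(1) _ contf S(2) inv_id])
    show "(f has_derivative blinfun_apply (f' x)) (at x)" if "x \<in> S" for x
      using holo_has_derivative[OF f that] by (simp add: f'[OF that])
  qed (rule that)
  have gS: "g y \<in> S" if "y \<in> V" for y
    using *(2,6) that unfolding homeomorphism_def by blast
  have "holo g V"
  proof (rule holoI[OF g'(1)])
    show "clinear (g' y)" if "y \<in> V" for y
      using clinear_inv[OF holo_clinear[OF f gS[OF that]]] g'(2,3)[OF that] by (simp add: f'[OF gS[OF that]])
  qed
  moreover have "fd g (f 0) = (\<lambda>v. v)"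
  proof -
    have "g (f 0) = 0" using *(3,6) unfolding homeomorphism_def by blast
    then have "g' (f 0) = inv (\<lambda>v. v)" using g'(2)[OF *(5)] by (simp add: f'[OF S(2)] id)
    then show ?thesis using fd_eq[OF g'(1)[OF *(5)]] inv_id by (simp add: inv_id[unfolded id_def] fun_eq_iff inv_equality)
  qed
  ultimately show ?thesis using that * by blast
qed

section \<open>Complex conjugation and real points\<close>

definition cj :: "complex^'n \<Rightarrow> complex^'n"
  where "cj z = (\<chi> i. cnj (z $ i))"

lemma cj_nth [simp]: "cj z $ i = cnj (z $ i)"
  by (simp add: cj_def)

lemma cj_cj [simp]: "cj (cj z) = z"
  by (simp add: vec_eq_iff)

lemma cj_add: "cj (z + w) = cj z + cj w"
  and cj_diff: "cj (z - w) = cj z - cj w"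
  and cj_cscale: "cj (s *\<^sub>C z) = cnj s *\<^sub>C cj z"
  and cj_scaleR: "cj (x *\<^sub>R z) = x *\<^sub>R cj z"
  and cj_zero [simp]: "cj 0 = 0"
  and cj_J: "cj (J z) = - J (cj z)"
  by (simp_all add: vec_eq_iff J_vec_def J_complex_def)

lemma norm_cj [simp]: "norm (cj z) = norm z"
  by (simp add: norm_vec_def)

lemma linear_cj: "linear cj"
  by (rule linearI) (simp_all add: cj_add cj_scaleR)

lemma bounded_linear_cj: "bounded_linear cj"
  using linear_cj linear_conv_bounded_linear by blast

lemma quad_cj [simp]: "quad I (cj z) = cnj (quad I z)"
  by (simp add: quad_def)

lemma proj_cj: "proj I (cj z) = cj (proj I z)"
  by (simp add: proj_def vec_eq_iff)

lemma has_derivative_conj: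
  assumes "holo f S" "cj z \<in> S"
  shows "((\<lambda>z. cnj (f (cj z))) has_derivative (\<lambda>v. cnj (fd f (cj z) (cj v)))) (at z)"
proof -
  have "(cj has_derivative cj) (at z)"
    by (rule bounded_linear_imp_has_derivative[OF bounded_linear_cj])
  from has_derivative_compose[OF this holo_has_derivative[OF assms]]
  show ?thesis by (rule has_derivative_cnj)
qed

lemma holo_conj:
  assumes f: "holo f S" and T: "\<And>z. z \<in> T \<Longrightarrow> cj z \<in> S"
  shows "holo (\<lambda>z. cnj (f (cj z))) T"
proof (rule holoI)
  fix z assume z: "z \<in> T"
  note d = has_derivative_conj[OF f T[OF z]]
  then show "((\<lambda>z. cnj (f (cj z))) has_derivative (\<lambda>v. cnj (fd f (cj z) (cj v)))) (at z)" .
  show "clinear (\<lambda>v. cnj (fd f (cj z) (cj v)))"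
    unfolding clinear_def
    using has_derivative_linear[OF d] holo_fd_minus[OF f T[OF z]] holo_fd_J[OF f T[OF z]]
    by (auto simp: cj_J J_complex_def)
qed

text \<open>
  On the complexification \<open>(z, w)\<close>, with \<open>w\<close> standing for the conjugate of \<open>z\<close>, complex
  conjugation becomes the antiholomorphic involution \<open>sw\<close>, whose fixed points are the real points.
\<close>

definition sw :: "(complex^'n) \<times> (complex^'n) \<Rightarrow> (complex^'n) \<times> (complex^'n)"
  where "sw Z = (cj (snd Z), cj (fst Z))"

lemma sw_add: "sw (Z + W) = sw Z + sw W"
  and sw_diff: "sw (Z - W) = sw Z - sw W"
  and sw_scaleR: "sw (x *\<^sub>R Z) = x *\<^sub>R sw Z"
  and sw_sw [simp]: "sw (sw Z) = Z"
  and sw_cscale: "sw (s *\<^sub>C Z) = cnj s *\<^sub>C sw Z"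
  and sw_zero [simp]: "sw 0 = 0"
  by (simp_all add: sw_def cj_add cj_diff cj_scaleR cj_cscale prod_eq_iff zero_prod_def)

lemma norm_sw [simp]: "norm (sw Z) = norm Z"
  by (simp add: sw_def norm_prod_def add.commute)

lemma linear_sw: "linear sw"
  by (rule linearI) (simp_all add: sw_add sw_scaleR)

lemma bounded_linear_sw: "bounded_linear sw"
  using linear_sw linear_conv_bounded_linear by blast

lemma subspace_sw: "subspace {Z. sw Z = Z}"
  by (rule subspaceI) (simp_all add: sw_add sw_scaleR)

text \<open>The fixed points of \<open>sw\<close> are totally real and span: \<zeta> = x + J y,
  where x and -J y ... play the part of real and imaginary components. Both x and y have norm at
  most that of \<zeta>, hence the radius \<rho> / 2. Identities known on w = conj z are complexified
  through this lemma.\<close>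

lemma holo_zero_real_points:
  fixes f :: "(complex^'n) \<times> (complex^'n) \<Rightarrow> complex"
  assumes f: "holo f (ball c \<rho>)"
    and zero: "\<And>x. sw x = x \<Longrightarrow> norm x < \<rho> \<Longrightarrow> f (c + x) = 0" and \<zeta>: "norm \<zeta> < \<rho> / 2"
  shows "f (c + \<zeta>) = 0"
proof -
  define x where "x = (1 / 2) *\<^sub>R (\<zeta> + sw \<zeta>)"
  define y where "y = - J ((1 / 2) *\<^sub>R (\<zeta> - sw \<zeta>))"
  have J_sw: "sw (J Z) = - J (sw Z)" for Z :: "(complex^'n) \<times> (complex^'n)"
    using sw_cscale[of \<i> Z] by (simp add: cscale_ii)
  have "sw (- Z) = - sw Z" for Z :: "(complex^'n) \<times> (complex^'n)"
    using sw_diff[of 0 Z] by simp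
  then have xy: "sw x = x" "sw y = y"
    by (simp_all add: x_def y_def sw_scaleR sw_add sw_diff J_sw add.commute J_scaleR[symmetric] J_diff algebra_simps)
  have "norm x \<le> norm \<zeta>" "norm y \<le> norm \<zeta>"
    using norm_triangle_ineq[of \<zeta> "sw \<zeta>"] norm_triangle_ineq4[of \<zeta> "sw \<zeta>"] by (simp_all add: x_def y_def)
  then have "f (c + x + J y) = 0"
    using \<zeta> xy by (intro holo_zero_totally_real[OF f subspace_sw]) (auto intro: zero)
  moreover have "x + J y = \<zeta>"
    by (simp add: x_def y_def scaleR_add_right[symmetric] scaleR_2[symmetric])
  ultimately show ?thesis by (simp add: add.assoc)
qed

section \<open>The bilinear form and the model quadric\<close>

text \<open>Bilinear rather than Hermitian: without conjugation, nonzero null vectors exist as soon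
  as I has two elements.\<close>

definition dot :: "'n::finite set \<Rightarrow> complex^'n \<Rightarrow> complex^'n \<Rightarrow> complex"
  where "dot I u v = (\<Sum>i\<in>I. u $ i * v $ i)"

lemma dot_commute: "dot I u v = dot I v u"
  by (simp add: dot_def mult.commute)

lemma clinear_dot: "clinear (dot I u)"
  by (auto simp: clinear_def dot_def linear_iff algebra_simps sum.distrib scaleR_sum_right sum_distrib_left J_vec_def J_complex_def)

lemma dot_add_right: "dot I u (v + w) = dot I u v + dot I u w"
  and dot_add_left: "dot I (v + w) u = dot I v u + dot I w u"
  and dot_cscale_right: "dot I u (s *\<^sub>C v) = s * dot I u v"
  and dot_cscale_left: "dot I (s *\<^sub>C v) u = s * dot I v u"
  using clinear_add[OF clinear_dot] clinear_cscale[OF clinear_dot] clinear_diff[OF clinear_dot] by (auto simp: dot_commute[of I _ u])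

lemma quad_add: "quad I (u + v) = quad I u + 2 * dot I u v + quad I v"
  by (simp add: quad_def dot_def power2_sum sum.distrib sum_distrib_left mult.assoc)

lemma cmod_dot: "cmod (dot I u v) \<le> norm u * norm v"
proof -
  have "cmod (dot I u v) \<le> (\<Sum>i\<in>I. \<bar>cmod (u $ i)\<bar> * \<bar>cmod (v $ i)\<bar>)"
    unfolding dot_def by (rule order_trans[OF norm_sum]) (simp add: norm_mult)
  also have "\<dots> \<le> L2_set (\<lambda>i. cmod (u $ i)) I * L2_set (\<lambda>i. cmod (v $ i)) I"
    by (rule L2_set_mult_ineq)
  also have "\<dots> \<le> norm u * norm v"
    unfolding norm_vec_def L2_set_def
    by (intro mult_mono real_sqrt_le_mono sum_mono2) (auto intro: sum_nonneg)
  finally show ?thesis .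
qed

lemma quad_dot: "quad I u = dot I u u"
  by (simp add: quad_def dot_def power2_eq_square)

lemma cmod_quad: "cmod (quad I u) \<le> (norm u)\<^sup>2"
  using cmod_dot[of I u u] by (simp add: quad_dot power2_eq_square)

definition QQ :: "'n::finite set \<Rightarrow> (complex^'n) \<times> (complex^'n) \<Rightarrow> complex"
  where "QQ I Z = (quad I (fst Z) + quad I (snd Z)) / 2"

lemma holo_QQ: "holo (QQ I) S"
  unfolding QQ_def
  by (intro holo_divide holo_add holo_const holo_compose[OF holo_quad[of I UNIV]] holo_fst holo_snd holo_id) auto

lemma QQ_scale: "QQ I (s *\<^sub>C Z) = s\<^sup>2 * QQ I Z"
  by (simp add: QQ_def quad_scale algebra_simps)

lemma QQ_add: "QQ I (Z + W) = QQ I Z + (dot I (fst Z) (fst W) + dot I (snd Z) (snd W)) + QQ I W"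
  by (simp add: QQ_def quad_add) (simp add: field_simps)

lemma cmod_dot_pair: "cmod (dot I (fst Z) (fst W) + dot I (snd Z) (snd W)) \<le> norm Z * norm W"
proof -
  have "cmod (dot I (fst Z) (fst W) + dot I (snd Z) (snd W)) \<le> norm (fst Z) * norm (fst W) + norm (snd Z) * norm (snd W)"
    by (intro norm_triangle_mono cmod_dot)
  also have "\<dots> \<le> sqrt ((norm (fst Z))\<^sup>2 + (norm (snd Z))\<^sup>2) * sqrt ((norm (fst W))\<^sup>2 + (norm (snd W))\<^sup>2)"
    unfolding real_sqrt_mult[symmetric]
  proof (rule real_le_rsqrt)
    have "0 \<le> (norm (fst Z) * norm (snd W) - norm (snd Z) * norm (fst W))\<^sup>2" by simp
    then show "(norm (fst Z) * norm (fst W) + norm (snd Z) * norm (snd W))\<^sup>2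
      \<le> ((norm (fst Z))\<^sup>2 + (norm (snd Z))\<^sup>2) * ((norm (fst W))\<^sup>2 + (norm (snd W))\<^sup>2)"
      by (simp add: power2_eq_square algebra_simps)
  qed
  finally show ?thesis by (simp add: norm_prod_def)
qed

lemma cmod_QQ: "cmod (QQ I Z) \<le> (norm Z)\<^sup>2 / 2"
  using cmod_dot_pair[of I Z Z] by (simp add: QQ_def quad_dot norm_divide power2_eq_square)

lemma fd_QQ: "fd (QQ I) Z W = dot I (fst Z) (fst W) + dot I (snd Z) (snd W)"
proof -
  have "(QQ I has_derivative (\<lambda>W. dot I (fst Z) (fst W) + dot I (snd Z) (snd W))) (at Z)"
    unfolding has_derivative_at
  proof (intro conjI)
    show "bounded_linear (\<lambda>W. dot I (fst Z) (fst W) + dot I (snd Z) (snd W))"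
      by (intro bounded_linear_add clinear_bounded_linear clinear_compose[OF clinear_fst] clinear_compose[OF clinear_snd] clinear_dot)
    show "(\<lambda>W. norm (QQ I (Z + W) - QQ I Z - (dot I (fst Z) (fst W) + dot I (snd Z) (snd W))) / norm W) \<midarrow>0\<rightarrow> 0"
    proof (rule Lim_null_comparison)
      show "(\<lambda>W::(complex^'a) \<times> (complex^'a). norm W / 2) \<midarrow>0\<rightarrow> 0"
        by (intro tendsto_eq_intros) auto
      show "\<forall>\<^sub>F W in at 0. norm (norm (QQ I (Z + W) - QQ I Z - (dot I (fst Z) (fst W) + dot I (snd Z) (snd W))) / norm W) \<le> norm W / 2"
      proof (rule eventually_at_topological[THEN iffD2], intro exI[of _ UNIV] conjI ballI impI)
        fix W :: "(complex^'a) \<times> (complex^'a)" assume "W \<noteq> 0"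
        then show "norm (norm (QQ I (Z + W) - QQ I Z - (dot I (fst Z) (fst W) + dot I (snd Z) (snd W))) / norm W) \<le> norm W / 2"
          using cmod_QQ[of I W] unfolding QQ_add by (simp add: field_simps power2_eq_square)
      qed auto
    qed
  qed
  from fun_cong[OF fd_eq[OF this]] show ?thesis .
qed

lemma norm_Pair_zero [simp]: "norm (a, 0) = norm a" "norm (0, b) = norm b"
  by (simp_all add: norm_prod_def)

lemma norm_fst_snd: "norm (fst Z) \<le> norm Z" "norm (snd Z) \<le> norm Z"
  by (cases Z; simp add: norm_fst_le norm_snd_le)+

section \<open>The first integral\<close>

locale null_pair =
  fixes I :: "'n::finite set" and a b :: 'n
  assumes ab: "a \<in> I" "b \<in> I" "a \<noteq> b"
begin

text \<open>The indices a and b exist because n - c >= 2. Null vectors scaled to pair to 1/2 give q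
  (n1 + s n2) = s, so q is a coordinate on this line.\<close>

definition n1 :: "complex^'n" where "n1 = (1 / 2) *\<^sub>C (axis a 1 - \<i> *\<^sub>C axis b 1)"
definition n2 :: "complex^'n" where "n2 = (1 / 2) *\<^sub>C (axis a 1 + \<i> *\<^sub>C axis b 1)"

lemma dot_axis: "i \<in> I \<Longrightarrow> dot I (axis i 1) v = v $ i"
  by (simp add: dot_def axis_def if_distrib[of "\<lambda>x. x * _"] cong: if_cong)

lemma dot_n: "dot I n1 v = (v $ a - \<i> * v $ b) / 2" "dot I n2 v = (v $ a + \<i> * v $ b) / 2"
  by (simp_all add: n1_def n2_def dot_cscale_left dot_add_left dot_axis ab field_simps
      dot_cscale_left[of I "-1", simplified] diff_conv_add_uminus[of "axis a 1"] del: add_uminus_conv_diff)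

lemma n_nth: "n1 $ a = 1 / 2" "n1 $ b = - \<i> / 2" "n2 $ a = 1 / 2" "n2 $ b = \<i> / 2"
  using ab by (simp_all add: n1_def n2_def axis_def)

lemma dot_nn [simp]: "dot I n1 n1 = 0" "dot I n2 n2 = 0" "dot I n1 n2 = 1 / 2" "dot I n2 n1 = 1 / 2"
  by (simp_all add: dot_n n_nth)

lemma quad_n [simp]: "quad I n1 = 0" "quad I n2 = 0"
  by (simp_all add: quad_dot)

lemma cj_n [simp]: "cj n1 = n2" "cj n2 = n1"
  by (auto simp: n1_def n2_def vec_eq_iff axis_def)

lemma proj_n [simp]: "proj I n1 = n1" "proj I n2 = n2"
  using ab by (auto simp: n1_def n2_def proj_def vec_eq_iff axis_def)

text \<open>The exact norm is 1 / sqrt 2; 7072/10000 is a rational number just above it.\<close>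

lemma norm_n: "norm n1 \<le> (7072 / 10000)" "norm n2 \<le> (7072 / 10000)"
proof -
  have "(norm n2)\<^sup>2 = (\<Sum>i\<in>UNIV. (cmod (n2 $ i))\<^sup>2)"
    by (simp add: norm_vec_def L2_set_def sum_nonneg)
  also have "\<dots> = (\<Sum>i\<in>{a, b}. (cmod (n2 $ i))\<^sup>2)"
    by (rule sum.mono_neutral_right) (auto simp: n2_def axis_def)
  also have "\<dots> = 1 / 2" using ab by (simp add: n_nth norm_divide power2_eq_square)
  also have "\<dots> \<le> (7072 / 10000)\<^sup>2" by (simp add: power2_eq_square)
  finally show "norm n2 \<le> (7072 / 10000)" by (rule power2_le_imp_le) simp
  then show "norm n1 \<le> (7072 / 10000)" using norm_cj[of n2] by simp
qed

end

text \<open>The situation after rescaling. \<open>sym\<close> expresses that F is real at real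
  points, \<open>inv\<close> that it ignores the coordinates outside I, and \<open>levi\<close> that
  at regular real zeros the Levi form, read as a mixed second derivative of the complexification,
  vanishes on the complex tangent space.\<close>

locale core = null_pair I a b
  for F :: "(complex^'n) \<times> (complex^'n) \<Rightarrow> complex" and I :: "'n set" and a b :: 'n +
  fixes \<eta> :: real
  assumes hol: "holo F (ball 0 100)"
    and est: "\<And>Z. Z \<in> ball 0 100 \<Longrightarrow> cmod (F Z - QQ I Z) \<le> \<eta> * norm Z ^ 3"
    and sym: "\<And>Z. Z \<in> ball 0 100 \<Longrightarrow> F (sw Z) = cnj (F Z)"
    and \<eta>: "\<eta> \<ge> 0" "\<eta> \<le> 1 / 10 ^ 11"
    and inv: "\<And>z w. (z, w) \<in> ball 0 100 \<Longrightarrow> F (proj I z, proj I w) = F (z, w)"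
    and levi: "\<And>z u v. norm z < 10 \<Longrightarrow> F (z, cj z) = 0 \<Longrightarrow> fd F (z, cj z) (v, 0) \<noteq> 0 \<Longrightarrow>
      fd F (z, cj z) (u, 0) = 0 \<Longrightarrow> hess F (z, cj z) (u, 0) (0, cj u) = 0"
begin

text \<open>A real point of the model quadric at which the differential of QQ does not vanish: its
  value on (n1, 0) is 1/2.\<close>

definition Z0 where "Z0 = (n2, n1)"

lemma norm_Z0: "norm Z0 \<le> (1001 / 1000)"
proof -
  have "(norm Z0)\<^sup>2 = (norm n2)\<^sup>2 + (norm n1)\<^sup>2" by (simp add: Z0_def norm_prod_def)
  also have "\<dots> \<le> (7072 / 10000)\<^sup>2 + (7072 / 10000)\<^sup>2" by (intro add_mono power_mono norm_n) auto
  also have "\<dots> \<le> (1001 / 1000)\<^sup>2" by (simp add: power2_eq_square)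
  finally show ?thesis by (rule power2_le_imp_le) simp
qed

lemma sw_Z0 [simp]: "sw Z0 = Z0" by (simp add: Z0_def sw_def)

text \<open>The scales r. The disc is convex, contains the segment (0, 1] and has 0 on its boundary,
  so identities can be continued from r = 1 towards r = 0.\<close>

abbreviation D where "D \<equiv> ball (3 / 5 :: complex) (3 / 5)"

lemma D: assumes "r \<in> D" shows "r \<noteq> 0" "cmod r \<le> 6 / 5"
proof -
  have *: "cmod (3 / 5 - r) < 3 / 5" using assms by (simp add: dist_norm)
  then show "r \<noteq> 0" by auto
  show "cmod r \<le> 6 / 5" using * norm_triangle_ineq4[of "3/5" "3 / 5 - r"] by simp
qed

lemma D_real: "0 < x \<Longrightarrow> x \<le> 1 \<Longrightarrow> complex_of_real x \<in> D"
proof -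
  assume "0 < x" "x \<le> 1"
  have "dist (3 / 5) (complex_of_real x) = cmod (complex_of_real (3 / 5 - x))" by (simp add: dist_norm)
  also have "\<dots> = \<bar>3 / 5 - x\<bar>" by (rule norm_of_real)
  also have "\<dots> < 3 / 5" using \<open>0 < x\<close> \<open>x \<le> 1\<close> unfolding abs_less_iff by simp
  finally show ?thesis by simp
qed

lemma est_scaled:
  assumes r: "r \<noteq> 0" and Z: "cmod r * norm Z < 100"
  shows "cmod (F (r *\<^sub>C Z) / r\<^sup>2 - QQ I Z) \<le> \<eta> * cmod r * norm Z ^ 3"
proof -
  have "cmod (F (r *\<^sub>C Z) - r\<^sup>2 * QQ I Z) \<le> \<eta> * (cmod r * norm Z) ^ 3"
    using est[of "r *\<^sub>C Z"] Z by (simp add: QQ_scale)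
  moreover have "F (r *\<^sub>C Z) / r\<^sup>2 - QQ I Z = (F (r *\<^sub>C Z) - r\<^sup>2 * QQ I Z) / r\<^sup>2"
    using r by (simp add: field_simps)
  ultimately have "cmod (F (r *\<^sub>C Z) / r\<^sup>2 - QQ I Z) \<le> \<eta> * (cmod r * norm Z) ^ 3 / (cmod r)\<^sup>2"
    by (simp add: norm_divide norm_power divide_right_mono)
  also have "\<dots> = \<eta> * cmod r * norm Z ^ 3"
    using r by (simp add: power_mult_distrib power3_eq_cube power2_eq_square)
  finally show ?thesis .
qed

text \<open>Joint holomorphy in the scale and the displacement is what permits continuation in r,
  and the bound on \<sigma> is uniform in r. The numbers 6 and 1 / 10^8 are twice the constants 3
  and 1 / (2 * 10^8) of the estimate \<open>est1\<close> below; the factor 2 bounds c.\<close>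

definition graph_fn where
  "graph_fn d \<sigma> \<longleftrightarrow> holo \<sigma> (D \<times> ball 0 (1 / 100)) \<and>
     (\<forall>r\<in>D. \<forall>\<zeta>. norm \<zeta> < 1 / 100 \<longrightarrow> F (r *\<^sub>C (Z0 + \<zeta> + \<sigma> (r, \<zeta>) *\<^sub>C d)) = 0 \<and>
        cmod (\<sigma> (r, \<zeta>)) \<le> 6 * norm \<zeta> + 1 / 10 ^ 8 \<and>
        (\<forall>s. cmod s < 1 / 2 \<longrightarrow> F (r *\<^sub>C (Z0 + \<zeta> + s *\<^sub>C d)) = 0 \<longrightarrow> s = \<sigma> (r, \<zeta>)))"

lemma graph_fn:
  assumes "graph_fn d \<sigma>"
  shows "holo \<sigma> (D \<times> ball 0 (1 / 100))"
    "\<And>r \<zeta>. r \<in> D \<Longrightarrow> norm \<zeta> < 1 / 100 \<Longrightarrow> F (r *\<^sub>C (Z0 + \<zeta> + \<sigma> (r, \<zeta>) *\<^sub>C d)) = 0"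
    "\<And>r \<zeta>. r \<in> D \<Longrightarrow> norm \<zeta> < 1 / 100 \<Longrightarrow> cmod (\<sigma> (r, \<zeta>)) \<le> 6 * norm \<zeta> + 1 / 10 ^ 8"
    "\<And>r \<zeta> s. r \<in> D \<Longrightarrow> norm \<zeta> < 1 / 100 \<Longrightarrow> cmod s < 1 / 2 \<Longrightarrow> F (r *\<^sub>C (Z0 + \<zeta> + s *\<^sub>C d)) = 0 \<Longrightarrow> s = \<sigma> (r, \<zeta>)"
  using assms unfolding graph_fn_def by blast+

text \<open>
  Near \<open>Z0\<close> the complexified hypersurface, rescaled by \<open>r\<close>, is a graph in every direction \<open>d\<close> along
  which \<open>QQ I\<close> is affine with slope \<open>1 / c\<close>.
\<close>

lemma graph:
  assumes d: "norm d \<le> (1001 / 1000)" and c: "c = 1 \<or> c = 2" and Q: "\<And>s. QQ I (Z0 + s *\<^sub>C d) = s / c"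
  shows "\<exists>\<sigma>. graph_fn d \<sigma>"
proof -
  let ?S = "D \<times> ball 0 (1 / 100) :: (complex \<times> (complex^'n) \<times> (complex^'n)) set"
  \<comment> \<open>The fixed points of h in s are the roots of F, and h equals -c times the
    deviation of F (r Z) / r^2 from its affine model s / c. It is therefore small on the whole unit
    disc.\<close>
  define h where "h = (\<lambda>(p, s). s - c * (F (fst p *\<^sub>C (Z0 + snd p + s *\<^sub>C d)) / (fst p)\<^sup>2))"
  have cc: "cmod c \<le> 2" "c \<noteq> 0" using c by auto
  have size: "norm (Z0 + \<zeta> + s *\<^sub>C d) \<le> (101 / 50)" if "norm \<zeta> < 1 / 100" "cmod s < 1" for \<zeta> s
  proof -
    have "norm (s *\<^sub>C d) \<le> 1 * (1001 / 1000)" using that d by (simp only: norm_cscale) (intro mult_mono, auto)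
    then show ?thesis
      using norm_triangle_ineq[of "Z0 + \<zeta>" "s *\<^sub>C d"] norm_triangle_ineq[of Z0 \<zeta>] norm_Z0 that by linarith
  qed
  have est1: "cmod (F (r *\<^sub>C (Z0 + \<zeta> + s *\<^sub>C d)) / r\<^sup>2 - s / c) \<le> 3 * norm \<zeta> + 1 / (2 * 10 ^ 8)"
    if r: "r \<in> D" and \<zeta>: "norm \<zeta> < 1 / 100" and s: "cmod s < 1" for r \<zeta> s
  proof -
    let ?Z = "Z0 + \<zeta> + s *\<^sub>C d"
    have "cmod r * norm ?Z \<le> 6 / 5 * (101 / 50)" using D[OF r] size[OF \<zeta> s] by (intro mult_mono) auto
    then have "cmod (F (r *\<^sub>C ?Z) / r\<^sup>2 - QQ I ?Z) \<le> \<eta> * cmod r * norm ?Z ^ 3"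
      using D[OF r] by (intro est_scaled) auto
    also have "\<dots> \<le> 1 / 10 ^ 11 * (6 / 5) * (101 / 50) ^ 3"
      using \<eta> D[OF r] size[OF \<zeta> s] by (intro mult_mono power_mono) auto
    also have "\<dots> \<le> 1 / (2 * 10 ^ 8)" by (simp add: power3_eq_cube)
    finally have 1: "cmod (F (r *\<^sub>C ?Z) / r\<^sup>2 - QQ I ?Z) \<le> 1 / (2 * 10 ^ 8)" .
    have "QQ I ?Z = s / c + ((dot I (fst (Z0 + s *\<^sub>C d)) (fst \<zeta>) + dot I (snd (Z0 + s *\<^sub>C d)) (snd \<zeta>)) + QQ I \<zeta>)"
      using QQ_add[of I "Z0 + s *\<^sub>C d" \<zeta>] Q[of s] by (simp add: add_ac)
    then have "cmod (QQ I ?Z - s / c) \<le> norm (Z0 + s *\<^sub>C d) * norm \<zeta> + (norm \<zeta>)\<^sup>2 / 2"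
      using norm_triangle_mono[OF cmod_dot_pair cmod_QQ, of I "Z0 + s *\<^sub>C d" \<zeta> I \<zeta>] by simp
    also have "\<dots> \<le> (101 / 50) * norm \<zeta> + 1 / 100 * norm \<zeta> / 2"
    proof (intro add_mono mult_right_mono divide_right_mono)
      show "norm (Z0 + s *\<^sub>C d) \<le> 101 / 50" using size[of 0 s] s by simp
      show "(norm \<zeta>)\<^sup>2 \<le> 1 / 100 * norm \<zeta>"
        unfolding power2_eq_square using \<zeta> by (intro mult_right_mono) auto
    qed auto
    also have "\<dots> = (81 / 40) * norm \<zeta>" by simp
    also have "\<dots> \<le> 3 * norm \<zeta>" by (intro mult_right_mono) auto
    finally have 2: "cmod (QQ I ?Z - s / c) \<le> 3 * norm \<zeta>" .
    show ?thesis
      using norm_triangle_mono[OF 1 2] by simp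
  qed
  have hs: "h ((r, \<zeta>), s) = - c * (F (r *\<^sub>C (Z0 + \<zeta> + s *\<^sub>C d)) / r\<^sup>2 - s / c)" for r \<zeta> s
    using cc by (simp add: h_def field_simps)
  have hb: "cmod (h ((r, \<zeta>), s)) \<le> 6 * norm \<zeta> + 1 / 10 ^ 8"
    if "r \<in> D" "norm \<zeta> < 1 / 100" "cmod s < 1" for r \<zeta> s
  proof -
    have "cmod (h ((r, \<zeta>), s)) \<le> 2 * (3 * norm \<zeta> + 1 / (2 * 10 ^ 8))"
      unfolding hs norm_mult norm_minus_cancel by (intro mult_mono est1 that cc) auto
    then show ?thesis by simp
  qed
  have root: "h ((r, \<zeta>), s) = s \<longleftrightarrow> F (r *\<^sub>C (Z0 + \<zeta> + s *\<^sub>C d)) = 0" if "r \<in> D" for r \<zeta> s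
    using D(1)[OF that] cc by (simp add: h_def)
  have "holo h (?S \<times> ball 0 1)"
    unfolding h_def split_beta
  proof (intro holo_diff holo_mult holo_divide holo_const holo_power holo_snd holo_fst holo_id)
    show "holo (\<lambda>p. F (fst (fst p) *\<^sub>C (Z0 + snd (fst p) + snd p *\<^sub>C d))) (?S \<times> ball 0 1)"
    proof (rule holo_compose[OF hol])
      show "holo (\<lambda>p. fst (fst p) *\<^sub>C (Z0 + snd (fst p) + snd p *\<^sub>C d)) (?S \<times> ball 0 1)"
        by (intro holo_cscale holo_add holo_const holo_snd holo_fst holo_id)
      fix p assume "p \<in> ?S \<times> ball (0::complex) 1"
      then obtain r \<zeta> s where p: "p = ((r, \<zeta>), s)" "r \<in> D" "norm \<zeta> < 1 / 100" "cmod s < 1" by auto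
      have "cmod r * norm (Z0 + \<zeta> + s *\<^sub>C d) \<le> 6 / 5 * (101 / 50)"
        using D[OF p(2)] size[OF p(3,4)] by (intro mult_mono) auto
      then show "fst (fst p) *\<^sub>C (Z0 + snd (fst p) + snd p *\<^sub>C d) \<in> ball 0 100" by (simp add: p)
    qed
    show "(fst (fst z))\<^sup>2 \<noteq> 0" if "z \<in> ?S \<times> ball 0 1" for z
      using that D(1) by auto
  qed
  then obtain \<sigma> where \<sigma>: "holo \<sigma> ?S" "\<And>Z. Z \<in> ?S \<Longrightarrow> cmod (\<sigma> Z - 0) \<le> 1 / 8" "\<And>Z. Z \<in> ?S \<Longrightarrow> h (Z, \<sigma> Z) = \<sigma> Z"
    "\<And>Z s. Z \<in> ?S \<Longrightarrow> s \<in> ball 0 (1 / 2) \<Longrightarrow> h (Z, s) = s \<Longrightarrow> s = \<sigma> Z"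
  proof (rule holo_fixpoint[rotated 1])
    show "open ?S" by (intro open_Times open_ball)
    show "cmod (h (Z, s) - 0) \<le> 1 / 8" if Zs: "Z \<in> ?S" "s \<in> ball 0 1" for Z s
    proof -
      obtain r \<zeta> where Z: "Z = (r, \<zeta>)" by (cases Z)
      have "6 * norm \<zeta> + 1 / 10 ^ 8 \<le> 1 / 8" using Zs Z by simp
      then show ?thesis using hb[of r \<zeta> s] Zs by (simp add: Z)
    qed
  qed auto
  show ?thesis
    unfolding graph_fn_def
  proof (intro exI[of _ \<sigma>] conjI ballI allI impI)
    show "holo \<sigma> ?S" by (rule \<sigma>)
    fix r and \<zeta> :: "(complex^'n) \<times> (complex^'n)" assume r: "r \<in> D" and \<zeta>: "norm \<zeta> < 1 / 100"
    then have S: "(r, \<zeta>) \<in> ?S" by simp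
    show "F (r *\<^sub>C (Z0 + \<zeta> + \<sigma> (r, \<zeta>) *\<^sub>C d)) = 0"
      using \<sigma>(3)[OF S] root[OF r] by blast
    show "cmod (\<sigma> (r, \<zeta>)) \<le> 6 * norm \<zeta> + 1 / 10 ^ 8"
      using hb[OF r \<zeta>, of "\<sigma> (r, \<zeta>)"] \<sigma>(2,3)[OF S] by simp
    show "s = \<sigma> (r, \<zeta>)" if "cmod s < 1 / 2" "F (r *\<^sub>C (Z0 + \<zeta> + s *\<^sub>C d)) = 0" for s
      using \<sigma>(4)[OF S, of s] root[OF r] that by simp
  qed
qed

end

section \<open>The Levi condition on the complexified hypersurface\<close>

context core
begin

text \<open>Here QQ (z, n1 + s n2) = (q z + s) / 2, so the root is near -q z and exists on a ball
  containing the singular point 0. The radius 40 for s is taken so that 40 / 8 exceeds the bound 4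
  on |q z| with room for the error.\<close>

lemma first_integral_ex:
  "\<exists>t. holo t (ball 0 2) \<and> (\<forall>z\<in>ball 0 2. F (z, n1 + t z *\<^sub>C n2) = 0 \<and> cmod (t z + quad I z) \<le> 1 / 10000 \<and>
     (\<forall>s. cmod s < 20 \<longrightarrow> F (z, n1 + s *\<^sub>C n2) = 0 \<longrightarrow> s = t z))"
proof -
  define h where "h = (\<lambda>(z, s). s - 2 * F (z, n1 + s *\<^sub>C n2))"
  have size: "norm (z, n1 + s *\<^sub>C n2) \<le> 31" if "norm z < 2" "cmod s < 40" for z s
  proof -
    have "norm (s *\<^sub>C n2) \<le> 40 * (7072 / 10000)"
      unfolding norm_cscale using that norm_n by (intro mult_mono) auto
    then show ?thesis
      using norm_triangle_ineq[of n1 "s *\<^sub>C n2"] norm_Pair_le[of z "n1 + s *\<^sub>C n2"] norm_n that by linarith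
  qed
  have Q: "QQ I (z, n1 + s *\<^sub>C n2) = (quad I z + s) / 2" for z s
    by (simp add: QQ_def quad_add quad_scale dot_cscale_right)
  have hb: "cmod (h (z, s) + quad I z) \<le> 1 / 10000" if "norm z < 2" "cmod s < 40" for z s
  proof -
    have "cmod (F (z, n1 + s *\<^sub>C n2) - QQ I (z, n1 + s *\<^sub>C n2)) \<le> \<eta> * norm (z, n1 + s *\<^sub>C n2) ^ 3"
      using size[OF that] by (intro est) simp
    also have "\<dots> \<le> 1 / 10 ^ 11 * 31 ^ 3"
      using \<eta> size[OF that] by (intro mult_mono power_mono) auto
    also have "\<dots> \<le> 1 / 20000" by (simp add: power3_eq_cube)
    finally have "cmod (F (z, n1 + s *\<^sub>C n2) - QQ I (z, n1 + s *\<^sub>C n2)) \<le> 1 / 20000" .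
    moreover have "h (z, s) + quad I z = - (2 * (F (z, n1 + s *\<^sub>C n2) - QQ I (z, n1 + s *\<^sub>C n2)))"
      by (simp add: h_def Q field_simps)
    then have "cmod (h (z, s) + quad I z) = 2 * cmod (F (z, n1 + s *\<^sub>C n2) - QQ I (z, n1 + s *\<^sub>C n2))"
      by (simp only: norm_minus_cancel norm_mult norm_numeral)
    ultimately show ?thesis by simp
  qed
  have root: "h (z, s) = s \<longleftrightarrow> F (z, n1 + s *\<^sub>C n2) = 0" for z s by (simp add: h_def)
  have "holo h (ball 0 2 \<times> ball 0 40)"
    unfolding h_def split_beta
  proof (intro holo_diff holo_mult holo_const holo_snd holo_id)
    show "holo (\<lambda>p. F (fst p, n1 + snd p *\<^sub>C n2)) (ball 0 2 \<times> ball 0 40)"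
    proof (rule holo_compose[OF hol])
      show "holo (\<lambda>p. (fst p, n1 + snd p *\<^sub>C n2)) (ball 0 2 \<times> ball 0 40)"
        by (intro holo_Pair holo_add holo_cscale holo_const holo_fst holo_snd holo_id)
      show "(fst p, n1 + snd p *\<^sub>C n2) \<in> ball 0 100" if "p \<in> ball 0 2 \<times> ball 0 40" for p :: "(complex^'n) \<times> complex"
        using size[of "fst p" "snd p"] that by auto
    qed
  qed
  then obtain t where t: "holo t (ball 0 2)" "\<And>z. z \<in> ball 0 2 \<Longrightarrow> cmod (t z - 0) \<le> 40 / 8"
    "\<And>z. z \<in> ball 0 2 \<Longrightarrow> h (z, t z) = t z"
    "\<And>z s. z \<in> ball 0 2 \<Longrightarrow> s \<in> ball 0 (40 / 2) \<Longrightarrow> h (z, s) = s \<Longrightarrow> s = t z"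
  proof (rule holo_fixpoint[rotated 1])
    show "cmod (h (z, s) - 0) \<le> 40 / 8" if "z \<in> ball 0 2" "s \<in> ball 0 40" for z s
    proof -
      have "cmod (quad I z) \<le> 2\<^sup>2"
        using cmod_quad[of I z] power_mono[of "norm z" 2 2] that by simp
      moreover have "cmod (h (z, s) + quad I z) \<le> 1 / 10000" using hb that by simp
      ultimately show ?thesis
        using norm_triangle_ineq4[of "h (z, s) + quad I z" "quad I z"] by simp
    qed
  qed auto
  show ?thesis
  proof (intro exI[of _ t] conjI ballI allI impI t(1))
    fix z :: "complex^'n" assume z: "z \<in> ball 0 2"
    show "F (z, n1 + t z *\<^sub>C n2) = 0" using t(3)[OF z] root by blast
    show "cmod (t z + quad I z) \<le> 1 / 10000" using hb[of z "t z"] t(2,3)[OF z] z by simp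
    show "s = t z" if "cmod s < 20" "F (z, n1 + s *\<^sub>C n2) = 0" for s
      using t(4)[OF z, of s] root that by simp
  qed
qed

lemma fd_near:
  assumes "norm Z \<le> 3"
  shows "cmod (fd F Z W - fd (QQ I) Z W) \<le> 1 / 10 ^ 6 * norm W"
proof -
  have sub: "ball Z 1 \<subseteq> ball 0 100"
  proof
    fix Y assume "Y \<in> ball Z 1"
    then show "Y \<in> ball 0 100" using assms norm_triangle_ineq2[of Y Z] by (simp add: dist_norm norm_minus_commute)
  qed
  have Z: "Z \<in> ball 0 100" using assms by simp
  have "cmod (fd (\<lambda>Y. F Y - QQ I Y) Z W) \<le> 2 * (1 / 10 ^ 11 * 4 ^ 3) / 1 * norm W"
  proof (rule holo_fd_bound)
    show "holo (\<lambda>Y. F Y - QQ I Y) (ball Z 1)"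
      by (intro holo_diff holo_QQ holo_subset[OF hol sub])
    show "cmod (F Y - QQ I Y) \<le> 1 / 10 ^ 11 * 4 ^ 3" if "Y \<in> ball Z 1" for Y
    proof -
      have "norm Y \<le> 4" using assms that norm_triangle_ineq2[of Y Z] by (simp add: dist_norm norm_minus_commute)
      then have "\<eta> * norm Y ^ 3 \<le> 1 / 10 ^ 11 * 4 ^ 3" using \<eta> by (intro mult_mono power_mono) auto
      then show ?thesis using est[of Y] sub that by force
    qed
  qed simp
  also have "\<dots> \<le> 1 / 10 ^ 6 * norm W" by (intro mult_right_mono) auto
  also have "fd (\<lambda>Y. F Y - QQ I Y) Z = (\<lambda>W. fd F Z W - fd (QQ I) Z W)"
    by (rule fd_eq) (intro has_derivative_diff holo_has_derivative[OF hol Z] holo_has_derivative[OF holo_QQ UNIV_I])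
  finally show ?thesis .
qed

lemma near_Z0: assumes "Z \<in> ball Z0 (1 / 100)" shows "norm Z \<le> 3" "Z \<in> ball 0 100"
proof -
  show "norm Z \<le> 3" using assms norm_Z0 norm_triangle_ineq2[of Z Z0] by (simp add: dist_norm norm_minus_commute)
  then show "Z \<in> ball 0 100" by simp
qed

lemma fd_nonzero:
  assumes Z: "Z \<in> ball Z0 (1 / 100)"
  shows "fd F Z (n1, 0) \<noteq> 0" "fd F Z (0, n2) \<noteq> 0"
proof -
  define \<zeta> where "\<zeta> = Z - Z0"
  have \<zeta>: "norm \<zeta> < 1 / 100" and Z\<zeta>: "Z = Z0 + \<zeta>"
    using Z by (simp_all add: \<zeta>_def dist_norm norm_minus_commute)
  have s: "norm (fst \<zeta>) \<le> 1 / 100" "norm (snd \<zeta>) \<le> 1 / 100"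
    using norm_fst_snd[of \<zeta>] \<zeta> by auto
  have small: "cmod (dot I u v) \<le> 1 / 100" if "norm u \<le> 1 / 100" "norm v \<le> 7072 / 10000" for u v
  proof -
    have "norm u * norm v \<le> 1 / 100 * 1" using that by (intro mult_mono) auto
    then show ?thesis using cmod_dot[of I u v] by simp
  qed
  have *: "cmod (x - 1 / 2) < 1 / 2 \<Longrightarrow> x \<noteq> 0" for x :: complex by auto
  have "fd (QQ I) Z (n1, 0) - 1 / 2 = dot I (fst \<zeta>) n1"
    by (simp add: fd_QQ Z\<zeta> Z0_def dot_add_left clinear_zero[OF clinear_dot])
  then have "cmod (fd (QQ I) Z (n1, 0) - 1 / 2) \<le> 1 / 100" using small[OF s(1) norm_n(1)] by simp
  then have "cmod ((fd F Z (n1, 0) - fd (QQ I) Z (n1, 0)) + (fd (QQ I) Z (n1, 0) - 1 / 2)) \<le> 1 / 10 ^ 6 * norm (n1, 0::complex^'n) + 1 / 100"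
    using fd_near[OF near_Z0(1)[OF Z], of "(n1, 0)"] by (intro norm_triangle_mono)
  then show "fd F Z (n1, 0) \<noteq> 0" using norm_n by (intro *) simp
  have "fd (QQ I) Z (0, n2) - 1 / 2 = dot I (snd \<zeta>) n2"
    by (simp add: fd_QQ Z\<zeta> Z0_def dot_add_left clinear_zero[OF clinear_dot])
  then have "cmod (fd (QQ I) Z (0, n2) - 1 / 2) \<le> 1 / 100" using small[OF s(2) norm_n(2)] by simp
  then have "cmod ((fd F Z (0, n2) - fd (QQ I) Z (0, n2)) + (fd (QQ I) Z (0, n2) - 1 / 2)) \<le> 1 / 10 ^ 6 * norm (0::complex^'n, n2) + 1 / 100"
    using fd_near[OF near_Z0(1)[OF Z], of "(0, n2)"] by (intro norm_triangle_mono)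
  then show "fd F Z (0, n2) \<noteq> 0" using norm_n by (intro *) simp
qed

abbreviation Fz where "Fz Z u \<equiv> fd F Z (u, 0)"
abbreviation Fw where "Fw Z v \<equiv> fd F Z (0, v)"
abbreviation Fzw where "Fzw Z u v \<equiv> hess F Z (u, 0) (0, v)"

lemma Fz_lin: assumes "Z \<in> ball 0 100"
  shows "Fz Z (u + u') = Fz Z u + Fz Z u'" "Fz Z (s *\<^sub>C u) = s * Fz Z u" "Fz Z (u - u') = Fz Z u - Fz Z u'"
    "Fw Z (u + u') = Fw Z u + Fw Z u'" "Fw Z (s *\<^sub>C u) = s * Fw Z u" "Fw Z (u - u') = Fw Z u - Fw Z u'"
proof -
  note c = holo_clinear[OF hol assms]
  have "clinear (\<lambda>u::complex^'n. (u, 0::complex^'n))" "clinear (\<lambda>u::complex^'n. (0::complex^'n, u))"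
    by (intro clinear_Pair clinear_id clinear_const_zero)+
  note c = clinear_compose[OF this(1) c] clinear_compose[OF this(2) c]
  show "Fz Z (u + u') = Fz Z u + Fz Z u'" "Fz Z (s *\<^sub>C u) = s * Fz Z u" "Fz Z (u - u') = Fz Z u - Fz Z u'"
    "Fw Z (u + u') = Fw Z u + Fw Z u'" "Fw Z (s *\<^sub>C u) = s * Fw Z u" "Fw Z (u - u') = Fw Z u - Fw Z u'"
    using clinear_add[OF c(1)] clinear_cscale[OF c(1)] clinear_diff[OF c(1)]
      clinear_add[OF c(2)] clinear_cscale[OF c(2)] clinear_diff[OF c(2)] by simp_all
qed

lemma Fzw_lin: assumes "Z \<in> ball 0 100"
  shows "Fzw Z (u + u') v = Fzw Z u v + Fzw Z u' v" "Fzw Z (s *\<^sub>C u) v = s * Fzw Z u v" "Fzw Z (u - u') v = Fzw Z u v - Fzw Z u' v"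
    "Fzw Z v (u + u') = Fzw Z v u + Fzw Z v u'" "Fzw Z v (s *\<^sub>C u) = s * Fzw Z v u" "Fzw Z v (u - u') = Fzw Z v u - Fzw Z v u'"
proof -
  have "clinear (\<lambda>u::complex^'n. (u, 0::complex^'n))" "clinear (\<lambda>u::complex^'n. (0::complex^'n, u))"
    by (intro clinear_Pair clinear_id clinear_const_zero)+
  note c = clinear_compose[OF this(1) hess_clinear_left[OF open_ball hol assms]]
    clinear_compose[OF this(2) hess_clinear_right[OF open_ball hol assms]]
  show "Fzw Z (u + u') v = Fzw Z u v + Fzw Z u' v" "Fzw Z (s *\<^sub>C u) v = s * Fzw Z u v" "Fzw Z (u - u') v = Fzw Z u v - Fzw Z u' v"
    "Fzw Z v (u + u') = Fzw Z v u + Fzw Z v u'" "Fzw Z v (s *\<^sub>C u) = s * Fzw Z v u" "Fzw Z v (u - u') = Fzw Z v u - Fzw Z v u'"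
    using clinear_add[OF c(1)] clinear_cscale[OF c(1)] clinear_diff[OF c(1)]
      clinear_add[OF c(2)] clinear_cscale[OF c(2)] clinear_diff[OF c(2)] by simp_all
qed

lemma fd_sw:
  assumes "Z \<in> ball 0 100"
  shows "fd F (sw Z) (sw V) = cnj (fd F Z V)"
proof -
  have Z: "sw Z \<in> ball 0 100" using assms by simp
  have "(sw has_derivative sw) (at Z)" by (rule bounded_linear_imp_has_derivative[OF bounded_linear_sw])
  from has_derivative_compose[OF this holo_has_derivative[OF hol Z]]
  have 1: "((\<lambda>Y. F (sw Y)) has_derivative (\<lambda>V. fd F (sw Z) (sw V))) (at Z)" .
  have 2: "((\<lambda>Y. cnj (F Y)) has_derivative (\<lambda>V. cnj (fd F Z V))) (at Z)"
    by (rule has_derivative_cnj[OF holo_has_derivative[OF hol assms]])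
  have "fd (\<lambda>Y. F (sw Y)) Z = fd (\<lambda>Y. cnj (F Y)) Z"
    by (rule fd_cong[OF open_ball assms sym])
  then show ?thesis using fd_eq[OF 1] fd_eq[OF 2] by metis
qed

text \<open>\<open>X Z u\<close> is, up to the factor \<open>Fz Z n1\<close>, the projection of u
  along n1 onto the kernel of \<open>Fz Z\<close>. \<open>Y\<close> does the same along n2 for
  \<open>Fw Z\<close>. Clearing the denominators keeps everything polynomial in derivatives of
  F.\<close>

definition X where "X Z u = Fz Z n1 *\<^sub>C u - Fz Z u *\<^sub>C n1"
definition Y where "Y Z v = Fw Z n2 *\<^sub>C v - Fw Z v *\<^sub>C n2"
text \<open>The complexified Levi form on the kernel vectors \<open>X Z u\<close> and
  \<open>Y Z v\<close>, expanded so that it is visibly holomorphic in Z.\<close>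

definition Lam where "Lam u v Z = Fz Z n1 * (Fw Z n2 * Fzw Z u v - Fw Z v * Fzw Z u n2)
  - Fz Z u * (Fw Z n2 * Fzw Z n1 v - Fw Z v * Fzw Z n1 n2)"

lemma Lam: "Z \<in> ball 0 100 \<Longrightarrow> Lam u v Z = Fzw Z (X Z u) (Y Z v)"
  by (simp add: Lam_def X_def Y_def Fzw_lin) (simp add: algebra_simps)

lemma holo_Lam: "holo (Lam u v) (ball 0 100)"
  unfolding Lam_def[abs_def] hess_def
  by (intro holo_diff holo_mult holo_fd open_ball hol)

text \<open>Polarisation of a sesquilinear form S: its vanishing on u + v and on u + \<i> v gives
  both S u v + S v u = 0 and S u v - S v u = 0.\<close>

lemma levi_polarized:
  assumes z: "norm z < 10" "F (z, cj z) = 0" "Fz (z, cj z) v0 \<noteq> 0"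
    and u: "Fz (z, cj z) u = 0" and v: "Fz (z, cj z) v = 0"
  shows "Fzw (z, cj z) u (cj v) = 0"
proof -
  have Z: "(z, cj z) \<in> ball 0 100" using norm_Pair_le[of z "cj z"] z(1) by simp
  define S where "S u v = Fzw (z, cj z) u (cj v)" for u v
  have S0: "S w w = 0" if "Fz (z, cj z) w = 0" for w
    unfolding S_def by (rule levi[OF z that])
  have Sadd: "S (w + w') x = S w x + S w' x" "S x (w + w') = S x w + S x w'"
    "S (c *\<^sub>C w) x = c * S w x" "S x (c *\<^sub>C w) = cnj c * S x w" for w w' x c
    by (simp_all add: S_def Fzw_lin[OF Z] cj_add cj_cscale)
  have "S (u + v) (u + v) = 0" "S (u + \<i> *\<^sub>C v) (u + \<i> *\<^sub>C v) = 0"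
    using u v by (auto intro!: S0 simp: Fz_lin[OF Z])
  then have "S u v + S v u = 0" "- \<i> * S u v + \<i> * S v u = 0"
    using S0[OF u] S0[OF v] by (simp_all add: Sadd)
  then have "\<i> * (S u v + S v u) - (- \<i> * S u v + \<i> * S v u) = 0" by simp
  then have "2 * \<i> * S u v = 0" by (simp add: algebra_simps)
  then show ?thesis by (simp add: S_def)
qed

lemma Lam_zero_real:
  assumes Z: "Z \<in> ball Z0 (1 / 100)" and sw: "sw Z = Z" and F0: "F Z = 0"
  shows "Lam u v Z = 0"
proof -
  obtain z where z: "Z = (z, cj z)" using sw by (cases Z) (auto simp: sw_def)
  have Zb: "Z \<in> ball 0 100" by (rule near_Z0[OF Z])
  have nz: "norm z < 10" using near_Z0(1)[OF Z] norm_fst_snd(1)[of Z] by (simp add: z)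
  have Fw: "Fw Z v = cnj (Fz Z (cj v))" for v
    using fd_sw[OF Zb, of "(cj v, 0)"] sw by (simp add: sw_def[of "(_, 0)"])
  have Xker: "Fz Z (X Z u) = 0" for u
    by (simp add: X_def Fz_lin[OF Zb])
  \<comment> \<open>At a real point the kernel in w is the conjugate of the kernel in z, so
    \<open>Lam\<close> becomes a value of the polarised Levi form.\<close>
  have "Y Z v = cj (X Z (cj v))"
    by (simp add: X_def Y_def Fw cj_diff cj_cscale)
  moreover have "Fzw (z, cj z) (X Z u) (cj (X Z (cj v))) = 0"
    by (rule levi_polarized[OF nz, of n1]) (use F0 fd_nonzero(1)[OF Z] Xker in \<open>simp_all add: z\<close>)
  ultimately show ?thesis using Lam[OF Zb, of u v] by (simp add: z)
qed

text \<open>Near Z0 the zero set is a graph in the direction d = (n1, n2). As d and Z0 are fixed by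
  \<open>sw\<close>, uniqueness of the root makes \<sigma> real at real parameters, so the
  parametrisation g sends real points to real points. The vanishing known there spreads by
  \<open>holo_zero_real_points\<close> in the parameter.\<close>

lemma Lam_zero:
  assumes Z: "Z \<in> ball Z0 (1 / 4000)" and F0: "F Z = 0"
  shows "Lam u v Z = 0"
proof -
  define d where "d = (n1, n2)"
  have Q: "QQ I (Z0 + s *\<^sub>C d) = s / 1" for s
    by (simp add: d_def Z0_def cscale_Pair QQ_def quad_add quad_scale dot_cscale_right)
  have nd: "norm d = norm Z0" by (simp add: d_def Z0_def norm_prod_def add.commute)
  have swd: "sw d = d" by (simp add: d_def sw_def)
  have "norm d \<le> 1001 / 1000" using nd norm_Z0 by simp
  then obtain \<sigma> where "graph_fn d \<sigma>"
    using graph[of d 1] Q by blast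
  note \<sigma> = graph_fn[OF this]
  have 1: "1 \<in> D" using D_real[of 1] by simp
  define g where "g \<zeta> = Z0 + \<zeta> + \<sigma> (1, \<zeta>) *\<^sub>C d" for \<zeta>
  have g_in: "g \<zeta> \<in> ball Z0 (1 / 100)" if "norm \<zeta> < 1 / 1000" for \<zeta>
  proof -
    have "norm (\<sigma> (1, \<zeta>) *\<^sub>C d) \<le> (6 * norm \<zeta> + 1 / 10 ^ 8) * (1001 / 1000)"
      unfolding norm_cscale using that \<sigma>(3)[OF 1, of \<zeta>] nd norm_Z0 by (intro mult_mono) auto
    then have "norm (\<zeta> + \<sigma> (1, \<zeta>) *\<^sub>C d) < 1 / 100"
      using norm_triangle_ineq[of \<zeta> "\<sigma> (1, \<zeta>) *\<^sub>C d"] that by simp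
    then show ?thesis unfolding g_def add.assoc mem_ball_add .
  qed
  have Fg: "F (g \<zeta>) = 0" if "norm \<zeta> < 1 / 1000" for \<zeta>
    using \<sigma>(2)[OF 1, of \<zeta>] that by (simp add: g_def)
  have "Lam u v (g (0 + (Z - Z0))) = 0"
  proof (rule holo_zero_real_points[where f = "\<lambda>\<zeta>. Lam u v (g \<zeta>)" and \<rho> = "1 / 1000"])
    show "holo (\<lambda>\<zeta>. Lam u v (g \<zeta>)) (ball 0 (1 / 1000))"
    proof (rule holo_compose[OF holo_Lam])
      show "holo g (ball 0 (1 / 1000))"
        unfolding g_def
        by (intro holo_add holo_const holo_id holo_cscale holo_compose[OF \<sigma>(1)] holo_Pair) (use 1 in auto)
      show "g \<zeta> \<in> ball 0 100" if "\<zeta> \<in> ball 0 (1 / 1000)" for \<zeta>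
        using near_Z0(2)[OF g_in] that by simp
    qed
    show "Lam u v (g (0 + x)) = 0" if x: "sw x = x" "norm x < 1 / 1000" for x
    proof -
      have \<zeta>: "norm x < 1 / 100" using x by simp
      have small: "cmod (\<sigma> (1, x)) < 1 / 2" using \<sigma>(3)[OF 1 \<zeta>] x by simp
      have "F (sw (g x)) = 0"
        using sym[OF near_Z0(2)[OF g_in[OF x(2)]]] Fg[OF x(2)] by simp
      moreover have "sw (g x) = Z0 + x + cnj (\<sigma> (1, x)) *\<^sub>C d"
        by (simp add: g_def sw_add sw_cscale x swd)
      ultimately have "cnj (\<sigma> (1, x)) = \<sigma> (1, x)"
        using \<sigma>(4)[OF 1 \<zeta>, of "cnj (\<sigma> (1, x))"] small by simp
      then have "sw (g x) = g x" by (simp add: g_def sw_add sw_cscale x swd)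
      then show ?thesis using Lam_zero_real[OF g_in[OF x(2)] _ Fg[OF x(2)]] by simp
    qed
    show "norm (Z - Z0) < 1 / 1000 / 2" using Z by (simp add: dist_norm norm_minus_commute)
  qed
  moreover have "\<sigma> (1, Z - Z0) = 0"
    using \<sigma>(4)[OF 1, of "Z - Z0" 0] Z F0 by (simp add: dist_norm norm_minus_commute)
  ultimately show ?thesis by (simp add: g_def)
qed

lemma one_in_D: "1 \<in> D" using D_real[of 1] by simp

lemma graph2: "\<exists>\<sigma>. graph_fn (0, n2) \<sigma>"
proof (rule graph[of _ 2])
  show "norm (0 :: complex^'n, n2) \<le> 1001 / 1000" using norm_n by simp
  show "QQ I (Z0 + s *\<^sub>C (0, n2)) = s / 2" for s
    by (simp add: Z0_def cscale_Pair QQ_def quad_add quad_scale dot_cscale_right)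
qed simp

lemma graph1: "\<exists>\<sigma>. graph_fn (n1, 0) \<sigma>"
proof (rule graph[of _ 2])
  show "norm (n1, 0 :: complex^'n) \<le> 1001 / 1000" using norm_n by simp
  show "QQ I (Z0 + s *\<^sub>C (n1, 0)) = s / 2" for s
    by (simp add: Z0_def cscale_Pair QQ_def quad_add quad_scale dot_cscale_right)
qed simp

text \<open>All Segre varieties through z share one tangent hyperplane at z. With z fixed and w
  moving on {F (z, w) = 0}, the derivative of the quotient of \<open>Fz\<close> on u by
  \<open>Fz\<close> on n1 is a multiple of \<open>Lam\<close>, so the quotient is constant.\<close>

lemma Fz_parallel:
  assumes z: "norm (z - n2) < 1 / 50000" and w: "norm (w - n1) < 1 / 50000" "F (z, w) = 0"
    and w': "norm (w' - n1) < 1 / 50000" "F (z, w') = 0"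
  shows "Fz (z, w) u * Fz (z, w') n1 = Fz (z, w') u * Fz (z, w) n1"
proof -
  obtain \<sigma> where "graph_fn (0, n2) \<sigma>"
    using graph2 by blast
  note \<sigma> = graph_fn[OF this]
  let ?B = "ball (0::complex^'n) (1 / 50000)"
  define s where "s k = \<sigma> (1, (z - n2, k))" for k
  define g where "g k = (z, n1 + k + s k *\<^sub>C n2)" for k
  have \<zeta>: "norm (z - n2, k) < 1 / 25000" if "k \<in> ?B" for k
    using norm_Pair_le[of "z - n2" k] z that by simp
  have s_small: "cmod (s k) \<le> 6 / 25000 + 1 / 10 ^ 8" if "k \<in> ?B" for k
    unfolding s_def using \<sigma>(3)[OF one_in_D, of "(z - n2, k)"] \<zeta>[OF that] by simp
  have g_eq: "g k = Z0 + ((z - n2, k) + s k *\<^sub>C (0, n2))" for k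
    by (simp add: g_def Z0_def cscale_Pair)
  have g_in: "g k \<in> ball Z0 (1 / 4000)" if "k \<in> ?B" for k
  proof -
    have "norm (s k *\<^sub>C (0::complex^'n, n2)) \<le> (6 / 25000 + 1 / 10 ^ 8) * (7072 / 10000)"
      unfolding norm_cscale norm_Pair_zero by (intro mult_mono s_small that norm_n) auto
    then have "norm ((z - n2, k) + s k *\<^sub>C (0, n2)) < 1 / 4000"
      using norm_triangle_ineq[of "(z - n2, k)" "s k *\<^sub>C (0, n2)"] \<zeta>[OF that] by simp
    then show ?thesis unfolding g_eq mem_ball_add .
  qed
  have g_in': "g k \<in> ball Z0 (1 / 100)" "g k \<in> ball 0 100" if "k \<in> ?B" for k
    using g_in[OF that] near_Z0(2)[of "g k"] by auto
  have Fg: "F (g k) = 0" if "k \<in> ?B" for k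
    using \<sigma>(2)[OF one_in_D, of "(z - n2, k)"] \<zeta>[OF that] by (simp add: g_eq s_def add.assoc)
  have s_hol: "holo s ?B"
    unfolding s_def
    by (rule holo_compose[OF \<sigma>(1)]) (use one_in_D \<zeta> in \<open>fastforce intro: holo_Pair holo_const holo_id\<close>)+
  define g' where "g' k \<kappa> = \<kappa> + fd s k \<kappa> *\<^sub>C n2" for k \<kappa>
  have g_der: "(g has_derivative (\<lambda>\<kappa>. (0, g' k \<kappa>))) (at k)" if k: "k \<in> ?B" for k
    unfolding g_def g'_def
    by (intro has_derivative_Pair has_derivative_const has_derivative_add[where f = "\<lambda>k. n1 + k" and f' = "\<lambda>\<kappa>. \<kappa>"]
        bounded_linear.has_derivative[OF bounded_linear_cscale_left] holo_has_derivative[OF s_hol k])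
      (auto intro!: derivative_eq_intros)
  have Fw0: "Fw (g k) (g' k \<kappa>) = 0" if k: "k \<in> ?B" for k \<kappa>
  proof -
    from has_derivative_compose[OF g_der[OF k] holo_has_derivative[OF hol g_in'(2)[OF k]]]
    have "((\<lambda>k. F (g k)) has_derivative (\<lambda>\<kappa>. Fw (g k) (g' k \<kappa>))) (at k)" .
    moreover have "((\<lambda>k. F (g k)) has_derivative (\<lambda>\<kappa>. 0)) (at k)"
      using has_derivative_cong_open[OF open_ball k, of "\<lambda>k. F (g k)" "\<lambda>_. 0"] Fg by simp
    ultimately show ?thesis using has_derivative_unique by metis
  qed
  have A_der: "((\<lambda>k. Fz (g k) u) has_derivative (\<lambda>\<kappa>. Fzw (g k) u (g' k \<kappa>))) (at k)" if k: "k \<in> ?B" for k u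
    unfolding hess_def
    using has_derivative_compose[OF g_der[OF k] holo_has_derivative[OF holo_fd[OF open_ball hol] g_in'(2)[OF k]]] .
  have key: "Fz (g k) n1 * Fzw (g k) u (g' k \<kappa>) - Fz (g k) u * Fzw (g k) n1 (g' k \<kappa>) = 0" if k: "k \<in> ?B" for k \<kappa>
  proof -
    note Z = g_in'(2)[OF k]
    have "Fw (g k) \<kappa> + fd s k \<kappa> * Fw (g k) n2 = 0"
      using Fw0[OF k, of \<kappa>] by (simp add: g'_def Fz_lin[OF Z])
    \<comment> \<open>The kernel vector \<open>Y\<close> is a nonzero multiple of the velocity of
      the curve in w. Hence \<open>Lam\<close> is, up to a nonzero factor, the numerator in the
      quotient rule below.\<close>
    then have "Y (g k) \<kappa> = Fw (g k) n2 *\<^sub>C g' k \<kappa>"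
      by (simp add: Y_def g'_def cscale_add_right eq_neg_iff_add_eq_0[symmetric] mult.commute)
    then have "Lam u \<kappa> (g k) = Fw (g k) n2 * (Fz (g k) n1 * Fzw (g k) u (g' k \<kappa>) - Fz (g k) u * Fzw (g k) n1 (g' k \<kappa>))"
      by (simp add: Lam[OF Z] X_def Fzw_lin[OF Z])
    then show ?thesis
      using Lam_zero[OF g_in[OF k] Fg[OF k]] fd_nonzero(2)[OF g_in'(1)[OF k]] by simp
  qed
  have "\<exists>c. \<forall>k\<in>?B. Fz (g k) u / Fz (g k) n1 = c"
  proof (rule has_derivative_zero_constant[OF convex_ball])
    fix k assume k: "k \<in> ?B"
    note nz = fd_nonzero(1)[OF g_in'(1)[OF k]]
    have "((\<lambda>k. Fz (g k) u / Fz (g k) n1) has_derivative (\<lambda>\<kappa>. (Fzw (g k) u (g' k \<kappa>) * Fz (g k) n1 - Fz (g k) u * Fzw (g k) n1 (g' k \<kappa>)) / (Fz (g k) n1 * Fz (g k) n1))) (at k within ?B)"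
      by (intro has_derivative_divide' has_derivative_at_withinI[OF A_der[OF k]] nz)
    moreover have "(\<lambda>\<kappa>. (Fzw (g k) u (g' k \<kappa>) * Fz (g k) n1 - Fz (g k) u * Fzw (g k) n1 (g' k \<kappa>)) / (Fz (g k) n1 * Fz (g k) n1)) = (\<lambda>\<kappa>. 0)"
      using key[OF k] by (simp add: mult.commute)
    ultimately show "((\<lambda>k. Fz (g k) u / Fz (g k) n1) has_derivative (\<lambda>\<kappa>. 0)) (at k within ?B)" by simp
  qed
  moreover have gw: "g (x - n1) = (z, x)" if "norm (x - n1) < 1 / 50000" "F (z, x) = 0" for x
  proof -
    have "norm (z - n2, x - n1) < 1 / 100" using \<zeta>[of "x - n1"] that by simp
    then have "0 = s (x - n1)"
      unfolding s_def using \<sigma>(4)[OF one_in_D, of "(z - n2, x - n1)" 0] that by (simp add: Z0_def)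
    then show ?thesis by (simp add: g_def)
  qed
  ultimately have "Fz (z, w) u / Fz (z, w) n1 = Fz (z, w') u / Fz (z, w') n1"
    using gw[OF w] gw[OF w'] w(1) w'(1) by (metis mem_ball_0)
  moreover have "Fz (z, w) n1 \<noteq> 0" "Fz (z, w') n1 \<noteq> 0"
    using fd_nonzero(1)[OF g_in'(1), of "w - n1"] fd_nonzero(1)[OF g_in'(1), of "w' - n1"] gw[OF w] gw[OF w'] w(1) w'(1) by auto
  ultimately show ?thesis by (simp add: field_simps)
qed

end

section \<open>Constancy of t on Segre varieties and the relation for f\<close>

locale core_t = core F I a b \<eta>
  for F :: "(complex^'n) \<times> (complex^'n) \<Rightarrow> complex" and I a b \<eta> +
  fixes t :: "complex^'n \<Rightarrow> complex"
  assumes t_hol: "holo t (ball 0 2)"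
    and t_root: "\<And>z. z \<in> ball 0 2 \<Longrightarrow> F (z, n1 + t z *\<^sub>C n2) = 0"
    and t_est: "\<And>z. z \<in> ball 0 2 \<Longrightarrow> cmod (t z + quad I z) \<le> 1 / 10000"
    and t_unique: "\<And>z s. z \<in> ball 0 2 \<Longrightarrow> cmod s < 20 \<Longrightarrow> F (z, n1 + s *\<^sub>C n2) = 0 \<Longrightarrow> s = t z"
begin

lemma near_n2: "norm (z - n2) < 1 / 100 \<Longrightarrow> z \<in> ball 0 2"
  using norm_triangle_ineq2[of z n2] norm_n by auto

lemma t_small:
  assumes z: "norm (z - n2) < 1 / 100"
  shows "cmod (t z) \<le> 6 * norm (z - n2) + 1 / 10 ^ 8"
proof -
  obtain \<sigma> where "graph_fn (0, n2) \<sigma>" using graph2 by blast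
  note \<sigma> = graph_fn[OF this]
  have z': "norm (z - n2, 0 :: complex^'n) < 1 / 100" using z by simp
  let ?s = "\<sigma> (1, (z - n2, 0))"
  have s: "cmod ?s \<le> 6 * norm (z - n2) + 1 / 10 ^ 8" using \<sigma>(3)[OF one_in_D z'] by simp
  have "F (z, n1 + ?s *\<^sub>C n2) = 0"
    using \<sigma>(2)[OF one_in_D z'] by (simp add: Z0_def cscale_Pair)
  then have "?s = t z" using t_unique[OF near_n2[OF z]] s z by simp
  then show ?thesis using s by simp
qed

definition ts where "ts w = cnj (t (cj w))"

lemma ts_hol: "holo ts (ball 0 2)"
  unfolding ts_def by (rule holo_conj[OF t_hol]) simp

lemma ts_small: "norm (w - n1) < 1 / 100 \<Longrightarrow> cmod (ts w) \<le> 6 * norm (w - n1) + 1 / 10 ^ 8"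
  using t_small[of "cj w"] norm_cj[of "w - n1"] by (simp add: ts_def cj_diff)

lemma ts_root:
  assumes "norm (w - n1) < 1 / 100"
  shows "F (n2 + ts w *\<^sub>C n1, w) = 0"
proof -
  have cw: "norm (cj w - n2) < 1 / 100" using assms norm_cj[of "w - n1"] by (simp add: cj_diff)
  let ?Z = "(cj w, n1 + t (cj w) *\<^sub>C n2)"
  have "norm (t (cj w) *\<^sub>C n2) \<le> 1 * 1"
    unfolding norm_cscale using t_small[OF cw] norm_n cw by (intro mult_mono) auto
  then have "norm ?Z < 100"
    using norm_Pair_le[of "cj w" "n1 + t (cj w) *\<^sub>C n2"] norm_triangle_ineq[of n1 "t (cj w) *\<^sub>C n2"] norm_n
      near_n2[OF cw] by simp
  then have "F (sw ?Z) = 0" using sym[of ?Z] t_root[OF near_n2[OF cw]] by simp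
  then show ?thesis by (simp add: sw_def cj_add cj_cscale ts_def)
qed

text \<open>Differentiating the equation that defines t shows that dt is proportional to
  \<open>Fz (z, w0)\<close> at w0 = n1 + t z n2. By \<open>Fz_parallel\<close> this functional has
  the same kernel as \<open>Fz (z, w)\<close>.\<close>

lemma t_deriv_zero:
  assumes z: "norm (z - n2) < 1 / 250000" and w: "norm (w - n1) < 1 / 50000" "F (z, w) = 0" and u: "Fz (z, w) u = 0"
  shows "fd t z u = 0"
proof -
  have z2: "z \<in> ball 0 2" using near_n2 z by simp
  define w0 where "w0 = n1 + t z *\<^sub>C n2"
  have tz: "cmod (t z) \<le> 6 / 250000 + 1 / 10 ^ 8" using t_small[of z] z by simp
  have "norm (t z *\<^sub>C n2) \<le> (6 / 250000 + 1 / 10 ^ 8) * (7072 / 10000)"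
    unfolding norm_cscale by (intro mult_mono tz norm_n) auto
  then have w0: "norm (w0 - n1) < 1 / 50000" by (simp add: w0_def)
  have F0: "F (z, w0) = 0" unfolding w0_def by (rule t_root[OF z2])
  have in_ball: "(z, x) \<in> ball Z0 (1 / 100)" if "norm (x - n1) < 1 / 50000" for x
    using norm_Pair_le[of "n2 - z" "n1 - x"] z that
    by (simp add: Z0_def dist_norm norm_minus_commute[of n2] norm_minus_commute[of n1])
  note Z = near_Z0(2)[OF in_ball[OF w0]]
  have "Fz (z, w0) u * Fz (z, w) n1 = 0"
    using Fz_parallel[of z w w0 u] z w w0 F0 u by simp
  then have Fz0: "Fz (z, w0) u = 0" using fd_nonzero(1)[OF in_ball[OF w(1)]] by simp
  have "((\<lambda>z. (z, n1 + t z *\<^sub>C n2)) has_derivative (\<lambda>u. (u, 0 + fd t z u *\<^sub>C n2))) (at z)"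
    by (intro has_derivative_Pair has_derivative_ident has_derivative_add has_derivative_const
        bounded_linear.has_derivative[OF bounded_linear_cscale_left] holo_has_derivative[OF t_hol z2])
  from has_derivative_compose[OF this] holo_has_derivative[OF hol Z]
  have "((\<lambda>z. F (z, n1 + t z *\<^sub>C n2)) has_derivative (\<lambda>u. fd F (z, w0) (u, 0 + fd t z u *\<^sub>C n2))) (at z)"
    unfolding w0_def by blast
  moreover have "((\<lambda>z. F (z, n1 + t z *\<^sub>C n2)) has_derivative (\<lambda>u. 0)) (at z)"
    using has_derivative_cong_open[OF open_ball z2, of "\<lambda>z. F (z, n1 + t z *\<^sub>C n2)" "\<lambda>_. 0"] t_root by simp
  ultimately have "(\<lambda>u. fd F (z, w0) (u, 0 + fd t z u *\<^sub>C n2)) = (\<lambda>u. 0)"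
    by (rule has_derivative_unique)
  from fun_cong[OF this, of u] have "fd F (z, w0) (u, fd t z u *\<^sub>C n2) = 0" by simp
  moreover have "(u, fd t z u *\<^sub>C n2) = (u, 0) + (0, fd t z u *\<^sub>C n2)" by simp
  ultimately have "Fz (z, w0) u + Fw (z, w0) (fd t z u *\<^sub>C n2) = 0"
    using holo_fd_add[OF hol Z] by metis
  then have "fd t z u * Fw (z, w0) n2 = 0" using Fz0 by (simp add: Fz_lin[OF Z])
  then show ?thesis using fd_nonzero(2)[OF in_ball[OF w0]] by simp
qed

text \<open>The Segre variety \<open>{z. F (z, w) = 0}\<close> meets the line \<open>n2 + \<complex> n1\<close> at parameter \<open>ts w\<close>.\<close>

lemma t_const_Segre:
  assumes z: "norm (z - n2) < 1 / 4000000" and w: "norm (w - n1) < 1 / 4000000" and F0: "F (z, w) = 0"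
  shows "t z = t (n2 + ts w *\<^sub>C n1)"
proof -
  obtain \<sigma> where "graph_fn (n1, 0) \<sigma>" using graph1 by blast
  note \<sigma> = graph_fn[OF this]
  let ?B = "ball (0::complex^'n) (1 / 4000000)"
  define s where "s k = \<sigma> (1, (k, w - n1))" for k
  \<comment> \<open>g parametrises the Segre variety of w over a ball: it passes through z at k = z
    - n2 and meets the line n2 + s n1 at k = 0.\<close>
  define g where "g k = n2 + k + s k *\<^sub>C n1" for k
  have \<zeta>: "norm (k, w - n1) < 1 / 2000000" if "k \<in> ?B" for k
    using norm_Pair_le[of k "w - n1"] w that by simp
  have s_small: "cmod (s k) \<le> 6 / 2000000 + 1 / 10 ^ 8" if "k \<in> ?B" for k
    unfolding s_def using \<sigma>(3)[OF one_in_D, of "(k, w - n1)"] \<zeta>[OF that] by simp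
  have g_in: "norm (g k - n2) < 1 / 250000" if "k \<in> ?B" for k
  proof -
    have "norm (s k *\<^sub>C n1) \<le> (6 / 2000000 + 1 / 10 ^ 8) * (7072 / 10000)"
      unfolding norm_cscale by (intro mult_mono s_small that norm_n) auto
    then show ?thesis using norm_triangle_ineq[of k "s k *\<^sub>C n1"] that by (simp add: g_def)
  qed
  have Fg: "F (g k, w) = 0" if "k \<in> ?B" for k
    using \<sigma>(2)[OF one_in_D, of "(k, w - n1)"] \<zeta>[OF that] by (simp add: g_def s_def Z0_def cscale_Pair)
  have gw: "(g k, w) \<in> ball 0 100" if "k \<in> ?B" for k
  proof (rule near_Z0(2))
    show "(g k, w) \<in> ball Z0 (1 / 100)"
      using norm_Pair_le[of "n2 - g k" "n1 - w"] g_in[OF that] w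
      by (simp add: Z0_def dist_norm norm_minus_commute[of n2] norm_minus_commute[of n1])
  qed
  have s_hol: "holo s ?B"
    unfolding s_def
    by (rule holo_compose[OF \<sigma>(1)]) (use one_in_D \<zeta> in \<open>fastforce intro: holo_Pair holo_const holo_id\<close>)+
  define g' where "g' k \<kappa> = \<kappa> + fd s k \<kappa> *\<^sub>C n1" for k \<kappa>
  have g_der: "(g has_derivative g' k) (at k)" if k: "k \<in> ?B" for k
    unfolding g_def g'_def
    by (intro has_derivative_add[where f = "\<lambda>k. n2 + k" and f' = "\<lambda>\<kappa>. \<kappa>"]
        bounded_linear.has_derivative[OF bounded_linear_cscale_left] holo_has_derivative[OF s_hol k])
      (auto intro!: derivative_eq_intros)
  have Fz0: "Fz (g k, w) (g' k \<kappa>) = 0" if k: "k \<in> ?B" for k \<kappa>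
  proof -
    have "((\<lambda>k. (g k, w)) has_derivative (\<lambda>\<kappa>. (g' k \<kappa>, 0))) (at k)"
      by (intro has_derivative_Pair has_derivative_const g_der[OF k])
    from has_derivative_compose[OF this holo_has_derivative[OF hol gw[OF k]]]
    have "((\<lambda>k. F (g k, w)) has_derivative (\<lambda>\<kappa>. Fz (g k, w) (g' k \<kappa>))) (at k)" .
    moreover have "((\<lambda>k. F (g k, w)) has_derivative (\<lambda>\<kappa>. 0)) (at k)"
      using has_derivative_cong_open[OF open_ball k, of "\<lambda>k. F (g k, w)" "\<lambda>_. 0"] Fg by simp
    ultimately have "(\<lambda>\<kappa>. Fz (g k, w) (g' k \<kappa>)) = (\<lambda>\<kappa>. 0)" by (rule has_derivative_unique)
    from fun_cong[OF this, of \<kappa>] show ?thesis .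
  qed
  have "\<exists>c. \<forall>k\<in>?B. t (g k) = c"
  proof (rule has_derivative_zero_constant[OF convex_ball])
    fix k assume k: "k \<in> ?B"
    have "g k \<in> ball 0 2" using near_n2[of "g k"] g_in[OF k] by simp
    from has_derivative_compose[OF g_der[OF k] holo_has_derivative[OF t_hol this]]
    have "((\<lambda>k. t (g k)) has_derivative (\<lambda>\<kappa>. fd t (g k) (g' k \<kappa>))) (at k)" .
    moreover have "fd t (g k) (g' k \<kappa>) = 0" for \<kappa>
      by (rule t_deriv_zero[OF g_in[OF k] _ Fg[OF k] Fz0[OF k]]) (use w in simp)
    ultimately show "((\<lambda>k. t (g k)) has_derivative (\<lambda>\<kappa>. 0)) (at k within ?B)"
      by (simp add: has_derivative_at_withinI)
  qed
  then have "t (g (z - n2)) = t (g 0)" using z by auto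
  moreover have "g (z - n2) = z"
  proof -
    have "0 = s (z - n2)"
      unfolding s_def using \<sigma>(4)[OF one_in_D, of "(z - n2, w - n1)" 0] \<zeta>[of "z - n2"] z F0 by (simp add: Z0_def)
    then show ?thesis by (simp add: g_def)
  qed
  moreover have "g 0 = n2 + ts w *\<^sub>C n1"
  proof -
    have "F (1 *\<^sub>C (Z0 + (0, w - n1) + ts w *\<^sub>C (n1, 0))) = 0"
      using ts_root[of w] w by (simp add: Z0_def cscale_Pair)
    then have "ts w = s 0"
      unfolding s_def using \<sigma>(4)[OF one_in_D, of "(0, w - n1)" "ts w"] ts_small[of w] w by simp
    then show ?thesis by (simp add: g_def)
  qed
  ultimately show ?thesis by simp
qed

text \<open>The two terms reinforce each other: t is near -q, and q (n1 + s n2) = s puts ts (n1 + s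
  n2) near -s, so f is near -2 q and its quadratic part cannot vanish.\<close>

definition f where "f z = t z - ts (n1 + t z *\<^sub>C n2)"
definition fs where "fs w = cnj (f (cj w))"

lemma t_bound: assumes "z \<in> ball 0 1" shows "cmod (t z) \<le> 1001 / 1000"
proof -
  have "cmod (quad I z) \<le> 1" using cmod_quad[of I z] power_mono[of "norm z" 1 2] assms by simp
  then show ?thesis using t_est[of z] norm_triangle_ineq4[of "t z + quad I z" "quad I z"] assms by simp
qed

lemma in_ball2: assumes "cmod s \<le> 1001 / 1000" shows "n1 + s *\<^sub>C n2 \<in> ball 0 2"
proof -
  have "norm (s *\<^sub>C n2) \<le> 1001 / 1000 * (7072 / 10000)"
    unfolding norm_cscale by (intro mult_mono assms norm_n) auto
  then show ?thesis using norm_triangle_ineq[of n1 "s *\<^sub>C n2"] norm_n by simp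
qed

lemma f_hol: "holo f (ball 0 1)"
  unfolding f_def
proof (intro holo_diff)
  show t: "holo t (ball 0 1)" by (rule holo_subset[OF t_hol]) auto
  show "holo (\<lambda>z. ts (n1 + t z *\<^sub>C n2)) (ball 0 1)"
    by (intro holo_compose[OF ts_hol] holo_add holo_const holo_cscale t in_ball2 t_bound)
qed

lemma fs_hol: "holo fs (ball 0 1)"
  unfolding fs_def by (rule holo_conj[OF f_hol]) simp

text \<open>\<open>t_const_Segre\<close> at (z, w) gives t z = t (n2 + ts w n1). At the conjugate
  point (cj w, cj z) it gives ts w = ts (n1 + t z n2). Hence f z = t z - ts w, and fs w is its
  negative.\<close>

lemma relation_near:
  assumes "Z \<in> ball Z0 (1 / 4000000)" "F Z = 0"
  shows "f (fst Z) + fs (snd Z) = 0"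
proof -
  obtain z w where Z: "Z = (z, w)" by (cases Z)
  have n: "norm (Z - Z0) < 1 / 4000000" using assms by (simp add: dist_norm norm_minus_commute)
  have z: "norm (z - n2) < 1 / 4000000" and w: "norm (w - n1) < 1 / 4000000"
    using norm_fst_snd[of "Z - Z0"] n by (auto simp: Z Z0_def)
  have 1: "t z = t (n2 + ts w *\<^sub>C n1)"
    by (rule t_const_Segre[OF z w]) (use assms Z in simp)
  have z': "norm (cj z - n1) < 1 / 4000000" and w': "norm (cj w - n2) < 1 / 4000000"
    using z w norm_cj[of "z - n2"] norm_cj[of "w - n1"] by (simp_all add: cj_diff)
  have "Z \<in> ball 0 100" using near_Z0(2)[of Z] assms by simp
  then have "F (cj w, cj z) = 0" using sym[of Z] assms by (simp add: Z sw_def)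
  then have "t (cj w) = t (n2 + ts (cj z) *\<^sub>C n1)" by (rule t_const_Segre[OF w' z'])
  then have 2: "ts w = ts (n1 + t z *\<^sub>C n2)"
    by (simp add: ts_def cj_add cj_cscale)
  have "f z = t z - ts w" by (simp add: f_def 2[symmetric])
  moreover have "fs w = ts w - t z"
    by (simp add: fs_def f_def ts_def cj_add cj_cscale 1)
  ultimately show ?thesis by (simp add: Z)
qed

text \<open>Analytic continuation in the scale \<open>r\<close>, from \<open>r\<close> near 1 to all \<open>r\<close> in \<open>D\<close>.\<close>

lemma relation:
  assumes r: "r \<in> D" and Z: "Z \<in> ball Z0 (1 / 100)" and F0: "F (r *\<^sub>C Z) = 0"
  shows "f (r *\<^sub>C fst Z) + fs (r *\<^sub>C snd Z) = 0"
proof -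
  obtain \<sigma> where "graph_fn (0, n2) \<sigma>" using graph2 by blast
  note \<sigma> = graph_fn[OF this]
  let ?S = "D \<times> ball (0 :: (complex^'n) \<times> (complex^'n)) (1 / 100)"
  \<comment> \<open>In graph coordinates the zero sets at all scales form the image of the convex
    set ?S, on which \<open>holo_identity\<close> applies.\<close>
  define G where "G p = fst p *\<^sub>C (Z0 + snd p + \<sigma> p *\<^sub>C (0, n2))" for p
  have G_hol: "holo G ?S"
    unfolding G_def by (intro holo_cscale holo_add holo_const holo_fst holo_snd holo_id \<sigma>(1))
  have FG: "F (G p) = 0" if "p \<in> ?S" for p
    using \<sigma>(2)[of "fst p" "snd p"] that by (auto simp: G_def)
  have G_in: "fst (G p) \<in> ball 0 1" "snd (G p) \<in> ball 0 1" if p: "p \<in> ?S" for p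
  proof -
    have r: "cmod (fst p) \<le> 6 / 5" and \<zeta>: "norm (snd p) < 1 / 100" using D(2)[of "fst p"] p by auto
    have s: "cmod (\<sigma> p) \<le> 7 / 100" using \<sigma>(3)[of "fst p" "snd p"] p \<zeta> by auto
    have \<zeta>': "norm (fst (snd p)) < 1 / 100" "norm (snd (snd p)) < 1 / 100"
      using norm_fst_snd[of "snd p"] \<zeta> by auto
    have "norm (n2 + fst (snd p)) \<le> 72 / 100"
      using norm_triangle_ineq[of n2 "fst (snd p)"] norm_n \<zeta>' by simp
    then have "cmod (fst p) * norm (n2 + fst (snd p)) \<le> 6 / 5 * (72 / 100)"
      using r by (intro mult_mono) auto
    then show "fst (G p) \<in> ball 0 1" by (simp add: G_def Z0_def)
    have "norm (\<sigma> p *\<^sub>C n2) \<le> 7 / 100 * 1" unfolding norm_cscale using s norm_n by (intro mult_mono) auto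
    then have "norm (n1 + snd (snd p) + \<sigma> p *\<^sub>C n2) \<le> 80 / 100"
      using norm_triangle_ineq[of "n1 + snd (snd p)" "\<sigma> p *\<^sub>C n2"] norm_triangle_ineq[of n1 "snd (snd p)"] norm_n \<zeta>' by simp
    then have "cmod (fst p) * norm (n1 + snd (snd p) + \<sigma> p *\<^sub>C n2) \<le> 6 / 5 * (80 / 100)"
      using r by (intro mult_mono) auto
    then show "snd (G p) \<in> ball 0 1" by (simp add: G_def Z0_def)
  qed
  have S: "open ?S" "convex ?S" by (auto intro: open_Times convex_Times)
  let ?W = "{p \<in> ?S. G p \<in> ball Z0 (1 / 4000000)}"
  have "f (fst (G (r, Z - Z0))) + fs (snd (G (r, Z - Z0))) = 0"
  proof (rule holo_identity[where f = "\<lambda>p. f (fst (G p)) + fs (snd (G p))" and S = ?S and W = ?W and p = "(1, 0)"])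
    show "holo (\<lambda>p. f (fst (G p)) + fs (snd (G p))) ?S"
      by (intro holo_add holo_compose[OF f_hol] holo_compose[OF fs_hol] holo_fst holo_snd G_hol G_in)
    show "open ?W"
      using continuous_open_preimage[OF holo_continuous_on[OF G_hol] S(1) open_ball, of Z0 "1 / 4000000"]
      by (simp add: vimage_def Int_def)
    have "cmod (\<sigma> (1, 0)) * norm n2 \<le> 1 / 10 ^ 8 * 1"
      using \<sigma>(3)[OF one_in_D, of 0] norm_n by (intro mult_mono) auto
    then have "norm (\<sigma> (1, 0) *\<^sub>C (0::complex^'n, n2)) < 1 / 4000000" by simp
    then have "G (1, 0) \<in> ball Z0 (1 / 4000000)"
      unfolding G_def by (simp only: fst_conv snd_conv cscale_1 add_0_right mem_ball_add)
    then show "(1, 0) \<in> ?W" using one_in_D by simp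
    show "f (fst (G p)) + fs (snd (G p)) = 0" if "p \<in> ?W" for p
      using that FG by (intro relation_near) auto
    show "(r, Z - Z0) \<in> ?S" using r Z by (simp add: dist_norm norm_minus_commute)
  qed (use S in auto)
  moreover have "\<sigma> (r, Z - Z0) = 0"
    using \<sigma>(4)[OF r, of "Z - Z0" 0] Z F0 by (simp add: dist_norm norm_minus_commute)
  ultimately show ?thesis by (simp add: G_def)
qed

lemma f_approx:
  assumes z: "z \<in> ball 0 1"
  shows "cmod (f z + 2 * quad I z) \<le> 3 / 10000"
proof -
  define w where "w = n1 + t z *\<^sub>C n2"
  have w: "w \<in> ball 0 2" unfolding w_def by (rule in_ball2[OF t_bound[OF z]])
  have "quad I w = t z" by (simp add: w_def quad_add quad_scale dot_cscale_right)
  moreover have "cmod (cnj (t (cj w) + quad I (cj w))) \<le> 1 / 10000"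
    unfolding complex_mod_cnj using w by (intro t_est) simp
  ultimately have 1: "cmod (ts w + t z) \<le> 1 / 10000" by (simp add: ts_def)
  have 2: "cmod (2 * (t z + quad I z)) \<le> 2 / 10000" using t_est[of z] z by (simp only: norm_mult norm_numeral) simp
  have "f z + 2 * quad I z = 2 * (t z + quad I z) - (ts w + t z)" by (simp add: f_def w_def algebra_simps)
  then have "cmod (f z + 2 * quad I z) \<le> cmod (2 * (t z + quad I z)) + cmod (ts w + t z)"
    by (simp only: norm_triangle_ineq4)
  also have "\<dots> \<le> 2 / 10000 + 1 / 10000" by (rule add_mono[OF 2 1])
  finally show ?thesis by simp
qed

lemma f_proj:
  assumes z: "z \<in> ball 0 1"
  shows "f (proj I z) = f z"
proof -
  have t: "t (proj I z) = t z" if z: "z \<in> ball 0 1" for z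
  proof -
    have z2: "z \<in> ball 0 2" "proj I z \<in> ball 0 2" using z norm_proj[of I z] by auto
    let ?w = "n1 + t z *\<^sub>C n2"
    have pw: "proj I ?w = ?w" by (simp add: clinear_add[OF clinear_proj] clinear_cscale[OF clinear_proj])
    have "norm (z, ?w) < 100" using norm_Pair_le[of z ?w] z in_ball2[OF t_bound[OF z]] by simp
    then have "F (proj I z, ?w) = 0" using inv[of z ?w] t_root[OF z2(1)] pw by simp
    then show ?thesis using t_unique[OF z2(2), of "t z"] t_bound[OF z] by simp
  qed
  show ?thesis by (simp add: f_def t[OF z])
qed

text \<open>Apply the relation at r (z, w) on the zero set and let r tend to 0: the terms of order
  0, 1 and 2 in r vanish separately. The resulting identities hold for z near n2 and extend to all z
  by \<open>holo_identity\<close>. Oddness then removes the linear part, and homogeneity forces the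
  quadratic part to be a multiple of q.\<close>

lemma f_expansion:
  "\<exists>\<beta>::real. \<exists>C. \<beta> \<noteq> (0::real) \<and> f 0 + cnj (f 0) = 0 \<and>
     (\<forall>v. norm v \<le> 1 / 2 \<longrightarrow> cmod (f v - f 0 - \<beta> * quad I v) \<le> C * norm v ^ 3)"
proof -
  define g where "g z = f z + 2 * quad I z" for z
  have g_hol: "holo g (ball 0 1)"
    unfolding g_def by (intro holo_add holo_mult holo_const holo_quad f_hol)
  have gB: "cmod (g z) \<le> 3 / 10000" if "z \<in> ball 0 1" for z
    unfolding g_def by (rule f_approx[OF that])
  have 0: "0 \<in> ball (0 :: complex^'n) 1" by simp
  define L where "L = fd g 0"
  have L: "clinear L" unfolding L_def by (rule holo_clinear[OF g_hol 0])
  define B where "B = hess g 0"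
  have Bl: "clinear (\<lambda>u. B u v)" and Br: "clinear (B u)" for u v
    unfolding B_def by (rule hess_clinear_left[OF open_ball g_hol 0] hess_clinear_right[OF open_ball g_hol 0])+
  define P where "P v = B v v / 2 - 2 * quad I v" for v
  define C where "C = 192 * (3 / 10000 :: real) / 1 ^ 3"
  have R: "cmod (f v - f 0 - L v - P v) \<le> C * norm v ^ 3" if "norm v \<le> 1 / 2" for v
  proof -
    have "cmod (g v - g 0 - fd g 0 v - hess g 0 v v / 2) \<le> 192 * (3 / 10000) / 1 ^ 3 * norm v ^ 3"
      by (rule holo_taylor2[OF g_hol _ gB]) (use that in auto)
    moreover have "g v = f v + 2 * quad I v" "g 0 = f 0" by (simp_all add: g_def quad_def)
    ultimately show ?thesis by (simp add: P_def L_def B_def C_def algebra_simps)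
  qed
  have P_hol: "holo P UNIV"
  proof -
    have "B v v = (\<Sum>i\<in>UNIV. v $ i * B (axis i 1) v)" for v
      by (rule clinear_vec_expansion[OF Bl])
    then show ?thesis
      unfolding P_def[abs_def]
      by (simp add: holo_diff holo_divide holo_sum holo_mult holo_nth holo_id holo_clinear_map[OF Br] holo_const holo_quad)
  qed
  have P_scale: "P (s *\<^sub>C v) = s\<^sup>2 * P v" for s v
    by (simp add: P_def clinear_cscale[OF Br] clinear_cscale[OF Bl] quad_scale power2_eq_square algebra_simps)
  define Ls where "Ls w = cnj (L (cj w))" for w
  define Ps where "Ps w = cnj (P (cj w))" for w
  have Rs: "cmod (fs w - cnj (f 0) - Ls w - Ps w) \<le> C * norm w ^ 3" if "norm w \<le> 1 / 2" for w
  proof -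
    have "fs w - cnj (f 0) - Ls w - Ps w = cnj (f (cj w) - f 0 - L (cj w) - P (cj w))"
      by (simp add: fs_def Ls_def Ps_def)
    then show ?thesis using R[of "cj w"] that by (simp only: complex_mod_cnj norm_cj)
  qed
  have Ls_clinear: "Ls (u + v) = Ls u + Ls v" "Ls (s *\<^sub>C v) = s * Ls v" for u v s
    by (simp_all add: Ls_def cj_add cj_cscale clinear_add[OF L] clinear_cscale[OF L])
  have Ps_hol: "holo Ps UNIV" unfolding Ps_def by (rule holo_conj[OF P_hol]) simp
  have Ls_hol: "holo Ls UNIV" unfolding Ls_def by (rule holo_conj[OF holo_clinear_map[OF L, of UNIV]]) simp
  obtain \<sigma> where "graph_fn (0, n2) \<sigma>" using graph2 by blast
  note \<sigma> = graph_fn[OF this]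
  \<comment> \<open>For small r the point (z, wr z r) lies on the zero set rescaled by r. As r tends
    to 0 it tends to (z, W z), a point of the model quadric.\<close>
  define wr where "wr z r = n1 + \<sigma> (complex_of_real r, (z - n2, 0)) *\<^sub>C n2" for z r
  define W where "W z = n1 - quad I z *\<^sub>C n2" for z
  define c0 where "c0 = f 0 + cnj (f 0)"
  define lin where "lin z r = L z + Ls (wr z r)" for z r
  define qua where "qua z r = P z + Ps (wr z r)" for z r
  have near: "\<forall>\<^sub>F r in at_right 0. r \<in> {0<..<1 / 4 :: real}"
    by (intro eventually_at_right_real) simp
  have wr_bound: "norm (z, wr z r) \<le> 2" "cmod (\<sigma> (complex_of_real r, (z - n2, 0)) + quad I z) \<le> r"
    "F (complex_of_real r *\<^sub>C (z, wr z r)) = 0" "(z, wr z r) \<in> ball Z0 1"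
    if z: "norm (z - n2) < 1 / 1000" and r: "r \<in> {0<..<1 / 4}" for z r
  proof -
    let ?s = "\<sigma> (complex_of_real r, (z - n2, 0))"
    have rD: "complex_of_real r \<in> D" using r by (intro D_real) auto
    have \<zeta>: "norm (z - n2, 0 :: complex^'n) < 1 / 100" using z by simp
    have eq: "(z, wr z r) = Z0 + ((z - n2, 0) + ?s *\<^sub>C (0, n2))" by (simp add: wr_def Z0_def cscale_Pair)
    have "norm (?s *\<^sub>C (0 :: complex^'n, n2)) \<le> 1 / 100 * 1"
      unfolding norm_cscale using \<sigma>(3)[OF rD \<zeta>] norm_n z by (intro mult_mono) auto
    then have *: "norm ((z - n2, 0) + ?s *\<^sub>C (0, n2)) < 1 / 50"
      using norm_triangle_ineq[of "(z - n2, 0)" "?s *\<^sub>C (0, n2)"] z by simp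
    then have "(z, wr z r) \<in> ball Z0 (1 / 50)" unfolding eq mem_ball_add .
    then show "(z, wr z r) \<in> ball Z0 1" by simp
    show n: "norm (z, wr z r) \<le> 2"
      unfolding eq using * norm_triangle_ineq[of Z0 "(z - n2, 0) + ?s *\<^sub>C (0, n2)"] norm_Z0 by simp
    show F0: "F (complex_of_real r *\<^sub>C (z, wr z r)) = 0"
      using \<sigma>(2)[OF rD \<zeta>] by (simp add: eq add.assoc)
    have "r * norm (z, wr z r) \<le> 1 * 2" using r n by (intro mult_mono) auto
    then have "cmod (QQ I (z, wr z r)) \<le> \<eta> * r * norm (z, wr z r) ^ 3"
      using est_scaled[of "complex_of_real r" "(z, wr z r)"] F0 r by simp
    also have "\<dots> \<le> (1 / 10 ^ 11) * r * 2 ^ 3"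
      using \<eta> r n by (intro mult_mono power_mono) auto
    also have "\<dots> \<le> r / 2" using r by simp
    also have "QQ I (z, wr z r) = (quad I z + ?s) / 2"
      by (simp add: QQ_def wr_def quad_add quad_scale dot_cscale_right)
    finally show "cmod (?s + quad I z) \<le> r" by (simp add: norm_divide add.commute)
  qed
  have wr_lim: "(wr z \<longlongrightarrow> W z) (at_right 0)" if z: "norm (z - n2) < 1 / 1000" for z
  proof -
    have "((\<lambda>r. \<sigma> (complex_of_real r, (z - n2, 0)) + quad I z) \<longlongrightarrow> 0) (at_right 0)"
    proof (rule Lim_null_comparison)
      show "\<forall>\<^sub>F r in at_right 0. cmod (\<sigma> (complex_of_real r, (z - n2, 0)) + quad I z) \<le> r"
        using near by eventually_elim (rule wr_bound[OF z])
    qed (rule tendsto_ident_at)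
    then have "((\<lambda>r. n1 + ((\<sigma> (complex_of_real r, (z - n2, 0)) + quad I z) - quad I z) *\<^sub>C n2) \<longlongrightarrow> n1 + (0 - quad I z) *\<^sub>C n2) (at_right 0)"
      by (intro tendsto_intros)
    then show ?thesis by (simp add: wr_def[abs_def] W_def)
  qed
  have lin_lim: "(lin z \<longlongrightarrow> L z + Ls (W z)) (at_right 0)" and qua_lim: "(qua z \<longlongrightarrow> P z + Ps (W z)) (at_right 0)"
    if z: "norm (z - n2) < 1 / 1000" for z
  proof -
    have "isCont Ls (W z)" "isCont Ps (W z)"
      using holo_has_derivative[OF Ls_hol UNIV_I] holo_has_derivative[OF Ps_hol UNIV_I] has_derivative_continuous by blast+
    then show "(lin z \<longlongrightarrow> L z + Ls (W z)) (at_right 0)" "(qua z \<longlongrightarrow> P z + Ps (W z)) (at_right 0)"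
      unfolding lin_def qua_def using isCont_tendsto_compose[OF _ wr_lim[OF z]]
      by (auto intro!: tendsto_add tendsto_const)
  qed
  define e where "e z r = c0 + complex_of_real r * lin z r + (complex_of_real r)\<^sup>2 * qua z r" for z r
  have e_bound: "cmod (e z r) \<le> 16 * C * r ^ 3" if z: "norm (z - n2) < 1 / 1000" and r: "r \<in> {0<..<1 / 4}" for z r
  proof -
    let ?r = "complex_of_real r"
    have rD: "?r \<in> D" using r by (intro D_real) auto
    have nn: "norm z \<le> 2" "norm (wr z r) \<le> 2"
      using norm_fst_snd[of "(z, wr z r)"] wr_bound(1)[OF z r] by auto
    have "norm ((z, wr z r) - Z0) < 1 / 100"
    proof -
      let ?s = "\<sigma> (?r, (z - n2, 0))"
      have \<zeta>: "norm (z - n2, 0 :: complex^'n) < 1 / 100" using z by simp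
      have "cmod ?s * norm n2 \<le> (6 / 1000 + 1 / 10 ^ 8) * 1"
        using \<sigma>(3)[OF rD \<zeta>] norm_n z by (intro mult_mono) auto
      then show ?thesis
        using norm_Pair_le[of "z - n2" "?s *\<^sub>C n2"] z by (simp add: wr_def Z0_def)
    qed
    then have "f (?r *\<^sub>C fst (z, wr z r)) + fs (?r *\<^sub>C snd (z, wr z r)) = 0"
      by (intro relation[OF rD] wr_bound(3)[OF z r]) (simp add: dist_norm norm_minus_commute)
    then have rel: "f (?r *\<^sub>C z) + fs (?r *\<^sub>C wr z r) = 0" by simp
    have half: "norm (?r *\<^sub>C z) \<le> 1 / 2" "norm (?r *\<^sub>C wr z r) \<le> 1 / 2"
      using mult_mono[of r "1/4" "norm z" 2] mult_mono[of r "1/4" "norm (wr z r)" 2] nn r by auto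
    have "Ps (?r *\<^sub>C w) = ?r\<^sup>2 * Ps w" for w
      by (simp add: Ps_def cj_cscale P_scale)
    then have "- e z r = (f (?r *\<^sub>C z) - f 0 - L (?r *\<^sub>C z) - P (?r *\<^sub>C z))
      + (fs (?r *\<^sub>C wr z r) - cnj (f 0) - Ls (?r *\<^sub>C wr z r) - Ps (?r *\<^sub>C wr z r))"
      using rel by (simp add: e_def c0_def lin_def qua_def clinear_cscale[OF L] P_scale Ls_clinear add_eq_0_iff2 algebra_simps)
    then have "cmod (e z r) \<le> C * norm (?r *\<^sub>C z) ^ 3 + C * norm (?r *\<^sub>C wr z r) ^ 3"
      using norm_triangle_mono[OF R[OF half(1)] Rs[OF half(2)]] by (metis norm_minus_cancel)
    also have "\<dots> \<le> C * (r * 2) ^ 3 + C * (r * 2) ^ 3"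
      using nn r by (intro add_mono mult_left_mono power_mono) (auto simp: C_def)
    finally show ?thesis by (simp add: power_mult_distrib)
  qed
  have e_lim: "((\<lambda>r. e z r / complex_of_real r ^ k) \<longlongrightarrow> 0) (at_right 0)" if z: "norm (z - n2) < 1 / 1000" and k: "k \<le> 2" for z k
  proof (rule Lim_null_comparison)
    have "((\<lambda>r. 16 * C * r) \<longlongrightarrow> 16 * C * 0) (at_right 0)" by (intro tendsto_intros)
    then show "((\<lambda>r. 16 * C * r) \<longlongrightarrow> 0) (at_right 0)" by simp
    show "\<forall>\<^sub>F r in at_right 0. cmod (e z r / complex_of_real r ^ k) \<le> 16 * C * r"
      using near
    proof eventually_elim
      case (elim r)
      have "16 * C * r ^ 3 \<le> 16 * C * (r * r ^ k)"
      proof -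
        have "r ^ 3 = r * r ^ 2" by (simp add: power3_eq_cube power2_eq_square)
        also have "\<dots> \<le> r * r ^ k" using elim k by (intro mult_left_mono power_decreasing) auto
        finally show ?thesis by (intro mult_left_mono) (auto simp: C_def)
      qed
      then have "cmod (e z r) \<le> 16 * C * r * r ^ k" using e_bound[OF z elim] by simp
      then show ?case using elim by (simp add: norm_divide norm_power divide_le_eq)
    qed
  qed
  have n2z: "norm (n2 - n2) < 1 / 1000" by simp
  have rlim: "((\<lambda>r. complex_of_real r) \<longlongrightarrow> 0) (at_right 0)"
    using tendsto_of_real[OF tendsto_ident_at[of "0::real" "{0<..}"]] by simp
  have c0: "c0 = 0"
  proof -
    have "((\<lambda>r. e n2 r - complex_of_real r * lin n2 r - (complex_of_real r)\<^sup>2 * qua n2 r) \<longlongrightarrow>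
      0 - 0 * (L n2 + Ls (W n2)) - 0\<^sup>2 * (P n2 + Ps (W n2))) (at_right 0)"
      using e_lim[OF n2z, of 0] by (intro tendsto_intros rlim lin_lim[OF n2z] qua_lim[OF n2z]) simp
    moreover have "e n2 r - complex_of_real r * lin n2 r - (complex_of_real r)\<^sup>2 * qua n2 r = c0" for r
      by (simp add: e_def)
    ultimately show ?thesis by (simp add: tendsto_const_iff)
  qed
  have near_ball: "norm (z - n2) < 1 / 1000" if "z \<in> ball n2 (1 / 1000)" for z
    using that by (simp add: dist_norm norm_minus_commute)
  have "L z + Ls (W z) = 0" if z: "norm (z - n2) < 1 / 1000" for z
  proof -
    have "((\<lambda>r. e z r / complex_of_real r ^ 1 - complex_of_real r * qua z r) \<longlongrightarrow> 0 - 0 * (P z + Ps (W z))) (at_right 0)"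
      by (intro tendsto_intros rlim qua_lim[OF z] e_lim[OF z]) simp
    moreover have "\<forall>\<^sub>F r in at_right 0. e z r / complex_of_real r ^ 1 - complex_of_real r * qua z r = lin z r"
      using near by eventually_elim (simp add: e_def c0 field_simps power2_eq_square)
    ultimately have "(lin z \<longlongrightarrow> 0) (at_right 0)" using tendsto_cong by force
    then show ?thesis using tendsto_unique[OF trivial_limit_at_right_real lin_lim[OF z]] by blast
  qed
  moreover have W_lin: "Ls (W z) = Ls n1 - quad I z * Ls n2" for z
    using Ls_clinear(1)[of n1 "(- quad I z) *\<^sub>C n2"] Ls_clinear(2)[of "- quad I z" n2] by (simp add: W_def)
  ultimately have Leq0: "L z + (Ls n1 - quad I z * Ls n2) = 0" if "z \<in> ball n2 (1 / 1000)" for z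
    using near_ball[OF that] by simp
  have Leq: "L z + (Ls n1 - quad I z * Ls n2) = 0" for z
  proof (rule holo_identity[where f = "\<lambda>z. L z + (Ls n1 - quad I z * Ls n2)" and p = n2,
        OF _ open_UNIV convex_UNIV open_ball[of n2 "1 / 1000"] subset_UNIV])
    show "holo (\<lambda>z. L z + (Ls n1 - quad I z * Ls n2)) UNIV"
      by (intro holo_add holo_diff holo_mult holo_const holo_quad holo_clinear_map L)
  qed (auto intro: Leq0)
  \<comment> \<open>L is odd while q is even, so comparing z, -z and 0 in \<open>Leq\<close>
    isolates L.\<close>
  have L0: "L z = 0" for z
  proof -
    have "quad I (- z) = quad I z" by (simp add: quad_def)
    then show ?thesis
      using Leq[of z] Leq[of "- z"] Leq[of 0] clinear_minus[OF L, of z] clinear_zero[OF L]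
      by (auto simp: quad_def)
  qed
  have Ls0: "Ls z = 0" for z by (simp add: Ls_def L0)
  have Peq0: "P z + Ps (W z) = 0" if z: "norm (z - n2) < 1 / 1000" for z
  proof -
    have "\<forall>\<^sub>F r in at_right 0. e z r / complex_of_real r ^ 2 = qua z r"
      using near by eventually_elim (simp add: e_def c0 lin_def L0 Ls0)
    then have "(qua z \<longlongrightarrow> 0) (at_right 0)" using e_lim[OF z, of 2] tendsto_cong by force
    then show ?thesis using tendsto_unique[OF trivial_limit_at_right_real qua_lim[OF z]] by blast
  qed
  have Peq: "P z + Ps (W z) = 0" for z
  proof (rule holo_identity[where f = "\<lambda>z. P z + Ps (W z)" and p = n2,
        OF _ open_UNIV convex_UNIV open_ball[of n2 "1 / 1000"] subset_UNIV])
    have "holo W UNIV" unfolding W_def by (intro holo_diff holo_cscale holo_const holo_quad)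
    then show "holo (\<lambda>z. P z + Ps (W z)) UNIV"
      by (intro holo_add P_hol holo_compose[OF Ps_hol]) auto
    show "P z + Ps (W z) = 0" if "z \<in> ball n2 (1 / 1000)" for z
      using that by (intro Peq0 near_ball)
  qed auto
  define \<alpha> where "\<alpha> = cnj (B n2 n2 / 2)"
  define \<beta>' where "\<beta>' = cnj ((B n2 n1 + B n1 n2) / 2 - 2)"
  define \<gamma> where "\<gamma> = cnj (B n1 n1 / 2)"
  \<comment> \<open>W z lies on the line n1 + s n2 at s = -q z, so a quadratic form of it is a
    polynomial of degree at most 2 in q z.\<close>
  have PsW: "Ps (W z) = \<alpha> - \<beta>' * quad I z + \<gamma> * (quad I z)\<^sup>2" for z
  proof -
    define s where "s = cnj (quad I z)"
    have cW: "cj (W z) = n2 - s *\<^sub>C n1" by (simp add: W_def s_def cj_diff cj_cscale)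
    have q1: "quad I (n2 - s *\<^sub>C n1) = - s"
      using quad_add[of I n2 "(- s) *\<^sub>C n1"] dot_cscale_right[of I n2 "- s" n1] quad_scale[of I "- s" n1] by simp
    have B1: "B (n2 - s *\<^sub>C n1) (n2 - s *\<^sub>C n1) = B n2 n2 - s * (B n2 n1 + B n1 n2) + s\<^sup>2 * B n1 n1"
      by (simp add: clinear_diff[OF Br] clinear_diff[OF Bl] clinear_cscale[OF Br] clinear_cscale[OF Bl] power2_eq_square algebra_simps)
    have "P (cj (W z)) = B n2 n2 / 2 - ((B n2 n1 + B n1 n2) / 2 - 2) * s + (B n1 n1 / 2) * s\<^sup>2"
      unfolding P_def cW q1 B1 by (simp add: field_simps)
    then show ?thesis by (simp add: Ps_def \<alpha>_def \<beta>'_def \<gamma>_def s_def)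
  qed
  have \<alpha>0: "\<alpha> = 0"
    using Peq[of 0] P_scale[of 0 0] by (simp add: PsW quad_def)
  \<comment> \<open>P has degree 2 in z and the \<gamma> term degree 4. Comparing z with 2 z
    separates them.\<close>
  have Pq: "P z = \<beta>' * quad I z" for z
  proof -
    have 1: "P z + (- \<beta>' * quad I z + \<gamma> * (quad I z)\<^sup>2) = 0"
      using Peq[of z] by (simp add: PsW \<alpha>0)
    have 2: "4 * P z + (- \<beta>' * (4 * quad I z) + \<gamma> * (4 * quad I z)\<^sup>2) = 0"
      using Peq[of "2 *\<^sub>C z"] by (simp add: PsW \<alpha>0 P_scale quad_scale)
    have "12 * (\<gamma> * (quad I z)\<^sup>2) = (4 * P z + (- \<beta>' * (4 * quad I z) + \<gamma> * (4 * quad I z)\<^sup>2))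
      - 4 * (P z + (- \<beta>' * quad I z + \<gamma> * (quad I z)\<^sup>2))"
      by (simp add: algebra_simps power2_eq_square)
    then have "12 * (\<gamma> * (quad I z)\<^sup>2) = 0"
      unfolding 1 2 by simp
    then have "\<gamma> * (quad I z)\<^sup>2 = 0" by simp
    then show ?thesis using 1 by (simp add: add_eq_0_iff2)
  qed
  have qa: "quad I (axis a 1) = 1" using ab by (simp add: quad_dot dot_axis)
  have qW: "quad I (W z) = - quad I z" for z
    using quad_add[of I n1 "(- quad I z) *\<^sub>C n2"] dot_cscale_right[of I n1 "- quad I z" n2] quad_scale[of I "- quad I z" n2]
    by (simp add: W_def)
  \<comment> \<open>At the basis vector of index a one has q z = 1 and q (W z) = -1, so
    \<open>Peq\<close> compares \<beta>' with its conjugate.\<close>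
  have "\<beta>' - cnj \<beta>' = 0"
    using Peq[of "axis a 1"] qW[of "axis a 1"] by (simp add: Ps_def Pq qa)
  then have real: "\<beta>' = complex_of_real (Re \<beta>')" by (simp add: complex_eq_iff)
  \<comment> \<open>Two Cauchy estimates make the second derivative of f + 2 q small. That
    derivative is 2 (\<beta>' + 2) along the basis vector, so \<beta>' is close to -2.\<close>
  have nz: "\<beta>' \<noteq> 0"
  proof -
    let ?e = "axis a (1::complex)"
    have fd_small: "cmod (fd g x ?e) \<le> 12 / 10000" if x: "x \<in> ball 0 (1 / 2)" for x
    proof -
      have sub: "ball x (1 / 2) \<subseteq> ball 0 1"
      proof
        fix y assume "y \<in> ball x (1 / 2)"
        then show "y \<in> ball 0 1" using x dist_triangle[of 0 y x] by simp
      qed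
      have "cmod (fd g x ?e) \<le> 2 * (3 / 10000) / (1 / 2) * norm ?e"
        by (rule holo_fd_bound[OF holo_subset[OF g_hol sub] gB]) (use sub in auto)
      then show ?thesis by simp
    qed
    have "cmod (B ?e ?e) \<le> 2 * (12 / 10000) / (1 / 2) * norm ?e"
      unfolding B_def hess_def
      by (rule holo_fd_bound[OF holo_subset[OF holo_fd[OF open_ball g_hol]] fd_small]) auto
    moreover have "B ?e ?e = 2 * (\<beta>' + 2)"
      using Pq[of ?e] by (simp add: P_def qa algebra_simps diff_eq_eq)
    ultimately show ?thesis by (auto simp: norm_mult)
  qed
  have "cmod (f v - f 0 - complex_of_real (Re \<beta>') * quad I v) \<le> C * norm v ^ 3" if "norm v \<le> 1 / 2" for v
    using R[OF that] by (simp add: L0 Pq real[symmetric])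
  moreover have "Re \<beta>' \<noteq> 0" using nz real by (metis of_real_0)
  ultimately show ?thesis using c0 unfolding c0_def by blast
qed

end

context core
begin

lemma first_integral:
  "\<exists>f C. holo f (ball 0 1) \<and> (\<forall>z\<in>ball 0 1. f (proj I z) = f z) \<and>
     (\<forall>v. norm v \<le> 1 / 2 \<longrightarrow> cmod (f v - quad I v) \<le> C * norm v ^ 3) \<and>
     (\<forall>r\<in>D. \<forall>Z\<in>ball Z0 (1 / 100). F (r *\<^sub>C Z) = 0 \<longrightarrow> f (r *\<^sub>C fst Z) + cnj (f (cj (r *\<^sub>C snd Z))) = 0)"
proof -
  obtain t where "core_t F I a b \<eta> t"
    using first_integral_ex core_axioms unfolding core_t_def core_t_axioms_def by blast
  then interpret core_t F I a b \<eta> t .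
  obtain \<beta> :: real and C where \<beta>: "\<beta> \<noteq> (0::real)" and f0: "f 0 + cnj (f 0) = 0"
    and C: "\<And>v. norm v \<le> 1 / 2 \<Longrightarrow> cmod (f v - f 0 - \<beta> * quad I v) \<le> C * norm v ^ 3"
    using f_expansion by blast
  \<comment> \<open>f 0 is purely imaginary and \<beta> is real, so the relation survives
    subtracting the one and dividing by the other.\<close>
  define k where "k z = (f z - f 0) / \<beta>" for z
  show ?thesis
  proof (intro exI[of _ k] exI[of _ "C / \<bar>\<beta>\<bar>"] conjI ballI allI impI)
    show "holo k (ball 0 1)"
      unfolding k_def using \<beta> by (intro holo_divide holo_diff f_hol holo_const) auto
    show "k (proj I z) = k z" if "z \<in> ball 0 1" for z by (simp add: k_def f_proj[OF that])
    show "cmod (k v - quad I v) \<le> C / \<bar>\<beta>\<bar> * norm v ^ 3" if "norm v \<le> 1 / 2" for v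
    proof -
      have "k v - quad I v = (f v - f 0 - \<beta> * quad I v) / \<beta>" using \<beta> by (simp add: k_def field_simps)
      then show ?thesis using divide_right_mono[OF C[OF that], of "\<bar>\<beta>\<bar>"] by (simp add: norm_divide)
    qed
    fix r Z assume "r \<in> D" "Z \<in> ball Z0 (1 / 100)" "F (r *\<^sub>C Z) = 0"
    then have "f (r *\<^sub>C fst Z) + fs (r *\<^sub>C snd Z) - (f 0 + cnj (f 0)) = 0" using relation f0 by simp
    then have "(f (r *\<^sub>C fst Z) - f 0) + (cnj (f (cj (r *\<^sub>C snd Z))) - cnj (f 0)) = 0"
      by (simp add: fs_def algebra_simps)
    then show "k (r *\<^sub>C fst Z) + cnj (k (cj (r *\<^sub>C snd Z))) = 0"
      by (simp add: k_def add_divide_distrib[symmetric])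
  qed
qed

end

section \<open>Rigidity of the zero set in Morse coordinates\<close>

lemma accumulates_real:
  assumes h: "h holomorphic_on ball 0 \<rho>" and \<rho>: "\<rho> > 0" and c: "c \<noteq> 0" and e: "e > 0"
    and zero: "\<And>r. 0 < r \<Longrightarrow> r < e \<Longrightarrow> h (complex_of_real r * c) = 0" and s: "s \<in> ball 0 \<rho>"
  shows "h s = 0"
proof -
  define m where "m = min e (\<rho> / cmod c)"
  have m: "m > 0" using \<rho> c e by (simp add: m_def)
  let ?U = "(\<lambda>r. complex_of_real r * c) ` {0<..<m}"
  show ?thesis
  proof (rule analytic_continuation[where f = h and S = "ball 0 \<rho>" and U = ?U and \<xi> = 0])
    show "?U \<subseteq> ball 0 \<rho>"
    proof
      fix x assume "x \<in> ?U"
      then obtain r where "x = complex_of_real r * c" "r \<in> {0<..<m}" by blast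
      then have r: "x = complex_of_real r * c" "0 < r" "r < m" by auto
      then have "r * cmod c < \<rho> / cmod c * cmod c" using c by (intro mult_strict_right_mono) (auto simp: m_def)
      then show "x \<in> ball 0 \<rho>" using r c by (simp add: norm_mult)
    qed
    show "0 islimpt ?U"
      unfolding islimpt_approachable
    proof (intro allI impI)
      fix d :: real assume d: "d > 0"
      define r where "r = min (m / 2) (d / (2 * cmod c))"
      have r: "0 < r" "r < m" using m d c by (auto simp: r_def)
      have "r * cmod c \<le> d / (2 * cmod c) * cmod c" by (intro mult_right_mono) (auto simp: r_def)
      then have "r * cmod c < d" using d c by simp
      then show "\<exists>x'\<in>?U. x' \<noteq> 0 \<and> dist x' 0 < d"
        using r c by (intro bexI[of _ "complex_of_real r * c"]) (auto simp: norm_mult)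
    qed
    show "h z = 0" if "z \<in> ?U" for z using that zero by (auto simp: m_def)
  qed (use h \<rho> s in auto)
qed

lemma norm_Pair_cj: "norm (z, cj z) \<le> 2 * norm z"
  using norm_Pair_le[of z "cj z"] by simp

text \<open>G is F written in the coordinates that turn the first integral into q. There the
  relation becomes \<open>rel\<close>: at small scales and near (n2, n1), every zero of G lies on
  the model quadric.\<close>

locale rigidity = null_pair I a b
  for G :: "(complex^'n) \<times> (complex^'n) \<Rightarrow> complex" and I :: "'n set" and a b :: 'n +
  fixes \<delta>0 \<kappa> r0 :: real
  assumes pos: "\<delta>0 > 0" "\<kappa> > 0" "r0 > 0" "\<kappa> \<le> 1"
    and hol: "holo G (ball 0 \<delta>0)"
    and small: "\<And>\<epsilon>. \<epsilon> > 0 \<Longrightarrow> \<exists>\<delta>>0. \<forall>Z\<in>ball 0 \<delta>. cmod (G Z - QQ I Z) \<le> \<epsilon> * (norm Z)\<^sup>2"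
    and rel: "\<And>r Z. 0 < r \<Longrightarrow> r < r0 \<Longrightarrow> Z \<in> ball (n2, n1) \<kappa> \<Longrightarrow> G (complex_of_real r *\<^sub>C Z) = 0 \<Longrightarrow> QQ I Z = 0"
    and inv: "\<And>z. (z, cj z) \<in> ball 0 \<delta>0 \<Longrightarrow> G (proj I z, cj (proj I z)) = G (z, cj z)"
begin

lemma norm_n_le_1: "norm n1 \<le> 1" "norm n2 \<le> 1"
  using norm_n by simp_all

lemma QQ_shift: "QQ I (Z + s *\<^sub>C (0, n2)) = QQ I Z + s * dot I (snd Z) n2"
  by (simp add: QQ_def cscale_Pair quad_add quad_scale dot_cscale_right field_simps)

text \<open>The converse of \<open>rel\<close>. For Z on the quadric, G has a root at Z + s (0, n2)
  with s small, and \<open>rel\<close> puts this point on the quadric too. But QQ is affine in s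
  with slope m near 1/2, so s = 0.\<close>

lemma quadric_near:
  "\<exists>r1>0. \<forall>r Z. 0 < r \<longrightarrow> r < r1 \<longrightarrow> Z \<in> ball (n2, n1) (\<kappa> / 4) \<longrightarrow> QQ I Z = 0 \<longrightarrow> G (complex_of_real r *\<^sub>C Z) = 0"
proof -
  define \<rho> where "\<rho> = \<kappa> / 2"
  have \<rho>: "\<rho> > 0" "\<rho> \<le> 1 / 2" using pos by (auto simp: \<rho>_def)
  \<comment> \<open>512 = 8 * 4 * 4^2: the fixed point lemma asks for \<rho> / 8, the inverse slope
    is at most 4, and the shifted points have norm at most 4.\<close>
  obtain \<delta> where \<delta>: "\<delta> > 0" "\<And>Z. Z \<in> ball 0 \<delta> \<Longrightarrow> cmod (G Z - QQ I Z) \<le> (\<rho> / 512) * (norm Z)\<^sup>2"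
    using small[of "\<rho> / 512"] \<rho> by auto
  define r1 where "r1 = min r0 (min \<delta> \<delta>0 / 4)"
  have "G (complex_of_real r *\<^sub>C Z) = 0"
    if r: "0 < r" "r < r1" and Z: "Z \<in> ball (n2, n1) (\<kappa> / 4)" and Q: "QQ I Z = 0" for r Z
  proof -
    define m where "m = dot I (snd Z) n2"
    have dZ: "norm (Z - (n2, n1)) < \<kappa> / 4" using Z by (simp add: dist_norm norm_minus_commute)
    have "cmod (m - 1 / 2) = cmod (dot I (snd (Z - (n2, n1))) n2)"
      using dot_add_left[of I "snd Z - n1" n1 n2] by (simp add: m_def)
    also have "\<dots> \<le> norm (snd (Z - (n2, n1))) * norm n2" by (rule cmod_dot)
    also have "\<dots> \<le> 1 / 4 * 1"
      using norm_fst_snd(2)[of "Z - (n2, n1)"] dZ pos norm_n_le_1 by (intro mult_mono) auto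
    finally have m: "cmod m \<ge> 1 / 4" using norm_triangle_ineq2[of "1 / 2" "1 / 2 - m"] by (simp add: norm_minus_commute)
    then have m0: "m \<noteq> 0" by auto
    have size: "norm (Z + s *\<^sub>C (0, n2)) \<le> 4" if "cmod s < 1" for s
    proof -
      have "norm (s *\<^sub>C (0 :: complex^'n, n2)) \<le> 1 * 1"
        unfolding norm_cscale norm_Pair_zero using that norm_n_le_1 by (intro mult_mono) auto
      moreover have "norm Z \<le> norm (n2, n1) + \<kappa> / 4" using dZ norm_triangle_ineq2[of Z "(n2, n1)"] by simp
      moreover have "norm (n2, n1) \<le> 2" using norm_Pair_le[of n2 n1] norm_n_le_1 by simp
      ultimately show ?thesis using norm_triangle_ineq[of Z "s *\<^sub>C (0, n2)"] pos by simp
    qed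
    have rs: "norm (complex_of_real r *\<^sub>C (Z + s *\<^sub>C (0, n2))) < min \<delta> \<delta>0" if "cmod s < 1" for s
    proof -
      have "r * norm (Z + s *\<^sub>C (0, n2)) \<le> r * 4" using size[OF that] r by (intro mult_left_mono) auto
      also have "\<dots> < min \<delta> \<delta>0" using r by (simp add: r1_def)
      finally show ?thesis using r by simp
    qed
    \<comment> \<open>r and Z are fixed here, so the parameter slot of \<open>holo_fixpoint\<close>
      is filled by an arbitrary complex number.\<close>
    define h where "h = (\<lambda>p :: complex \<times> complex. snd p - G (complex_of_real r *\<^sub>C (Z + snd p *\<^sub>C (0, n2))) / ((complex_of_real r)\<^sup>2 * m))"
    have "holo h (UNIV \<times> ball 0 \<rho>)"
      unfolding h_def
    proof (intro holo_diff holo_divide holo_const holo_snd holo_id)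
      show "holo (\<lambda>p. G (complex_of_real r *\<^sub>C (Z + snd p *\<^sub>C (0, n2)))) ((UNIV :: complex set) \<times> ball (0 :: complex) \<rho>)"
        by (rule holo_compose[OF hol])
          (use rs \<rho> in \<open>auto intro!: holo_cscale holo_add holo_const holo_snd holo_id simp del: norm_cscale\<close>)
    qed (use r m0 in auto)
    then obtain g where g: "\<And>p. p \<in> UNIV \<Longrightarrow> cmod (g p - 0) \<le> \<rho> / 8" "\<And>p. p \<in> UNIV \<Longrightarrow> h (p, g p) = g p"
    proof (rule holo_fixpoint[OF open_UNIV])
      show "cmod (h (p, s) - 0) \<le> \<rho> / 8" if "s \<in> ball 0 \<rho>" for p s
      proof -
        have s: "cmod s < 1" using that \<rho> by simp
        let ?Z = "Z + s *\<^sub>C (0, n2)"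
        have "h (p, s) = - (G (complex_of_real r *\<^sub>C ?Z) - QQ I (complex_of_real r *\<^sub>C ?Z)) / ((complex_of_real r)\<^sup>2 * m)"
          using r m0 unfolding QQ_scale QQ_shift Q by (simp add: h_def m_def[symmetric] field_simps)
        then have "cmod (h (p, s)) = cmod (G (complex_of_real r *\<^sub>C ?Z) - QQ I (complex_of_real r *\<^sub>C ?Z)) / (r\<^sup>2 * cmod m)"
          using r by (simp add: norm_divide norm_mult norm_power norm_minus_commute)
        also have "\<dots> \<le> (\<rho> / 512) * (norm (complex_of_real r *\<^sub>C ?Z))\<^sup>2 / (r\<^sup>2 * cmod m)"
          using rs[OF s] by (intro divide_right_mono \<delta>(2)) (auto simp del: norm_cscale)
        also have "\<dots> = (\<rho> / 512) * (norm ?Z)\<^sup>2 / cmod m"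
          using r by (simp add: power_mult_distrib)
        also have "\<dots> \<le> (\<rho> / 512) * 4\<^sup>2 / (1 / 4)"
          using \<rho> size[OF s] m by (intro frac_le mult_mono power_mono) auto
        finally show ?thesis by simp
      qed
    qed (use \<rho> in auto)
    define s where "s = g 0"
    have s: "cmod s \<le> \<rho> / 8" "h (0, s) = s" using g by (auto simp: s_def)
    have G0: "G (complex_of_real r *\<^sub>C (Z + s *\<^sub>C (0, n2))) = 0" using s(2) r m0 by (simp add: h_def)
    have "cmod s * norm n2 \<le> \<rho> / 8 * 1" using s norm_n_le_1 \<rho> by (intro mult_mono) auto
    then have "norm ((Z - (n2, n1)) + s *\<^sub>C (0, n2)) < \<kappa>"
      using norm_triangle_ineq[of "Z - (n2, n1)" "s *\<^sub>C (0, n2)"] dZ pos by (simp add: \<rho>_def)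
    moreover have "Z + s *\<^sub>C (0, n2) = (n2, n1) + ((Z - (n2, n1)) + s *\<^sub>C (0, n2))" by simp
    ultimately have "Z + s *\<^sub>C (0, n2) \<in> ball (n2, n1) \<kappa>" using mem_ball_add by metis
    then have "QQ I (Z + s *\<^sub>C (0, n2)) = 0" using rel[of r] r G0 by (simp add: r1_def)
    then have "s = 0" using m0 by (simp add: QQ_shift Q m_def)
    then show ?thesis using G0 by simp
  qed
  moreover have "r1 > 0" using pos \<delta> by (simp add: r1_def)
  ultimately show ?thesis by blast
qed

definition y0 :: "complex^'n \<Rightarrow> complex^'n" where "y0 = proj (- {a, b})"
text \<open>A polynomial parametrisation of the part of the quadric with w_a + \<i> w_b = 1: the
  component along n2 is solved from QQ = 0. Its domain is a whole vector space, which makes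
  continuation along the quadric straightforward.\<close>

definition V :: "(complex^'n) \<times> (complex^'n) \<Rightarrow> (complex^'n) \<times> (complex^'n)"
  where "V p = (fst p, n1 + y0 (snd p) - (quad I (fst p) + quad I (y0 (snd p))) *\<^sub>C n2)"

lemma V_hol: "holo V S"
  unfolding V_def
  by (intro holo_Pair holo_diff holo_add holo_cscale holo_const holo_fst holo_snd holo_id
      holo_compose[OF holo_quad[of I UNIV]] holo_compose[OF holo_clinear_map[of y0 UNIV]])
    (auto simp: y0_def clinear_proj)

lemma QQ_V: "QQ I (V p) = 0"
proof -
  have d: "dot I n1 (y0 v) = 0" "dot I n2 (y0 v) = 0" for v
    by (simp_all add: dot_n y0_def proj_def)
  let ?s = "quad I (fst p) + quad I (y0 (snd p))"
  have "quad I ((n1 + y0 (snd p)) + (- ?s) *\<^sub>C n2) = quad I (y0 (snd p)) - ?s"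
    unfolding quad_add dot_add_left dot_cscale_right quad_scale using d by (simp add: dot_commute[of I _ n2] field_simps)
  then have "quad I (n1 + y0 (snd p) - ?s *\<^sub>C n2) = quad I (y0 (snd p)) - ?s"
    by (simp only: cscale_minus_left add_uminus_conv_diff)
  then show ?thesis by (simp add: QQ_def V_def)
qed

text \<open>V maps (n2, 0) to (n2, n1), near which \<open>quadric_near\<close> applies. The identity
  theorem on a ball containing p carries the vanishing to p, once r is so small that r V maps this
  ball into the domain of G.\<close>

lemma G_V: "\<exists>r2>0. \<forall>r. 0 < r \<longrightarrow> r < r2 \<longrightarrow> G (complex_of_real r *\<^sub>C V p) = 0"
proof -
  obtain r1 where r1: "r1 > 0"
    "\<forall>r Z. 0 < r \<longrightarrow> r < r1 \<longrightarrow> Z \<in> ball (n2, n1) (\<kappa> / 4) \<longrightarrow> QQ I Z = 0 \<longrightarrow> G (complex_of_real r *\<^sub>C Z) = 0"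
    using quadric_near by (elim exE conjE)
  define R where "R = norm p + 2"
  let ?B = "ball (0 :: (complex^'n) \<times> (complex^'n)) R"
  have base: "(n2, 0) \<in> ?B" using add_less_le_mono[of 1 2 0 "norm p"] norm_n_le_1(2) by (simp add: R_def)
  have V0: "V (n2, 0) = (n2, n1)"
    using clinear_zero[OF clinear_proj, of "- {a, b}"] by (simp add: V_def y0_def) (simp add: quad_def)
  have "bounded (V ` cball 0 R)"
    by (intro compact_imp_bounded compact_continuous_image holo_continuous_on[OF V_hol] compact_cball)
  then obtain K where K: "K > 0" "\<forall>x\<in>V ` cball 0 R. norm x \<le> K"
    unfolding bounded_pos by (elim exE conjE)
  define r2 where "r2 = min r1 (\<delta>0 / K)"
  have "G (complex_of_real r *\<^sub>C V p) = 0" if r: "0 < r" "r < r2" for r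
  proof (rule holo_identity[where f = "\<lambda>p. G (complex_of_real r *\<^sub>C V p)" and S = ?B and W = "{x \<in> ?B. V x \<in> ball (n2, n1) (\<kappa> / 4)}" and p = "(n2, 0)"])
    show "holo (\<lambda>p. G (complex_of_real r *\<^sub>C V p)) ?B"
    proof (rule holo_compose[OF hol])
      show "holo (\<lambda>p. complex_of_real r *\<^sub>C V p) ?B" by (intro holo_cscale_const V_hol)
      fix x assume "x \<in> ?B"
      then have "r * norm (V x) \<le> r * K" using K(2) r by (intro mult_left_mono) auto
      also have "\<dots> < \<delta>0" using r K by (simp add: r2_def pos_less_divide_eq)
      finally show "complex_of_real r *\<^sub>C V x \<in> ball 0 \<delta>0" using r by simp
    qed
    show "open {x \<in> ?B. V x \<in> ball (n2, n1) (\<kappa> / 4)}"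
      using continuous_open_preimage[OF holo_continuous_on[OF V_hol] open_ball open_ball, of 0 R "(n2, n1)" "\<kappa> / 4"]
      by (simp add: vimage_def Int_def)
    show "(n2, 0) \<in> {x \<in> ?B. V x \<in> ball (n2, n1) (\<kappa> / 4)}" using base V0 pos by simp
    show "G (complex_of_real r *\<^sub>C V z) = 0" if "z \<in> {x \<in> ?B. V x \<in> ball (n2, n1) (\<kappa> / 4)}" for z
      using that r by (intro r1(2)[rule_format] QQ_V) (auto simp: r2_def)
    show "p \<in> ?B" by (simp add: R_def)
  qed auto
  moreover have "r2 > 0" using r1 K pos by (simp add: r2_def)
  ultimately show ?thesis by blast
qed

text \<open>Scaling (z, cj z) by c = 1 / \<alpha> puts it in the chart V, since the quadric is a
  cone. By \<open>G_V\<close>, G vanishes at all small positive multiples of the scaled point. On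
  the complex line through (z, cj z) these accumulate at 0, so G vanishes along the line as far as
  (z, cj z).\<close>

lemma G_real_generic:
  assumes z: "norm (z, cj z) < \<delta>0" and Q: "Re (quad I z) = 0" and \<alpha>: "cj z $ a + \<i> * cj z $ b \<noteq> 0"
  shows "G (z, cj z) = 0"
proof -
  define \<alpha> where "\<alpha> = cj z $ a + \<i> * cj z $ b"
  define c where "c = inverse \<alpha>"
  have c: "c \<noteq> 0" "c * \<alpha> = 1" using \<alpha> by (simp_all add: c_def \<alpha>_def)
  have "QQ I (z, cj z) = 0" using Q by (simp add: QQ_def complex_eq_iff)
  then have Q': "QQ I (c *\<^sub>C (z, cj z)) = 0" by (simp only: QQ_scale mult_zero_right)
  define w where "w = c *\<^sub>C cj z"
  define \<beta> where "\<beta> = w $ a - \<i> * w $ b"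
  have w1: "w $ a + \<i> * w $ b = 1" using c by (simp add: w_def \<alpha>_def algebra_simps)
  have w: "w = n1 + y0 w + \<beta> *\<^sub>C n2"
    unfolding vec_eq_iff
  proof
    fix i
    have wa: "w $ a = (1 + \<beta>) / 2" and wb: "w $ b = \<i> * (\<beta> - 1) / 2"
      using w1 unfolding \<beta>_def by (auto simp: algebra_simps complex_eq_iff)
    show "w $ i = (n1 + y0 w + \<beta> *\<^sub>C n2) $ i"
    proof (cases "i = a \<or> i = b")
      case True
      then show ?thesis using wa wb by (auto simp: n_nth y0_def proj_def algebra_simps add_divide_distrib diff_divide_distrib)
    next
      case False
      then show ?thesis by (simp add: n1_def n2_def y0_def proj_def axis_def)
    qed
  qed
  have d: "dot I n1 (y0 v) = 0" "dot I n2 (y0 v) = 0" for v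
    by (simp_all add: dot_n y0_def proj_def)
  have "quad I ((n1 + y0 w) + \<beta> *\<^sub>C n2) = quad I (y0 w) + \<beta>"
    unfolding quad_add dot_add_left dot_cscale_right quad_scale using d by (simp add: dot_commute[of I _ n2])
  then have "quad I w = quad I (y0 w) + \<beta>" using w by simp
  then have "\<beta> = - (quad I (c *\<^sub>C z) + quad I (y0 w))"
    using Q' by (simp add: QQ_def w_def[symmetric] add_eq_0_iff2 algebra_simps)
  then have "\<beta> *\<^sub>C n2 = - ((quad I (c *\<^sub>C z) + quad I (y0 w)) *\<^sub>C n2)" by (simp only: cscale_minus_left)
  then have "w = n1 + y0 w - (quad I (c *\<^sub>C z) + quad I (y0 w)) *\<^sub>C n2"
    using w by (simp only: diff_conv_add_uminus)
  then have cV: "c *\<^sub>C (z, cj z) = V (c *\<^sub>C z, w)"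
    by (simp only: V_def cscale_Pair w_def[symmetric] fst_conv snd_conv)
  obtain r2 where r2: "r2 > 0" "\<And>r. 0 < r \<Longrightarrow> r < r2 \<Longrightarrow> G (complex_of_real r *\<^sub>C c *\<^sub>C (z, cj z)) = 0"
    using G_V[of "(c *\<^sub>C z, w)"] unfolding cV by blast
  define \<rho> where "\<rho> = \<delta>0 / norm (z, cj z)"
  have z0: "norm (z, cj z) > 0" using \<alpha> by (auto simp: zero_prod_def)
  have "G (0 + 1 *\<^sub>C (z, cj z)) = 0"
  proof (rule accumulates_real[where h = "\<lambda>s. G (0 + s *\<^sub>C (z, cj z))" and \<rho> = \<rho>, OF _ _ c(1) r2(1)])
    show "(\<lambda>s. G (0 + s *\<^sub>C (z, cj z))) holomorphic_on ball 0 \<rho>"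
      by (rule line_holomorphic[OF hol]) (use z0 in \<open>simp add: \<rho>_def pos_less_divide_eq\<close>)
    show "\<rho> > 0" using z0 pos by (simp add: \<rho>_def)
    show "G (0 + (complex_of_real r * c) *\<^sub>C (z, cj z)) = 0" if "0 < r" "r < r2" for r
      using r2(2)[OF that] by simp
    show "(1::complex) \<in> ball 0 \<rho>" using z z0 by (simp add: \<rho>_def dist_norm)
  qed
  then show ?thesis by simp
qed

text \<open>Each exceptional point of the cone is a limit of generic points of the cone, found along
  a suitable line z + s v. Continuity of G finishes.\<close>

lemma G_real:
  assumes z: "norm (z, cj z) < \<delta>0" and Q: "Re (quad I z) = 0"
  shows "G (z, cj z) = 0"
proof (cases "cj z $ a + \<i> * cj z $ b = 0")
  case False
  then show ?thesis using G_real_generic[OF z Q] by blast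
next
  case True
  then have b0: "z $ a - \<i> * z $ b = 0"
    using complex_cnj_zero_iff[of "z $ a - \<i> * z $ b"] by simp
  define \<alpha> where "\<alpha> = z $ a + \<i> * z $ b"
  obtain v where v: "\<And>s::real. s \<noteq> 0 \<Longrightarrow> Re (quad I (z + s *\<^sub>R v)) = 0"
      "\<And>s::real. s \<noteq> 0 \<Longrightarrow> (z + s *\<^sub>R v) $ a - \<i> * (z + s *\<^sub>R v) $ b \<noteq> 0"
  proof (cases "\<alpha> = 0")
    case False
    \<comment> \<open>Moving along this vector adds \<i> s |\<alpha>|^2 to q z, which is purely
      imaginary.\<close>
    let ?v = "(\<i> * cnj \<alpha>) *\<^sub>C n2"
    show ?thesis
    proof (rule that[of ?v])
      fix s :: real assume s: "s \<noteq> 0"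
      have eq: "s *\<^sub>R ?v = (s * \<i> * cnj \<alpha>) *\<^sub>C n2" by (simp add: cscale_of_real[symmetric] mult.assoc)
      have "quad I (z + s *\<^sub>R ?v) = quad I z + s * \<i> * (cnj \<alpha> * \<alpha>)"
        unfolding eq quad_add quad_scale dot_cscale_right by (simp add: dot_commute[of I z] dot_n \<alpha>_def)
      then show "Re (quad I (z + s *\<^sub>R ?v)) = 0" using Q by (simp add: complex_mult_cnj mult.commute[of "cnj \<alpha>"])
      have "(z + s *\<^sub>R ?v) $ a - \<i> * (z + s *\<^sub>R ?v) $ b = s * \<i> * cnj \<alpha>"
        unfolding eq using b0 by (simp add: n_nth algebra_simps)
      then show "(z + s *\<^sub>R ?v) $ a - \<i> * (z + s *\<^sub>R ?v) $ b \<noteq> 0" using s False by simp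
    qed
  next
    case True
    then have zab: "z $ a = 0" "z $ b = 0" using b0 by (auto simp: \<alpha>_def)
    \<comment> \<open>Now z pairs to 0 with n1 and n2, so moving along this vector adds the purely
      imaginary \<i> s^2 to q z.\<close>
    let ?v = "n1 + \<i> *\<^sub>C n2"
    show ?thesis
    proof (rule that[of ?v])
      fix s :: real assume s: "s \<noteq> 0"
      have eq: "s *\<^sub>R ?v = complex_of_real s *\<^sub>C (n1 + \<i> *\<^sub>C n2)" by (simp add: cscale_of_real)
      have "quad I (z + s *\<^sub>R ?v) = quad I z + (complex_of_real s)\<^sup>2 * \<i>"
        unfolding eq quad_add quad_scale dot_cscale_right dot_add_right by (simp add: dot_commute[of I z] dot_n zab n_nth)
      then show "Re (quad I (z + s *\<^sub>R ?v)) = 0" using Q by (simp add: of_real_power[symmetric] del: of_real_power)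
      have "(z + s *\<^sub>R ?v) $ a - \<i> * (z + s *\<^sub>R ?v) $ b = s * \<i>"
        unfolding eq by (simp add: zab n_nth algebra_simps)
      then show "(z + s *\<^sub>R ?v) $ a - \<i> * (z + s *\<^sub>R ?v) $ b \<noteq> 0" using s by simp
    qed
  qed
  let ?p = "\<lambda>s::real. (z + s *\<^sub>R v, cj (z + s *\<^sub>R v))"
  have "((\<lambda>s. z + s *\<^sub>R v) \<longlongrightarrow> z + 0 *\<^sub>R v) (at_right 0)" by (intro tendsto_intros)
  then have zs: "((\<lambda>s. z + s *\<^sub>R v) \<longlongrightarrow> z) (at_right 0)" by simp
  then have p: "(?p \<longlongrightarrow> (z, cj z)) (at_right 0)"
    by (intro tendsto_Pair bounded_linear.tendsto[OF bounded_linear_cj])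
  have "isCont G (z, cj z)"
    using holo_has_derivative[OF hol, of "(z, cj z)"] z has_derivative_continuous by auto
  then have "((\<lambda>s. G (?p s)) \<longlongrightarrow> G (z, cj z)) (at_right 0)" by (rule isCont_tendsto_compose[OF _ p])
  moreover have "\<forall>\<^sub>F s in at_right 0. G (?p s) = 0"
  proof -
    have "\<forall>\<^sub>F s in at_right 0. norm (?p s) < \<delta>0" by (rule order_tendstoD(2)[OF tendsto_norm[OF p] z])
    moreover have "\<forall>\<^sub>F s in at_right 0. s \<in> {0<..<1 :: real}" by (intro eventually_at_right_real) simp
    ultimately show ?thesis
    proof eventually_elim
      case (elim s)
      have "cj (z + s *\<^sub>R v) $ a + \<i> * cj (z + s *\<^sub>R v) $ b = cnj ((z + s *\<^sub>R v) $ a - \<i> * (z + s *\<^sub>R v) $ b)" by simp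
      then have "cj (z + s *\<^sub>R v) $ a + \<i> * cj (z + s *\<^sub>R v) $ b \<noteq> 0"
        using v(2)[of s] elim by (metis complex_cnj_zero_iff greaterThanLessThan_iff less_irrefl)
      then show ?case using G_real_generic[OF elim(1)] v(1)[of s] elim by simp
    qed
  qed
  ultimately have "((\<lambda>s::real. 0) \<longlongrightarrow> G (z, cj z)) (at_right 0)" using tendsto_cong by force
  then show ?thesis by (simp add: tendsto_const_iff)
qed

text \<open>
  The converse inclusion: for \<open>z\<close> in the zero set with \<open>Re (quad I z) \<noteq> 0\<close>, rescaling the real part of
  \<open>z\<close> gives a point \<open>z'\<close> of the model cone, hence of the zero set; but \<open>G - QQ I\<close> varies too little
  between \<open>z\<close> and \<open>z'\<close>.
\<close>

lemma zero_set: "\<forall>\<^sub>F z in nhds 0. G (z, cj z) = 0 \<longleftrightarrow> Re (quad I z) = 0"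
proof -
  obtain \<delta> where \<delta>: "\<delta> > 0" "\<And>Z. Z \<in> ball 0 \<delta> \<Longrightarrow> cmod (G Z - QQ I Z) \<le> (1 / 100) * (norm Z)\<^sup>2"
    using small[of "1 / 100"] by auto
  define \<delta>' where "\<delta>' = min \<delta> \<delta>0 / 20"
  have \<delta>': "\<delta>' > 0" "20 * \<delta>' \<le> \<delta>" "20 * \<delta>' \<le> \<delta>0" using \<delta> pos by (auto simp: \<delta>'_def)
  have pair: "norm (z, cj z) < \<delta>0" if "norm z < 10 * \<delta>'" for z :: "complex^'n"
    using norm_Pair_cj[of z] that \<delta>' by simp
  have "Re (quad I z) = 0" if z: "norm z < \<delta>'" and G0: "G (z, cj z) = 0" for z
  proof (rule ccontr)
    assume nz: "Re (quad I z) \<noteq> 0"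
    \<comment> \<open>Projecting changes neither G nor q, and bounds the size of the point by N = X
      + Y, free of the coordinates outside I.\<close>
    define p where "p = proj I z"
    define x where "x = (\<chi> i. complex_of_real (Re (p $ i)))"
    define y where "y = (\<chi> i. complex_of_real (Im (p $ i)))"
    define X where "X = norm x"
    define Y where "Y = norm y"
    have p: "p = x + J y"
      by (simp add: vec_eq_iff x_def y_def J_vec_def J_complex_def complex_eq_iff)
    have np: "norm p \<le> norm z" unfolding p_def by (rule norm_proj)
    have Xp: "X \<le> norm p" "Y \<le> norm p"
      unfolding X_def Y_def x_def y_def norm_vec_def
      by (intro L2_set_mono; simp add: abs_Re_le_cmod abs_Im_le_cmod)+
    have X2: "X\<^sup>2 = (\<Sum>i\<in>I. (Re (p $ i))\<^sup>2)" "Y\<^sup>2 = (\<Sum>i\<in>I. (Im (p $ i))\<^sup>2)"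
    proof -
      have "X\<^sup>2 = (\<Sum>i\<in>UNIV. (Re (p $ i))\<^sup>2)" "Y\<^sup>2 = (\<Sum>i\<in>UNIV. (Im (p $ i))\<^sup>2)"
        by (simp_all add: X_def Y_def x_def y_def norm_vec_def L2_set_def sum_nonneg)
      then show "X\<^sup>2 = (\<Sum>i\<in>I. (Re (p $ i))\<^sup>2)" "Y\<^sup>2 = (\<Sum>i\<in>I. (Im (p $ i))\<^sup>2)"
        by (simp_all, intro sum.mono_neutral_right; simp add: p_def proj_def)+
    qed
    have Rq: "Re (quad I (k *\<^sub>R x + J y)) = k\<^sup>2 * X\<^sup>2 - Y\<^sup>2" for k
      unfolding X2 quad_def sum_distrib_left
      by (simp add: x_def y_def J_vec_def J_complex_def power2_eq_square sum_subtractf[symmetric] algebra_simps)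
    have Rp: "Re (quad I p) = X\<^sup>2 - Y\<^sup>2" using Rq[of 1] p by simp
    have XY: "X \<noteq> Y" using nz Rp by (auto simp: p_def)
    have XY0: "X \<ge> 0" "Y \<ge> 0" by (simp_all add: X_def Y_def)
    define N where "N = X + Y"
    have N: "N > 0" "N \<le> 2 * norm z" using XY XY0 Xp np by (auto simp: N_def)
    obtain z' where z': "norm (p - z') = \<bar>X - Y\<bar>" "Re (quad I z') = 0" "norm z' \<le> 2 * N"
    proof (cases "X = 0")
      case True
      show ?thesis
      proof (rule that[of 0])
        have "x = 0" using True by (simp add: X_def)
        then show "norm (p - 0) = \<bar>X - Y\<bar>" using True XY0 by (simp add: p Y_def)
      qed (use N in \<open>simp_all add: quad_def\<close>)
    next
      case False
      let ?z = "(Y / X) *\<^sub>R x + J y"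
      show ?thesis
      proof (rule that[of ?z])
        have "p - ?z = (1 - Y / X) *\<^sub>R x" by (simp add: p scaleR_diff_left)
        then have "norm (p - ?z) = \<bar>1 - Y / X\<bar> * \<bar>X\<bar>" by (simp add: X_def)
        also have "\<dots> = \<bar>X - Y\<bar>" unfolding abs_mult[symmetric] using False by (simp add: left_diff_distrib)
        finally show "norm (p - ?z) = \<bar>X - Y\<bar>" .
        show "Re (quad I ?z) = 0" using False by (simp only: Rq) (simp add: power_divide)
        have "norm ?z \<le> Y / X * X + Y"
          using norm_triangle_ineq[of "(Y / X) *\<^sub>R x" "J y"] XY0 by (simp add: X_def[symmetric] Y_def[symmetric])
        then show "norm ?z \<le> 2 * N" using False XY0 by (simp add: N_def)
      qed
    qed
    let ?Z = "(p, cj p)" and ?Z' = "(z', cj z')"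
    have pN: "norm p \<le> N"
      using norm_triangle_ineq[of x "J y"] by (simp add: p N_def X_def Y_def)
    have in_T: "?Z \<in> ball 0 (5 * N)" "?Z' \<in> ball 0 (5 * N)"
      using norm_Pair_cj[of p] norm_Pair_cj[of z'] pN z'(3) N(1) by simp_all
    have N10: "10 * N < \<delta>" "10 * N < \<delta>0" using N z \<delta>' by auto
    have GZ: "G ?Z = 0" using inv[of z] pair[of z] z G0 \<delta>' by (simp add: p_def)
    have GZ': "G ?Z' = 0"
      by (rule G_real[OF _ z'(2)]) (use in_T N10 N in simp)
    \<comment> \<open>On the ball of radius 10 N the difference G - QQ is at most N^2, so its
      Lipschitz constant on half that ball is 2 N / 5. The points are at most 2 |X - Y| apart,
      giving 4/5 N |X - Y|, whereas QQ itself changes by N |X - Y|.\<close>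
    have "cmod ((G ?Z - QQ I ?Z) - (G ?Z' - QQ I ?Z')) \<le> 2 * N\<^sup>2 / (5 * N) * norm (?Z - ?Z')"
    proof (rule holo_lipschitz[where S = "ball 0 (10 * N)" and T = "ball 0 (5 * N)" and f = "\<lambda>Z. G Z - QQ I Z"])
      show "holo (\<lambda>Z. G Z - QQ I Z) (ball 0 (10 * N))"
        by (intro holo_diff holo_QQ holo_subset[OF hol]) (use N10 in auto)
      show "ball x (5 * N) \<subseteq> ball 0 (10 * N)" if "x \<in> ball 0 (5 * N)" for x :: "(complex^'n) \<times> (complex^'n)"
      proof
        fix u assume "u \<in> ball x (5 * N)"
        then show "u \<in> ball 0 (10 * N)" using that dist_triangle[of 0 u x] by simp
      qed
      show "cmod (G u - QQ I u) \<le> N\<^sup>2" if "u \<in> ball 0 (10 * N)" for u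
      proof -
        have "cmod (G u - QQ I u) \<le> (1 / 100) * (norm u)\<^sup>2" using \<delta>(2)[of u] that N10 by simp
        also have "\<dots> \<le> (1 / 100) * (10 * N)\<^sup>2" using that by (intro mult_left_mono power_mono) auto
        finally show ?thesis by (simp add: power_mult_distrib)
      qed
    qed (use N in_T in auto)
    also have "\<dots> = 2 / 5 * N * norm (?Z - ?Z')" using N by (simp add: power2_eq_square)
    also have "\<dots> \<le> 2 / 5 * N * (2 * \<bar>X - Y\<bar>)"
      using norm_Pair_cj[of "p - z'"] z'(1) N by (intro mult_left_mono) (simp_all add: cj_diff)
    finally have "cmod (QQ I ?Z - QQ I ?Z') \<le> 2 / 5 * N * (2 * \<bar>X - Y\<bar>)"
      using GZ GZ' by (simp add: norm_minus_commute)
    moreover have "QQ I ?Z - QQ I ?Z' = complex_of_real (N * (X - Y))"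
      using Rp z'(2) by (simp add: QQ_def complex_eq_iff N_def power2_eq_square algebra_simps)
    moreover have "cmod (complex_of_real (N * (X - Y))) = N * \<bar>X - Y\<bar>"
      unfolding norm_of_real using N by (simp add: abs_mult)
    ultimately have "N * \<bar>X - Y\<bar> * (1 - 4 / 5) \<le> 0" by simp
    moreover have "N * \<bar>X - Y\<bar> > 0" using N XY by simp
    ultimately show False by simp
  qed
  moreover have "G (z, cj z) = 0" if "norm z < \<delta>'" "Re (quad I z) = 0" for z
    by (rule G_real[OF pair that(2)]) (use that \<delta>' in auto)
  ultimately show ?thesis
    unfolding eventually_nhds_metric using \<delta>' by (intro exI[of _ \<delta>']) (auto simp: dist_norm)
qed

end

section \<open>The normal form after rescaling\<close>

lemma tangent_to_identity:
  fixes g :: "'a::real_normed_vector \<Rightarrow> 'a"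
  assumes "(g has_derivative (\<lambda>v. v)) (at 0)" "g 0 = 0" "e > 0"
  obtains d where "d > 0" "\<And>y. norm y < d \<Longrightarrow> norm (g y - y) \<le> e * norm y"
  using assms unfolding has_derivative_at_alt by (auto elim!: allE[of _ e])

context core
begin

text \<open>The change of coordinates is the inverse g of the Morse coordinates S of the first
  integral, so f (g x) = q x. Transforming F by g, complexified, gives a function G satisfying
  \<open>rigidity\<close>, and its \<open>zero_set\<close> is the claim.\<close>

lemma normal_form:
  "\<exists>\<Phi> \<Psi> U V. open U \<and> open V \<and> 0 \<in> U \<and> 0 \<in> V \<and> homeomorphism U V \<Phi> \<Psi> \<and> holo \<Phi> U \<and> holo \<Psi> V \<and>
     \<Phi> 0 = 0 \<and> fd \<Phi> 0 = (\<lambda>v. v) \<and>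
     (\<forall>\<^sub>F z in nhds 0. F (\<Phi> z, cj (\<Phi> z)) = 0 \<longleftrightarrow> Re (quad I z) = 0)"
proof -
  obtain f C where f: "holo f (ball 0 1)" "\<forall>z\<in>ball 0 1. f (proj I z) = f z"
    "\<forall>v. norm v \<le> 1 / 2 \<longrightarrow> cmod (f v - quad I v) \<le> C * norm v ^ 3"
    and rel: "\<forall>r\<in>D. \<forall>Z\<in>ball Z0 (1 / 100). F (r *\<^sub>C Z) = 0 \<longrightarrow> f (r *\<^sub>C fst Z) + cnj (f (cj (r *\<^sub>C snd Z))) = 0"
    using first_integral by (elim exE conjE)
  obtain r S where r: "r > 0" "r \<le> 1 / 2" and S: "holo S (ball 0 r)" "S 0 = 0" "fd S 0 = (\<lambda>v. v)"
    and fS: "\<And>z. z \<in> ball 0 r \<Longrightarrow> f z = quad I (S z)"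
    and projS: "\<And>z. z \<in> ball 0 r \<Longrightarrow> proj I (S z) = S (proj I z)"
  proof (rule morse_coordinates[of f "1 / 2" I C])
    show "holo f (ball 0 (1 / 2))" by (rule holo_subset[OF f(1)]) auto
    show "f (proj I z) = f z" if "z \<in> ball 0 (1 / 2)" for z using f(2) that by simp
    show "cmod (f v - quad I v) \<le> C * norm v ^ 3" if "v \<in> ball 0 (1 / 2)" for v using f(3) that by simp
  qed auto
  obtain U V g where UV: "open U" "U \<subseteq> ball 0 r" "0 \<in> U" "open V" "S 0 \<in> V" "homeomorphism U V S g"
    and g: "holo g V" "fd g (S 0) = (\<lambda>v. v)"
    by (rule holo_inverse_function[OF open_ball _ S(1) holo_fd_vec[OF open_ball S(1)] S(3)]) (use r in auto)
  have V0: "0 \<in> V" using UV(5) S(2) by simp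
  have gS: "g (S z) = z" if "z \<in> U" for z using UV(6) that by (simp add: homeomorphism_def)
  have Sg: "S (g z) = z" "g z \<in> U" if "z \<in> V" for z using UV(6) that by (auto simp: homeomorphism_def)
  have g0: "g 0 = 0" using gS[OF UV(3)] S(2) by simp
  have dg: "(g has_derivative (\<lambda>v. v)) (at 0)"
    using holo_has_derivative[OF g(1) V0] g(2) S(2) by simp
  obtain \<rho> where \<rho>: "\<rho> > 0" "ball 0 \<rho> \<subseteq> U" using UV(1,3) openE by blast
  obtain d1 where d1: "d1 > 0" "\<And>y. norm y < d1 \<Longrightarrow> norm (g y - y) \<le> 1 * norm y"
    using tangent_to_identity[OF dg g0, of 1] by auto
  obtain d2 where d2: "d2 > 0" "ball 0 d2 \<subseteq> V" using UV(4) V0 openE by blast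
  define \<delta> where "\<delta> = min (min d1 d2) (min \<rho> 1) / 4"
  have \<delta>: "\<delta> > 0" "\<delta> \<le> 1" using d1 d2 \<rho> by (auto simp: \<delta>_def)
  have near: "z \<in> V" "norm (g z) \<le> 2 * norm z" "g z \<in> ball 0 \<rho>" "proj I (g z) = g (proj I z)" if z: "norm z < \<delta>" for z
  proof -
    show zV: "z \<in> V" using z d2 \<delta> by (auto simp: \<delta>_def)
    have "4 * norm z < d1" using z by (simp add: \<delta>_def)
    then have "norm z < d1" by (rule order_le_less_trans[rotated]) simp
    then show n: "norm (g z) \<le> 2 * norm z"
      using d1(2)[of z] norm_triangle_ineq[of "g z - z" z] by simp
    then show in_ball: "g z \<in> ball 0 \<rho>" using z \<delta> by (auto simp: \<delta>_def)
    then have "proj I (g z) \<in> U" using proj_in_ball \<rho>(2) by blast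
    then have "g (S (proj I (g z))) = proj I (g z)" by (rule gS)
    moreover have "S (proj I (g z)) = proj I z"
      using projS[of "g z"] Sg[OF zV] UV(2) by auto
    ultimately show "proj I (g z) = g (proj I z)" by simp
  qed
  \<comment> \<open>The complexification of g: it is holomorphic in both blocks and sends (z, cj z)
    to (g z, cj (g z)).\<close>
  define K where "K Z = (g (fst Z), cj (g (cj (snd Z))))" for Z
  define G where "G Z = F (K Z)" for Z
  have K_near: "norm (fst Z) < \<delta>" "norm (snd Z) < \<delta>" if "Z \<in> ball 0 \<delta>" for Z :: "(complex^'n) \<times> (complex^'n)"
    using norm_fst_snd[of Z] that by auto
  have K_in: "K Z \<in> ball 0 100" if Z: "Z \<in> ball 0 \<delta>" for Z
    using norm_Pair_le[of "g (fst Z)" "cj (g (cj (snd Z)))"] near(2)[OF K_near(1)[OF Z]] near(2)[of "cj (snd Z)"]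
      K_near[OF Z] \<delta> by (simp add: K_def)
  have K_hol: "holo K (ball 0 \<delta>)"
    unfolding K_def
  proof (intro holo_Pair)
    have gb: "holo g (ball 0 \<delta>)" by (rule holo_subset[OF g(1)]) (use near(1) in auto)
    show "holo (\<lambda>Z. g (fst Z)) (ball (0 :: (complex^'n) \<times> (complex^'n)) \<delta>)"
      by (intro holo_compose[OF gb] holo_fst holo_id) (use K_near(1) in simp)
    have "holo (\<lambda>w. cj (g (cj w))) (ball 0 \<delta>)"
    proof (rule holo_vec)
      fix i
      have "holo (\<lambda>w. cnj ((\<lambda>z. g z $ i) (cj w))) (ball 0 \<delta>)"
        by (rule holo_conj[OF holo_nth[OF gb]]) simp
      then show "holo (\<lambda>w. cj (g (cj w)) $ i) (ball 0 \<delta>)" by simp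
    qed
    then show "holo (\<lambda>Z. cj (g (cj (snd Z)))) (ball (0 :: (complex^'n) \<times> (complex^'n)) \<delta>)"
      by (rule holo_compose) (intro holo_snd holo_id, use K_near(2) in simp)
  qed
  have K_close: "\<exists>d>0. \<forall>Z. norm Z < d \<longrightarrow> norm (K Z - Z) \<le> e * norm Z" if e: "e > 0" for e
  proof -
    obtain d where d: "d > 0" "\<And>y. norm y < d \<Longrightarrow> norm (g y - y) \<le> (e / 2) * norm y"
      using tangent_to_identity[OF dg g0, of "e / 2"] e by auto
    have "norm (K Z - Z) \<le> e * norm Z" if "norm Z < d" for Z
    proof -
      have Z: "norm (fst Z) < d" "norm (cj (snd Z)) < d" using norm_fst_snd[of Z] that by auto
      have "K Z - Z = (g (fst Z) - fst Z, cj (g (cj (snd Z)) - cj (snd Z)))"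
        by (simp add: K_def prod_eq_iff cj_diff)
      then have "norm (K Z - Z) \<le> norm (g (fst Z) - fst Z) + norm (g (cj (snd Z)) - cj (snd Z))"
        using norm_Pair_le[of "g (fst Z) - fst Z" "cj (g (cj (snd Z)) - cj (snd Z))"] by simp
      also have "\<dots> \<le> e / 2 * norm (fst Z) + e / 2 * norm (cj (snd Z))" by (intro add_mono d Z)
      also have "\<dots> \<le> e / 2 * norm Z + e / 2 * norm Z"
        using e norm_fst_snd[of Z] by (intro add_mono mult_left_mono) auto
      finally show ?thesis by simp
    qed
    then show ?thesis using d(1) by blast
  qed
  obtain d3 where d3: "d3 > 0" "\<forall>Z. norm Z < d3 \<longrightarrow> norm (K Z - Z) \<le> (1 / 1000) * norm Z"
    using K_close[of "1 / 1000"] by auto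
  interpret rigidity G I a b \<delta> "1 / 200" "min (min \<delta> d3 / 3) 1"
  proof unfold_locales
    show "holo G (ball 0 \<delta>)" unfolding G_def by (rule holo_compose[OF hol K_hol K_in])
    show "\<exists>d>0. \<forall>Z\<in>ball 0 d. cmod (G Z - QQ I Z) \<le> \<epsilon> * (norm Z)\<^sup>2" if \<epsilon>: "\<epsilon> > 0" for \<epsilon>
    proof -
      define e where "e = min 1 (\<epsilon> / 8)"
      have e: "e > 0" "e \<le> 1" "8 * e \<le> \<epsilon>" using \<epsilon> by (auto simp: e_def)
      obtain d where d: "d > 0" "\<forall>Z. norm Z < d \<longrightarrow> norm (K Z - Z) \<le> e * norm Z"
        using K_close[OF e(1)] by auto
      define d' where "d' = min (min d \<delta>) (\<epsilon> / 2)"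
      have "cmod (G Z - QQ I Z) \<le> \<epsilon> * (norm Z)\<^sup>2" if "Z \<in> ball 0 d'" for Z
      proof -
        have Z: "norm Z < d" "Z \<in> ball 0 \<delta>" "norm Z \<le> \<epsilon> / 2" using that by (auto simp: d'_def)
        define \<Delta> where "\<Delta> = K Z - Z"
        have \<Delta>: "norm \<Delta> \<le> e * norm Z" unfolding \<Delta>_def by (rule d(2)[rule_format, OF Z(1)])
        have "e * norm Z \<le> 1 * norm Z" using e by (intro mult_right_mono) auto
        then have KZ: "norm (K Z) \<le> 2 * norm Z"
          using \<Delta> norm_triangle_ineq[of Z \<Delta>] by (simp add: \<Delta>_def)
        have "QQ I (K Z) - QQ I Z = (dot I (fst Z) (fst \<Delta>) + dot I (snd Z) (snd \<Delta>)) + QQ I \<Delta>"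
          using QQ_add[of I Z \<Delta>] by (simp add: \<Delta>_def)
        then have "cmod (QQ I (K Z) - QQ I Z) \<le> norm Z * norm \<Delta> + (norm \<Delta>)\<^sup>2 / 2"
          using norm_triangle_mono[OF cmod_dot_pair[of I Z \<Delta>] cmod_QQ[of I \<Delta>]] by simp
        also have "\<dots> \<le> norm Z * (e * norm Z) + (e * norm Z) * (1 * norm Z) / 2"
          unfolding power2_eq_square using \<Delta> e by (intro add_mono mult_left_mono divide_right_mono mult_mono order_trans[OF \<Delta>] mult_right_mono) auto
        also have "\<dots> \<le> 2 * e * (norm Z)\<^sup>2" using e by (simp add: power2_eq_square)
        finally have 1: "cmod (QQ I (K Z) - QQ I Z) \<le> 2 * e * (norm Z)\<^sup>2" .
        have "cmod (F (K Z) - QQ I (K Z)) \<le> \<eta> * norm (K Z) ^ 3" by (rule est[OF K_in[OF Z(2)]])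
        also have "\<dots> \<le> (1 / 10 ^ 11) * (2 * norm Z) ^ 3" using \<eta> KZ by (intro mult_mono power_mono) auto
        also have "\<dots> \<le> norm Z * (norm Z)\<^sup>2" by (simp add: power_mult_distrib power3_eq_cube power2_eq_square)
        also have "\<dots> \<le> \<epsilon> / 2 * (norm Z)\<^sup>2" using Z(3) by (intro mult_right_mono) auto
        finally have 2: "cmod (F (K Z) - QQ I (K Z)) \<le> \<epsilon> / 2 * (norm Z)\<^sup>2" .
        have "cmod (G Z - QQ I Z) \<le> \<epsilon> / 2 * (norm Z)\<^sup>2 + 2 * e * (norm Z)\<^sup>2"
          using norm_triangle_mono[OF 2 1] by (simp add: G_def)
        also have "\<dots> \<le> \<epsilon> / 2 * (norm Z)\<^sup>2 + \<epsilon> / 2 * (norm Z)\<^sup>2"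
          using e by (intro add_mono mult_right_mono) auto
        finally show ?thesis by simp
      qed
      moreover have "d' > 0" using d \<delta> \<epsilon> by (simp add: d'_def)
      ultimately show ?thesis by blast
    qed
    show "QQ I Z = 0" if s: "0 < s" "s < min (min \<delta> d3 / 3) 1" and Z: "Z \<in> ball (n2, n1) (1 / 200)"
      and G0: "G (complex_of_real s *\<^sub>C Z) = 0" for s Z
    proof -
      let ?s = "complex_of_real s"
      have dZ: "norm (Z - Z0) < 1 / 200" using Z by (simp add: Z0_def dist_norm norm_minus_commute)
      have nZ: "norm Z \<le> 3 / 2" using norm_triangle_ineq2[of Z Z0] dZ norm_Z0 by simp
      have "s * norm Z \<le> s * (3 / 2)" using nZ s by (intro mult_left_mono) auto
      also have "\<dots> < min \<delta> d3" using s by auto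
      finally have sZ: "norm (?s *\<^sub>C Z) < \<delta>" "norm (?s *\<^sub>C Z) < d3" using s by auto
      \<comment> \<open>As g is tangent to the identity, W differs from Z by at most norm Z / 1000.
        With Z within 1/200 of Z0 this leaves W within the 1/100 where the relation is
        available.\<close>
      define W where "W = (1 / ?s) *\<^sub>C K (?s *\<^sub>C Z)"
      have sW: "?s *\<^sub>C W = K (?s *\<^sub>C Z)" using s by (simp add: W_def)
      have "W - Z = (1 / ?s) *\<^sub>C (K (?s *\<^sub>C Z) - ?s *\<^sub>C Z)" using s by (simp add: W_def cscale_diff_right)
      then have "norm (W - Z) = norm (K (?s *\<^sub>C Z) - ?s *\<^sub>C Z) / s" using s by (simp add: norm_divide)
      also have "\<dots> \<le> (1 / 1000) * norm (?s *\<^sub>C Z) / s" using d3(2)[rule_format, OF sZ(2)] s by (intro divide_right_mono) auto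
      also have "\<dots> = (1 / 1000) * norm Z" using s by simp
      also have "\<dots> \<le> (1 / 1000) * (3 / 2)" using nZ by (intro mult_left_mono) auto
      finally have "norm (W - Z0) < 1 / 100" using norm_triangle_ineq[of "W - Z" "Z - Z0"] dZ by simp
      then have W: "W \<in> ball Z0 (1 / 100)" by (simp add: dist_norm norm_minus_commute)
      have sD: "?s \<in> D" using s by (intro D_real) auto
      have "F (?s *\<^sub>C W) = 0" using G0 by (simp only: G_def sW)
      then have "f (?s *\<^sub>C fst W) + cnj (f (cj (?s *\<^sub>C snd W))) = 0" using rel sD W by blast
      moreover have "?s *\<^sub>C fst W = g (?s *\<^sub>C fst Z)" "cj (?s *\<^sub>C snd W) = g (cj (?s *\<^sub>C snd Z))"
        using sW by (simp_all add: K_def prod_eq_iff)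
      moreover have "f (g x) = quad I x" if "norm x < \<delta>" for x
        using fS[of "g x"] Sg[OF near(1)[OF that]] UV(2) by auto
      moreover have "norm (?s *\<^sub>C fst Z) < \<delta>" "norm (cj (?s *\<^sub>C snd Z)) < \<delta>"
        using sZ(1) norm_fst_snd[of "?s *\<^sub>C Z"] by auto
      ultimately have "quad I (?s *\<^sub>C fst Z) + quad I (?s *\<^sub>C snd Z) = 0" by simp
      then have "?s\<^sup>2 * QQ I Z = 0" unfolding QQ_def quad_scale by (simp add: algebra_simps add_divide_distrib[symmetric])
      then show ?thesis using s by simp
    qed
    show "G (proj I z, cj (proj I z)) = G (z, cj z)" if z: "(z, cj z) \<in> ball 0 \<delta>" for z
    proof -
      have "norm z < \<delta>" using norm_fst_snd(1)[of "(z, cj z)"] z by simp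
      then have "G (proj I z, cj (proj I z)) = F (proj I (g z), proj I (cj (g z)))"
        using near(4) by (simp add: G_def K_def proj_cj)
      also have "\<dots> = F (g z, cj (g z))"
        by (rule inv) (use K_in[OF z] in \<open>simp add: K_def\<close>)
      finally show ?thesis by (simp add: G_def K_def)
    qed
  qed (use \<delta> d3 in auto)
  have "\<forall>\<^sub>F z in nhds 0. F (g z, cj (g z)) = 0 \<longleftrightarrow> Re (quad I z) = 0"
    using zero_set by (simp add: G_def K_def)
  moreover have "homeomorphism V U g S" using UV(6) homeomorphism_sym by blast
  moreover have "holo S U" by (rule holo_subset[OF S(1) UV(2)])
  moreover have "fd g 0 = (\<lambda>v. v)" using g(2) S(2) by simp
  ultimately show ?thesis using UV(1,3,4) V0 g(1) g0 by blast
qed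

end

section \<open>Complexification\<close>

definition \<iota> :: "complex^'n \<Rightarrow> (complex^'n) \<times> (complex^'n)"
  where "\<iota> z = (z, cj z)"

lemma bounded_linear_\<iota>: "bounded_linear \<iota>"
  unfolding \<iota>_def by (intro bounded_linear_Pair bounded_linear_ident bounded_linear_cj)

lemma norm_\<iota>: "norm (\<iota> z) \<le> 2 * norm z"
  unfolding \<iota>_def by (rule norm_Pair_cj)

lemma sw_fixed: "sw Z = Z \<Longrightarrow> Z = \<iota> (fst Z)"
  by (cases Z) (auto simp: sw_def \<iota>_def)

lemma QQ_\<iota>: "QQ I (\<iota> z) = complex_of_real (Re (quad I z))"
  by (simp add: QQ_def \<iota>_def complex_eq_iff)

text \<open>Replace the conjugate variables of the power series by independent ones. Absolute
  convergence at one real point with all coordinates equal to \<rho> dominates every term on the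
  ball of radius \<rho>.\<close>

lemma real_analytic_complexification:
  fixes f :: "complex^'n \<Rightarrow> complex"
  assumes "real_analytic_at f 0"
  obtains \<rho> Fc where "\<rho> > 0" "holo Fc (ball 0 \<rho>)" "\<And>z. norm z < \<rho> \<Longrightarrow> Fc (\<iota> z) = f z"
proof -
  obtain r a where r: "r > 0" and "\<forall>z\<in>ball 0 r.
      ((\<lambda>(\<alpha>, \<beta>). a \<alpha> \<beta> * (\<Prod>i\<in>UNIV. (z $ i) ^ \<alpha> i) * (\<Prod>i\<in>UNIV. cnj (z $ i) ^ \<beta> i)) has_sum f z) UNIV"
    using assms unfolding real_analytic_at_def zero_index diff_zero by blast
  note sum = this(2)[rule_format]
  \<comment> \<open>The point with all coordinates \<rho> has norm at most N * \<rho> = r / 2, where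
    N is the dimension, so it lies in the given ball of convergence.\<close>
  define \<rho> where "\<rho> = r / (2 * real CARD('n))"
  have N: "real CARD('n) \<ge> 1" using zero_less_card_finite[where 'a='n] by linarith
  have "1 \<le> 2 * real CARD('n)" using N by linarith
  then have \<rho>: "\<rho> > 0" "\<rho> \<le> r" using r mult_left_mono[of 1 "2 * real CARD('n)" r] by (simp_all add: \<rho>_def divide_le_eq)
  define trm where "trm p Z = (case p of (\<alpha>, \<beta>) \<Rightarrow> a \<alpha> \<beta> * (\<Prod>i\<in>UNIV. (fst Z $ i) ^ \<alpha> i) * (\<Prod>i\<in>UNIV. (snd Z $ i) ^ \<beta> i))"
    for p :: "('n \<Rightarrow> nat) \<times> ('n \<Rightarrow> nat)" and Z :: "(complex^'n) \<times> (complex^'n)"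
  have trm_\<iota>: "(\<lambda>p. trm p (\<iota> z)) = (\<lambda>(\<alpha>, \<beta>). a \<alpha> \<beta> * (\<Prod>i\<in>UNIV. (z $ i) ^ \<alpha> i) * (\<Prod>i\<in>UNIV. cnj (z $ i) ^ \<beta> i))" for z
    by (auto simp: fun_eq_iff trm_def \<iota>_def)
  define z0 :: "complex^'n" where "z0 = (\<chi> i. complex_of_real \<rho>)"
  have "norm z0 \<le> (\<Sum>i\<in>UNIV. cmod (z0 $ i))" unfolding norm_vec_def by (rule L2_set_le_sum) simp
  also have "\<dots> = real CARD('n) * \<rho>" using \<rho>(1) by (simp add: z0_def)
  also have "\<dots> < r" using r N by (simp add: \<rho>_def)
  finally have "z0 \<in> ball 0 r" by simp
  from has_sum_imp_summable[OF sum[OF this]]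
  have "(\<lambda>p. trm p (\<iota> z0)) summable_on UNIV" by (simp only: trm_\<iota>)
  then have M: "(\<lambda>p. cmod (trm p (\<iota> z0))) summable_on UNIV"
    by (rule summable_on_iff_abs_summable_on_complex[THEN iffD1])
  let ?B = "ball (0 :: (complex^'n) \<times> (complex^'n)) \<rho>"
  have le: "cmod (trm p Z) \<le> cmod (trm p (\<iota> z0))" if "Z \<in> ?B" for p Z
  proof -
    have Z: "cmod (fst Z $ i) \<le> \<rho>" "cmod (snd Z $ i) \<le> \<rho>" for i
      using norm_fst_snd[of Z] Finite_Cartesian_Product.norm_nth_le[of "fst Z" i] Finite_Cartesian_Product.norm_nth_le[of "snd Z" i] that
      by (auto intro: order_trans)
    obtain \<alpha> \<beta> where p: "p = (\<alpha>, \<beta>)" by (cases p)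
    have trm_eq: "trm p W = a \<alpha> \<beta> * (\<Prod>i\<in>UNIV. (fst W $ i) ^ \<alpha> i) * (\<Prod>i\<in>UNIV. (snd W $ i) ^ \<beta> i)" for W
      unfolding trm_def p by simp
    have "cmod (trm p Z) = cmod (a \<alpha> \<beta>) * (\<Prod>i\<in>UNIV. cmod (fst Z $ i) ^ \<alpha> i) * (\<Prod>i\<in>UNIV. cmod (snd Z $ i) ^ \<beta> i)"
      unfolding trm_eq norm_mult prod_norm[symmetric] norm_power ..
    also have "\<dots> \<le> cmod (a \<alpha> \<beta>) * (\<Prod>i\<in>UNIV. \<rho> ^ \<alpha> i) * (\<Prod>i\<in>UNIV. \<rho> ^ \<beta> i)"
      using \<rho> by (intro mult_mono prod_mono conjI power_mono Z prod_nonneg mult_nonneg_nonneg) auto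
    also have "\<dots> = cmod (trm p (\<iota> z0))"
      using \<rho> unfolding trm_eq norm_mult prod_norm[symmetric] norm_power by (simp add: \<iota>_def z0_def)
    finally show ?thesis .
  qed
  define Fc where "Fc Z = (\<Sum>\<^sub>\<infinity>p. trm p Z)" for Z
  have lim: "uniform_limit ?B (\<lambda>X Z. \<Sum>p\<in>X. trm p Z) Fc (finite_subsets_at_top UNIV)"
    unfolding Fc_def by (rule Weierstrass_m_test_general[OF _ M]) (rule le)
  \<comment> \<open>The M-test converges along the net of finite index sets. A sequence of finite
    partial sums is extracted, as \<open>holo_uniform_limit\<close> is about sequences.\<close>
  have "\<exists>X. \<forall>Z\<in>?B. dist (\<Sum>p\<in>X. trm p Z) (Fc Z) < 1 / real (Suc k)" for k
    using eventually_happens'[OF finite_subsets_at_top_neq_bot uniform_limitD[OF lim, of "1 / real (Suc k)"]] by auto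
  then obtain X where X: "\<And>k Z. Z \<in> ?B \<Longrightarrow> dist (\<Sum>p\<in>X k. trm p Z) (Fc Z) < 1 / real (Suc k)"
    by metis
  have trm_hol: "holo (trm p) S" for p S
    by (cases p) (simp add: trm_def[abs_def] holo_mult holo_prod holo_power holo_nth holo_fst holo_snd holo_id holo_const)
  have "holo Fc ?B"
  proof (rule holo_uniform_limit[OF open_ball])
    show "holo (\<lambda>Z. \<Sum>p\<in>X k. trm p Z) ?B" for k by (intro holo_sum trm_hol)
    show "uniform_limit ?B (\<lambda>k Z. \<Sum>p\<in>X k. trm p Z) Fc sequentially"
    proof (rule uniform_limitI)
      fix e :: real assume "e > 0"
      then have "\<forall>\<^sub>F k in sequentially. 1 / real (Suc k) < e"
        using LIMSEQ_Suc[OF lim_1_over_n] order_tendstoD(2) by fastforce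
      then show "\<forall>\<^sub>F k in sequentially. \<forall>Z\<in>?B. dist (\<Sum>p\<in>X k. trm p Z) (Fc Z) < e"
        by eventually_elim (use X order_less_trans in blast)
    qed
  qed
  moreover have "Fc (\<iota> z) = f z" if "norm z < \<rho>" for z
  proof -
    have "((\<lambda>p. trm p (\<iota> z)) has_sum f z) UNIV"
      using sum[of z] that \<rho> by (simp add: trm_\<iota>)
    then show ?thesis unfolding Fc_def by (rule infsumI)
  qed
  ultimately show ?thesis using that \<rho> by blast
qed

lemma holo_sw:
  assumes f: "holo f S" and T: "\<And>Z. Z \<in> T \<Longrightarrow> sw Z \<in> S"
  shows "holo (\<lambda>Z. cnj (f (sw Z))) T"
proof (rule holoI)
  fix Z assume Z: "Z \<in> T"
  have "(sw has_derivative sw) (at Z)"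
    by (rule bounded_linear_imp_has_derivative[OF bounded_linear_sw])
  from has_derivative_cnj[OF has_derivative_compose[OF this holo_has_derivative[OF f T[OF Z]]]]
  show d: "((\<lambda>Z. cnj (f (sw Z))) has_derivative (\<lambda>V. cnj (fd f (sw Z) (sw V)))) (at Z)" .
  have "sw (J V) = - J (sw V)" for V :: "(complex^'a) \<times> (complex^'a)"
    using sw_cscale[of \<i> V] by (simp add: cscale_ii)
  then show "clinear (\<lambda>V. cnj (fd f (sw Z) (sw V)))"
    unfolding clinear_def
    using has_derivative_linear[OF d] holo_fd_minus[OF f T[OF Z]] holo_fd_J[OF f T[OF Z]]
    by (auto simp: J_complex_def)
qed

text \<open>Dividing by s and letting s tend to 0 gives l = 0; dividing by s^2 then gives m =
  0.\<close>

lemma quadratic_zero: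
  fixes l m :: complex
  assumes s0: "s0 > 0" and K: "\<And>s. 0 < s \<Longrightarrow> s < s0 \<Longrightarrow> cmod (complex_of_real s * l + (complex_of_real s)\<^sup>2 * m) \<le> K * s ^ 3"
  shows "l = 0" "m = 0"
proof -
  have near: "\<forall>\<^sub>F s in at_right 0. s \<in> {0<..<s0}" using s0 by (intro eventually_at_right_real)
  have zero: "((\<lambda>s::real. c * s) \<longlongrightarrow> 0) (at_right 0)" for c :: real
    using tendsto_mult[OF tendsto_const[of c] tendsto_ident_at[of "0::real" "{0<..}"]] by simp
  have "((\<lambda>s::real. (cmod m + \<bar>K\<bar> * s0) * s) \<longlongrightarrow> 0) (at_right 0)" by (rule zero)
  moreover have "\<forall>\<^sub>F s in at_right 0. cmod l \<le> (cmod m + \<bar>K\<bar> * s0) * s"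
    using near
  proof eventually_elim
    case (elim s)
    then have s: "0 < s" "s < s0" by auto
    have "cmod (complex_of_real s * l) = cmod ((complex_of_real s * l + (complex_of_real s)\<^sup>2 * m) - (complex_of_real s)\<^sup>2 * m)" by simp
    also have "\<dots> \<le> cmod (complex_of_real s * l + (complex_of_real s)\<^sup>2 * m) + cmod ((complex_of_real s)\<^sup>2 * m)"
      by (rule norm_triangle_ineq4)
    also have "\<dots> \<le> K * s ^ 3 + cmod ((complex_of_real s)\<^sup>2 * m)"
      by (rule add_right_mono[OF K[OF s]])
    finally have "cmod (complex_of_real s * l) \<le> K * s ^ 3 + cmod ((complex_of_real s)\<^sup>2 * m)" .
    then have "s * cmod l \<le> K * s ^ 3 + s\<^sup>2 * cmod m" using s by (simp add: norm_mult norm_power)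
    also have "\<dots> \<le> \<bar>K\<bar> * (s0 * s\<^sup>2) + s\<^sup>2 * cmod m"
      using s by (intro add_right_mono mult_mono) (auto simp: power3_eq_cube power2_eq_square)
    also have "\<dots> = s * ((cmod m + \<bar>K\<bar> * s0) * s)" by (simp add: power2_eq_square algebra_simps)
    finally show ?case using s by simp
  qed
  ultimately have "cmod l \<le> 0" by (intro tendsto_lowerbound[of _ 0 "at_right (0::real)"]) auto
  then show l: "l = 0" by simp
  have "\<forall>\<^sub>F s in at_right 0. cmod m \<le> K * s"
    using near
  proof eventually_elim
    case (elim s)
    then have "s\<^sup>2 * cmod m \<le> s\<^sup>2 * (K * s)"
      using K[of s] by (simp add: l norm_mult norm_power power2_eq_square power3_eq_cube mult_ac)
    then show ?case using elim by simp
  qed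
  then have "cmod m \<le> 0" using zero[of K] by (intro tendsto_lowerbound[of _ 0 "at_right (0::real)"]) auto
  then show "m = 0" by simp
qed

text \<open>The cubic bound at real points kills the derivative and the diagonal second derivative
  at 0 on real vectors. Real vectors span over the complex numbers, so polarisation removes both
  entirely, and Taylor's formula yields a cubic bound in every complexified direction.\<close>

lemma cubic_of_real_cubic:
  fixes E :: "(complex^'n) \<times> (complex^'n) \<Rightarrow> complex"
  assumes E: "holo E (ball 0 \<rho>)" and \<rho>: "\<rho> > 0"
    and C: "\<And>z. norm z < \<rho> \<Longrightarrow> cmod (E (\<iota> z)) \<le> C * norm z ^ 3"
  obtains \<rho>' K where "\<rho>' > 0" "\<rho>' \<le> \<rho>" "\<And>Z. norm Z < \<rho>' \<Longrightarrow> cmod (E Z) \<le> K * norm Z ^ 3"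
proof -
  have 0: "0 \<in> ball (0 :: (complex^'n) \<times> (complex^'n)) \<rho>" using \<rho> by simp
  obtain r B where r: "r > 0" "ball 0 r \<subseteq> ball (0 :: (complex^'n) \<times> (complex^'n)) \<rho>"
    and B: "\<And>x. x \<in> ball 0 r \<Longrightarrow> cmod (E x) \<le> B"
    using holo_locally_bounded[OF open_ball E 0] by blast
  have Er: "holo E (ball 0 r)" by (rule holo_subset[OF E r(2)])
  have 0: "0 \<in> ball (0 :: (complex^'n) \<times> (complex^'n)) r" using r by simp
  define K where "K = 192 * B / r ^ 3"
  have T: "cmod (E v - E 0 - fd E 0 v - hess E 0 v v / 2) \<le> K * norm v ^ 3" if "norm v \<le> r / 2" for v
    unfolding K_def by (rule holo_taylor2[OF Er r(1) B that])
  have E0: "E 0 = 0" using C[of 0] \<rho> by (simp add: \<iota>_def zero_prod_def)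
  define b where "b = hess E 0"
  have bl: "clinear (\<lambda>u. b u v)" and br: "clinear (b u)" for u v
    unfolding b_def by (rule hess_clinear_left[OF open_ball Er 0] hess_clinear_right[OF open_ball Er 0])+
  have L: "clinear (fd E 0)" by (rule holo_clinear[OF Er 0])
  have real: "fd E 0 x = 0 \<and> b x x / 2 = 0" if x: "sw x = x" for x
  proof -
    obtain z where z: "x = \<iota> z" using sw_fixed[OF x] by blast
    define s0 where "s0 = min (r / 2) \<rho> / (norm x + norm z + 1)"
    have pos: "norm x + norm z + 1 > 0" by (simp add: add_nonneg_pos)
    have s0: "s0 > 0" using r \<rho> pos by (simp add: s0_def)
    have "cmod (complex_of_real s * fd E 0 x + (complex_of_real s)\<^sup>2 * (b x x / 2)) \<le> (\<bar>C\<bar> * norm z ^ 3 + K * norm x ^ 3) * s ^ 3"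
      if s: "0 < s" "s < s0" for s
    proof -
      have sM: "s * (norm x + norm z + 1) < min (r / 2) \<rho>" using s pos by (simp add: s0_def pos_less_divide_eq)
      have "s * norm x \<le> s * (norm x + norm z + 1)" "s * norm z \<le> s * (norm x + norm z + 1)"
        using s by (intro mult_left_mono; simp)+
      from this[THEN order.strict_trans1, OF sM]
      have n: "norm (s *\<^sub>R x) \<le> r / 2" "norm (s *\<^sub>R z) < \<rho>" using s by simp_all
      have "E (s *\<^sub>R x) = E (\<iota> (s *\<^sub>R z))"
        by (simp add: z linear_cmul[OF bounded_linear.linear[OF bounded_linear_\<iota>]])
      then have 1: "cmod (E (s *\<^sub>R x)) \<le> \<bar>C\<bar> * norm (s *\<^sub>R z) ^ 3"
        using C[OF n(2)] mult_right_mono[OF abs_ge_self[of C], of "norm (s *\<^sub>R z) ^ 3"] by simp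
      have "fd E 0 (s *\<^sub>R x) = complex_of_real s * fd E 0 x" "b (s *\<^sub>R x) (s *\<^sub>R x) = (complex_of_real s)\<^sup>2 * b x x"
        by (simp_all add: cscale_of_real[symmetric] clinear_cscale[OF L] clinear_cscale[OF br] clinear_cscale[OF bl] power2_eq_square)
      then have "cmod (complex_of_real s * fd E 0 x + (complex_of_real s)\<^sup>2 * (b x x / 2))
        = cmod (E (s *\<^sub>R x) - (E (s *\<^sub>R x) - E 0 - fd E 0 (s *\<^sub>R x) - hess E 0 (s *\<^sub>R x) (s *\<^sub>R x) / 2))"
        by (simp add: E0 b_def)
      also have "\<dots> \<le> \<bar>C\<bar> * norm (s *\<^sub>R z) ^ 3 + K * norm (s *\<^sub>R x) ^ 3"
        by (rule order_trans[OF norm_triangle_ineq4 add_mono[OF 1 T[OF n(1)]]])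
      finally show ?thesis using s by (simp add: power_mult_distrib algebra_simps)
    qed
    from quadratic_zero[OF s0 this] show ?thesis by blast
  qed
  have dec: "\<exists>x y. sw x = x \<and> sw y = y \<and> Z = x + J y" for Z :: "(complex^'n) \<times> (complex^'n)"
  proof -
    let ?x = "(1 / 2) *\<^sub>R (Z + sw Z)" and ?y = "- J ((1 / 2) *\<^sub>R (Z - sw Z))"
    have J_sw: "sw (J Z) = - J (sw Z)" for Z :: "(complex^'n) \<times> (complex^'n)"
      using sw_cscale[of \<i> Z] by (simp add: cscale_ii)
    have "sw (- Z) = - sw Z" for Z :: "(complex^'n) \<times> (complex^'n)"
      using sw_diff[of 0 Z] by simp
    then have "sw ?x = ?x" "sw ?y = ?y"
      by (simp_all add: sw_scaleR sw_add sw_diff J_sw add.commute J_scaleR[symmetric] J_diff algebra_simps)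
    moreover have "Z = ?x + J ?y" by (simp add: scaleR_add_right[symmetric] scaleR_2[symmetric])
    ultimately show ?thesis by blast
  qed
  have zero: "fd E 0 Z = 0 \<and> hess E 0 Z Z = 0" for Z
  proof -
    obtain x y where xy: "sw x = x" "sw y = y" "Z = x + J y" using dec by blast
    have "b (x + y) (x + y) = 0" using real[of "x + y"] xy by (simp add: sw_add)
    then have "b x y + b y x = 0"
      using real[OF xy(1)] real[OF xy(2)] by (simp add: clinear_add[OF bl] clinear_add[OF br] add.commute)
    then have "b Z Z = 0"
      using real[OF xy(1)] real[OF xy(2)]
      by (simp add: xy(3) add.commute[of "b y x"] clinear_add[OF bl] clinear_add[OF br] clinear_J[OF bl] clinear_J[OF br] J_complex_def distrib_left[symmetric])
    moreover have "fd E 0 Z = 0" using real[OF xy(1)] real[OF xy(2)] by (simp add: xy(3) clinear_add[OF L] clinear_J[OF L])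
    ultimately show ?thesis by (simp add: b_def)
  qed
  show ?thesis
  proof (rule that[of "min (r / 2) \<rho>" K])
    show "cmod (E Z) \<le> K * norm Z ^ 3" if "norm Z < min (r / 2) \<rho>" for Z
      using T[of Z] that zero[of Z] by (simp add: E0)
  qed (use r \<rho> in auto)
qed

section \<open>Levi-flatness\<close>

lemma Ck_on_cong:
  assumes "open S" "\<And>x. x \<in> S \<Longrightarrow> f x = g x"
  shows "Ck_on k S f \<longleftrightarrow> Ck_on k S g"
  using assms(2)
proof (induction k arbitrary: f g)
  case 0
  then show ?case by (simp cong: continuous_on_cong)
next
  case (Suc k)
  have "f differentiable_on S \<longleftrightarrow> g differentiable_on S"
    unfolding differentiable_on_def using Suc.prems by (metis differentiable_transform_within zero_less_one)
  moreover have "Ck_on k S (\<lambda>x. fd f x v) \<longleftrightarrow> Ck_on k S (\<lambda>x. fd g x v)" for v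
    by (rule Suc.IH) (simp add: fd_cong[OF assms(1) _ Suc.prems])
  ultimately show ?case by simp
qed

lemma has_derivative_\<iota>:
  assumes "holo g S" "\<iota> x \<in> S"
  shows "((\<lambda>x. g (\<iota> x)) has_derivative (\<lambda>h. fd g (\<iota> x) (\<iota> h))) (at x)"
  by (rule has_derivative_compose[OF bounded_linear_imp_has_derivative[OF bounded_linear_\<iota>] holo_has_derivative[OF assms]])

text \<open>Induction works because the derivative of x -> g (\<iota> x) in direction v has the same
  shape, with the holomorphic map Z -> \<open>fd g Z (\<iota> v)\<close> in place of g.\<close>

lemma smooth_on_\<iota>:
  fixes g :: "(complex^'n) \<times> (complex^'n) \<Rightarrow> complex^'m"
  assumes S: "open S" and V: "open V" "\<And>x. x \<in> V \<Longrightarrow> \<iota> x \<in> S" and g: "holo g S"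
  shows "smooth_on V (\<lambda>x. g (\<iota> x))"
proof -
  have "Ck_on k V (\<lambda>x. g (\<iota> x))" for k
    using g
  proof (induction k arbitrary: g)
    case (0 g)
    have "continuous (at x) (\<lambda>x. g (\<iota> x))" if "x \<in> V" for x
      using has_derivative_continuous[OF has_derivative_\<iota>[OF 0 V(2)[OF that]]] .
    then show ?case by (simp add: continuous_at_imp_continuous_on)
  next
    case (Suc k g)
    have "(\<lambda>x. g (\<iota> x)) differentiable (at x)" if "x \<in> V" for x
      using has_derivative_\<iota>[OF Suc.prems V(2)[OF that]] differentiableI by blast
    then have "(\<lambda>x. g (\<iota> x)) differentiable_on V"
      by (simp add: differentiable_on_def differentiable_at_withinI)
    moreover have "Ck_on k V (\<lambda>x. fd (\<lambda>x. g (\<iota> x)) x v)" for v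
    proof -
      have "Ck_on k V (\<lambda>x. fd g (\<iota> x) (\<iota> v))" by (rule Suc.IH[OF holo_fd_vec[OF S Suc.prems]])
      moreover have "fd (\<lambda>x. g (\<iota> x)) x v = fd g (\<iota> x) (\<iota> v)" if "x \<in> V" for x
        using fun_cong[OF fd_eq[OF has_derivative_\<iota>[OF Suc.prems V(2)[OF that]]]] .
      ultimately show ?thesis
        using Ck_on_cong[OF V(1), of "\<lambda>x. fd (\<lambda>x. g (\<iota> x)) x v" "\<lambda>x. fd g (\<iota> x) (\<iota> v)" k] by simp
    qed
    ultimately show ?case by simp
  qed
  then show ?thesis by (simp add: smooth_on_def)
qed

lemma axis_ii: "axis i \<i> = \<i> *\<^sub>C axis i (1::complex)"
  by (simp add: vec_eq_iff axis_def)

context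
  fixes F :: "complex^'n \<Rightarrow> real" and Fc :: "(complex^'n) \<times> (complex^'n) \<Rightarrow> complex" and \<rho> :: real
  assumes Fc: "holo Fc (ball 0 \<rho>)" and FcF: "\<And>z. norm z < \<rho> \<Longrightarrow> Fc (\<iota> z) = complex_of_real (F z)"
begin

lemma \<iota>_in: "norm z < \<rho> / 2 \<Longrightarrow> \<iota> z \<in> ball 0 \<rho>"
  using norm_\<iota>[of z] by simp

lemma complexified_derivative:
  assumes q: "norm q < \<rho> / 2"
  shows "((\<lambda>z. complex_of_real (F z)) has_derivative (\<lambda>h. fd Fc (\<iota> q) (\<iota> h))) (at q)"
proof -
  have q': "q \<in> ball 0 (\<rho> / 2)" using q by simp
  have "((\<lambda>z. Fc (\<iota> z)) has_derivative (\<lambda>h. fd Fc (\<iota> q) (\<iota> h))) (at q)"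
    by (rule has_derivative_\<iota>[OF Fc \<iota>_in[OF q]])
  moreover have "Fc (\<iota> z) = complex_of_real (F z)" if "z \<in> ball 0 (\<rho> / 2)" for z
  proof -
    have "norm z < \<rho> / 2" using that by simp
    then have "norm z < \<rho>" using norm_ge_zero[of z] by linarith
    then show ?thesis by (rule FcF)
  qed
  ultimately show ?thesis using has_derivative_cong_open[OF open_ball q', of "\<lambda>z. Fc (\<iota> z)" "\<lambda>z. complex_of_real (F z)"] by simp
qed

text \<open>In the combination of the directions 1 and \<i> the contributions of the conjugate block
  cancel, which leaves the partial derivative in the first block.\<close>

lemma wirtinger_complexified:
  assumes q: "norm q < \<rho> / 2"
  shows "wirtinger (\<lambda>z. complex_of_real (F z)) i q = fd Fc (\<iota> q) (axis i 1, 0)"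
proof -
  note c = holo_clinear[OF Fc \<iota>_in[OF q]]
  have *: "fd Fc (\<iota> q) (u, v) = fd Fc (\<iota> q) (u, 0) + fd Fc (\<iota> q) (0, v)" for u v
    using clinear_add[OF c, of "(u, 0)" "(0, v)"] by simp
  have s: "fd Fc (\<iota> q) (s *\<^sub>C u, 0) = s * fd Fc (\<iota> q) (u, 0)" "fd Fc (\<iota> q) (0, s *\<^sub>C u) = s * fd Fc (\<iota> q) (0, u)" for s u
    using clinear_cscale[OF c, of s "(u, 0)"] clinear_cscale[OF c, of s "(0, u)"] by (simp_all add: cscale_Pair)
  have "cj (axis i 1) = axis i (1::complex)" by (simp add: vec_eq_iff axis_def)
  then show ?thesis
    unfolding wirtinger_def fd_eq[OF complexified_derivative[OF q]] axis_ii \<iota>_def[of "axis i 1"] \<iota>_def[of "_ *\<^sub>C _"] cj_cscale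
    using *[of "axis i 1" "axis i 1"] *[of "\<i> *\<^sub>C axis i 1" "cnj \<i> *\<^sub>C axis i 1"] by (simp only: s) (simp add: field_simps)
qed

lemma levi_distribution_complexified:
  assumes q: "norm q < \<rho> / 2"
  shows "w \<in> levi_distribution F q \<longleftrightarrow> fd Fc (\<iota> q) (w, 0) = 0"
proof -
  have "clinear (\<lambda>w. fd Fc (\<iota> q) (w, 0 :: complex^'n))"
    by (rule clinear_compose[OF clinear_Pair[OF clinear_id clinear_const_zero] holo_clinear[OF Fc \<iota>_in[OF q]]])
  from clinear_vec_expansion[OF this, of w] show ?thesis
    by (simp add: levi_distribution_def wirtinger_complexified[OF q] mult.commute)
qed

text \<open>Test involutivity on a field X tangent to the Levi distribution and on J X. In their
  bracket the holomorphic parts of the derivative of X cancel, leaving 2 J B, where B is the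
  derivative of X along the conjugate direction (0, cj X). Applying \<partial>F to B produces the
  mixed Hessian.\<close>

lemma levi_form_zero:
  assumes flat: "levi_flat_germ F" and \<rho>: "\<rho> > 0"
  shows "\<exists>\<rho>'>0. \<rho>' \<le> \<rho> / 2 \<and> (\<forall>q u v. norm q < \<rho>' \<longrightarrow> Fc (\<iota> q) = 0 \<longrightarrow> fd Fc (\<iota> q) (v, 0) \<noteq> 0 \<longrightarrow>
    fd Fc (\<iota> q) (u, 0) = 0 \<longrightarrow> hess Fc (\<iota> q) (u, 0) (0, cj u) = 0)"
proof -
  obtain U where U: "open U" "0 \<in> U" and inv: "\<forall>V X Y. open V \<longrightarrow> V \<subseteq> U \<longrightarrow> smooth_on V X \<longrightarrow> smooth_on V Y \<longrightarrow>
      (\<forall>q \<in> V \<inter> reg_part F. X q \<in> levi_distribution F q \<and> Y q \<in> levi_distribution F q) \<longrightarrow>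
      (\<forall>q \<in> V \<inter> reg_part F. lie_bracket X Y q \<in> levi_distribution F q)"
    using flat unfolding levi_flat_germ_def by (elim exE conjE)
  obtain r where r: "r > 0" "ball 0 r \<subseteq> U" using U openE by blast
  define \<rho>' where "\<rho>' = min r (\<rho> / 2)"
  have key: "hess Fc (\<iota> q) (u, 0) (0, cj u) = 0"
    if q: "norm q < \<rho>'" and F0: "Fc (\<iota> q) = 0" and v: "fd Fc (\<iota> q) (v, 0) \<noteq> 0" and u: "fd Fc (\<iota> q) (u, 0) = 0" for q u v
  proof -
    have q2: "norm q < \<rho> / 2" using q by (simp add: \<rho>'_def)
    let ?V = "ball (0::complex^'n) \<rho>'"
    define A where "A w Z = fd Fc Z (w, 0)" for w Z
    have A_hol: "holo (A w) (ball 0 \<rho>)" for w unfolding A_def by (rule holo_fd[OF open_ball Fc])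
    \<comment> \<open>This field lies in the kernel of \<partial>F at every point, by antisymmetry,
      and at q it is a nonzero multiple of u.\<close>
    define g where "g Z = A v Z *\<^sub>C u - A u Z *\<^sub>C v" for Z
    have g_hol: "holo g (ball 0 \<rho>)" unfolding g_def by (intro holo_diff holo_cscale A_hol holo_const)
    have Jg_hol: "holo (\<lambda>Z. J (g Z)) (ball 0 \<rho>)"
      using holo_cscale_const[OF g_hol, of \<i>] by (simp add: cscale_ii)
    define X where "X x = g (\<iota> x)" for x
    define Y where "Y x = J (g (\<iota> x))" for x
    have VS: "\<iota> x \<in> ball 0 \<rho>" "norm x < \<rho> / 2" if "x \<in> ?V" for x
      using that \<iota>_in[of x] by (auto simp: \<rho>'_def)
    have A_lin: "A (s *\<^sub>C w) Z = s * A w Z" "A (w - w') Z = A w Z - A w' Z" if "Z \<in> ball 0 \<rho>" for s w w' Z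
      using clinear_cscale[OF holo_clinear[OF Fc that], of s "(w, 0)"] clinear_diff[OF holo_clinear[OF Fc that], of "(w, 0)" "(w', 0)"]
      by (simp_all add: A_def cscale_Pair)
    have ker: "A (g Z) Z = 0" "A (J (g Z)) Z = 0" if "Z \<in> ball 0 \<rho>" for Z
    proof -
      show 1: "A (g Z) Z = 0" unfolding g_def by (simp add: A_lin[OF that])
      show "A (J (g Z)) Z = 0" using A_lin(1)[OF that, of \<i> "g Z"] 1 by (simp add: cscale_ii)
    qed
    have reg: "q \<in> reg_part F"
    proof -
      have n: "norm q < \<rho>" using q2 norm_ge_zero[of q] by linarith
      have "fd F q \<noteq> (\<lambda>_. 0)"
      proof
        assume z: "fd F q = (\<lambda>_. 0)"
        have "((\<lambda>x. Re (complex_of_real (F x))) has_derivative (\<lambda>h. Re (fd Fc (\<iota> q) (\<iota> h)))) (at q)"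
          by (rule bounded_linear.has_derivative[OF bounded_linear_Re complexified_derivative[OF q2]])
        then have d: "(F has_derivative (\<lambda>h. Re (fd Fc (\<iota> q) (\<iota> h)))) (at q)" by simp
        then have "(F has_derivative (\<lambda>h. 0)) (at q)" using fd_eq[OF d] z by simp
        then have "((\<lambda>x. complex_of_real (F x)) has_derivative (\<lambda>h. complex_of_real 0)) (at q)"
          by (rule bounded_linear.has_derivative[OF bounded_linear_of_real])
        then have "fd (\<lambda>x. complex_of_real (F x)) q = (\<lambda>h. 0)" using fd_eq by fastforce
        then have "wirtinger (\<lambda>z. complex_of_real (F z)) i q = 0" for i by (simp add: wirtinger_def)
        then have "v \<in> levi_distribution F q" by (simp add: levi_distribution_def)
        then show False using v levi_distribution_complexified[OF q2] by blast
      qed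
      then show ?thesis using FcF[OF n] F0 by (simp add: reg_part_def sing_part_def)
    qed
    have "lie_bracket X Y q \<in> levi_distribution F q"
    proof (rule inv[rule_format])
      show "open ?V" "?V \<subseteq> U" using r by (auto simp: \<rho>'_def)
      show "smooth_on ?V X" unfolding X_def by (rule smooth_on_\<iota>[OF open_ball open_ball VS(1) g_hol])
      show "smooth_on ?V Y" unfolding Y_def by (rule smooth_on_\<iota>[OF open_ball open_ball VS(1) Jg_hol])
      show "X q \<in> levi_distribution F q \<and> Y q \<in> levi_distribution F q" if "q \<in> ?V \<inter> reg_part F" for q
      proof -
        have q: "q \<in> ?V" using that by blast
        show ?thesis
          using ker[OF VS(1)[OF q]] by (simp add: levi_distribution_complexified[OF VS(2)[OF q]] X_def Y_def A_def)
      qed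
      show "q \<in> ?V \<inter> reg_part F" using reg q by simp
    qed
    then have br: "A (lie_bracket X Y q) (\<iota> q) = 0"
      using levi_distribution_complexified[OF q2] by (simp add: A_def)
    note Zq = \<iota>_in[OF q2]
    define DX where "DX h = fd g (\<iota> q) h" for h
    have DX: "clinear DX" unfolding DX_def by (rule holo_clinear[OF g_hol Zq])
    have dX: "fd X q h = DX (\<iota> h)" for h
      unfolding X_def DX_def using fun_cong[OF fd_eq[OF has_derivative_\<iota>[OF g_hol Zq]]] .
    have dY: "fd Y q h = J (DX (\<iota> h))" for h
      unfolding Y_def DX_def
      using fun_cong[OF fd_eq[OF bounded_linear.has_derivative[OF bounded_linear_J has_derivative_\<iota>[OF g_hol Zq]]]] .
    define B where "B = DX (0, cj (X q))"
    have split: "DX (\<iota> (X q)) = DX (X q, 0) + B" "DX (\<iota> (Y q)) = J (DX (X q, 0)) - J B"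
    proof -
      show "DX (\<iota> (X q)) = DX (X q, 0) + B"
        using clinear_add[OF DX, of "(X q, 0)" "(0, cj (X q))"] by (simp add: \<iota>_def B_def)
      have "\<iota> (Y q) = J (X q, 0) - J (0, cj (X q))" by (simp add: \<iota>_def Y_def X_def J_Pair cj_J)
      then show "DX (\<iota> (Y q)) = J (DX (X q, 0)) - J B" by (simp add: clinear_diff[OF DX] clinear_J[OF DX] B_def)
    qed
    have "lie_bracket X Y q = J B + J B"
      unfolding lie_bracket_def dX dY split by (simp add: J_add)
    then have "lie_bracket X Y q = (2 * \<i>) *\<^sub>C B" by (simp add: cscale_def scaleR_2)
    then have AB: "A B (\<iota> q) = 0" using br by (simp add: A_lin[OF Zq])
    have "DX h = hess Fc (\<iota> q) (v, 0) h *\<^sub>C u - hess Fc (\<iota> q) (u, 0) h *\<^sub>C v" for h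
    proof -
      have "(g has_derivative (\<lambda>h. fd (A v) (\<iota> q) h *\<^sub>C u - fd (A u) (\<iota> q) h *\<^sub>C v)) (at (\<iota> q))"
        unfolding g_def
        by (intro has_derivative_diff bounded_linear.has_derivative[OF bounded_linear_cscale_left] holo_has_derivative[OF A_hol Zq])
      from fun_cong[OF fd_eq[OF this]] show ?thesis by (simp add: DX_def hess_def A_def[abs_def])
    qed
    then have "A B (\<iota> q) = - (hess Fc (\<iota> q) (u, 0) (0, cj (X q)) * A v (\<iota> q))"
      using u by (simp add: B_def A_lin[OF Zq]) (simp add: A_def)
    then have 0: "hess Fc (\<iota> q) (u, 0) (0, cj (X q)) = 0" using AB v by (simp add: A_def)
    have "X q = A v (\<iota> q) *\<^sub>C u" using u by (simp add: X_def g_def A_def)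
    then have Xq: "(0, cj (X q)) = cnj (A v (\<iota> q)) *\<^sub>C (0, cj u)" by (simp add: cj_cscale cscale_Pair)
    have "cnj (A v (\<iota> q)) * hess Fc (\<iota> q) (u, 0) (0, cj u) = 0"
      using 0 clinear_cscale[OF hess_clinear_right[OF open_ball Fc Zq], of "(u, 0)" "cnj (A v (\<iota> q))" "(0, cj u)"]
      unfolding Xq by simp
    then show ?thesis using v by (simp add: A_def)
  qed
  show ?thesis
  proof (intro exI[of _ \<rho>'] conjI allI impI)
    show "\<rho>' > 0" "\<rho>' \<le> \<rho> / 2" using r \<rho> by (auto simp: \<rho>'_def)
  qed (rule key)
qed

end

section \<open>Rescaling to the normalised situation and the final statement\<close>

text \<open>The function Fe Z = Fc (e Z) / e^2 has the same quadratic part QQ, while its cubic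
  remainder is multiplied by e. A small e thus meets the smallness demanded by \<open>core\<close>,
  and the dilation is undone at the end.\<close>

lemma levi_flat_normal_form:
  fixes F :: "complex^'n \<Rightarrow> real"
  assumes ab: "a \<in> I" "b \<in> I" "a \<noteq> b"
    and analytic: "real_analytic_at (\<lambda>z. complex_of_real (F z)) 0" and flat: "levi_flat_germ F"
    and cubic: "\<forall>\<^sub>F z in nhds 0. \<bar>F z - Re (quad I z)\<bar> \<le> C * norm z ^ 3"
    and inv: "\<forall>\<^sub>F z in nhds 0. F (proj I z) = F z"
  shows "\<exists>\<Phi> \<Psi> U V. open U \<and> open V \<and> 0 \<in> U \<and> 0 \<in> V \<and> homeomorphism U V \<Phi> \<Psi> \<and> holo \<Phi> U \<and> holo \<Psi> V \<and>
    \<Phi> 0 = 0 \<and> fd \<Phi> 0 = (\<lambda>v. v) \<and> (\<forall>\<^sub>F z in nhds 0. F (\<Phi> z) = 0 \<longleftrightarrow> Re (quad I z) = 0)"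
proof -
  obtain \<rho>1 Fc where \<rho>1: "\<rho>1 > 0" and Fc1: "holo Fc (ball 0 \<rho>1)" "\<And>z. norm z < \<rho>1 \<Longrightarrow> Fc (\<iota> z) = complex_of_real (F z)"
    by (rule real_analytic_complexification[OF analytic]) blast
  have "\<forall>\<^sub>F z in nhds 0. \<bar>F z - Re (quad I z)\<bar> \<le> C * norm z ^ 3 \<and> F (proj I z) = F z"
    using cubic inv by eventually_elim simp
  then obtain \<rho>2 where \<rho>2: "\<rho>2 > 0" "\<And>z. norm z < \<rho>2 \<Longrightarrow> \<bar>F z - Re (quad I z)\<bar> \<le> C * norm z ^ 3"
    "\<And>z. norm z < \<rho>2 \<Longrightarrow> F (proj I z) = F z"
    unfolding eventually_nhds_metric by (auto simp: dist_norm)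
  define \<rho> where "\<rho> = min \<rho>1 \<rho>2"
  have \<rho>: "\<rho> > 0" using \<rho>1 \<rho>2 by (simp add: \<rho>_def)
  have Fc: "holo Fc (ball 0 \<rho>)" by (rule holo_subset[OF Fc1(1)]) (auto simp: \<rho>_def)
  have FcF: "Fc (\<iota> z) = complex_of_real (F z)" if "norm z < \<rho>" for z
    using Fc1(2)[of z] that by (simp add: \<rho>_def)
  have "\<exists>\<rho>'>0. \<rho>' \<le> \<rho> / 2 \<and> (\<forall>q u v. norm q < \<rho>' \<longrightarrow> Fc (\<iota> q) = 0 \<longrightarrow> fd Fc (\<iota> q) (v, 0) \<noteq> 0 \<longrightarrow>
    fd Fc (\<iota> q) (u, 0) = 0 \<longrightarrow> hess Fc (\<iota> q) (u, 0) (0, cj u) = 0)"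
    by (rule levi_form_zero[OF Fc _ flat \<rho>]) (rule FcF)
  then obtain \<rho>' where \<rho>': "\<rho>' > 0" "\<rho>' \<le> \<rho> / 2" and "\<forall>q u v. norm q < \<rho>' \<longrightarrow> Fc (\<iota> q) = 0 \<longrightarrow> fd Fc (\<iota> q) (v, 0) \<noteq> 0 \<longrightarrow>
    fd Fc (\<iota> q) (u, 0) = 0 \<longrightarrow> hess Fc (\<iota> q) (u, 0) (0, cj u) = 0"
    by (elim exE conjE)
  note levi = this(3)[rule_format]
  have real_pt: "\<exists>z. x = \<iota> z \<and> norm z < \<rho>" if "sw x = x" "norm x < \<rho>" for x
    using sw_fixed[OF that(1)] norm_fst_snd(1)[of x] that(2) by (intro exI[of _ "fst x"]) auto
  have sym: "Fc (sw Z) = cnj (Fc Z)" if Z: "norm Z < \<rho> / 2" for Z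
  proof -
    have "Fc (0 + Z) - cnj (Fc (sw (0 + Z))) = 0"
    proof (rule holo_zero_real_points[where f = "\<lambda>Z. Fc Z - cnj (Fc (sw Z))", OF _ _ Z])
      show "holo (\<lambda>Z. Fc Z - cnj (Fc (sw Z))) (ball 0 \<rho>)"
        by (intro holo_diff Fc holo_sw[OF Fc]) simp
      show "Fc (0 + x) - cnj (Fc (sw (0 + x))) = 0" if x: "sw x = x" "norm x < \<rho>" for x
        using real_pt[OF x] FcF x by auto
    qed
    then have "cnj (Fc (sw Z)) = Fc Z" by simp
    then show ?thesis by (metis complex_cnj_cnj)
  qed
  have Pin: "norm (proj I z, proj I w) \<le> norm (z, w)" for z w
    unfolding norm_prod_def using norm_proj[of I z] norm_proj[of I w] by (intro real_sqrt_le_mono add_mono power_mono) auto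
  have invc: "Fc (proj I z, proj I w) = Fc (z, w)" if zw: "norm (z, w) < \<rho> / 2" for z w
  proof -
    let ?f = "\<lambda>Z. Fc (proj I (fst Z), proj I (snd Z)) - Fc Z"
    have "?f (0 + (z, w)) = 0"
    proof (rule holo_zero_real_points[where f = ?f, OF _ _ zw])
      show "holo ?f (ball 0 \<rho>)"
      proof (intro holo_diff Fc holo_compose[OF Fc] holo_Pair holo_linear_image[OF clinear_proj] holo_fst holo_snd holo_id)
        fix Z :: "(complex^'n) \<times> (complex^'n)" assume "Z \<in> ball 0 \<rho>"
        then show "(proj I (fst Z), proj I (snd Z)) \<in> ball 0 \<rho>" using Pin[of "fst Z" "snd Z"] by simp
      qed
      show "?f (0 + x) = 0" if x: "sw x = x" "norm x < \<rho>" for x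
      proof -
        obtain y where y: "x = \<iota> y" "norm y < \<rho>" using real_pt[OF x] by blast
        have Py: "norm (proj I y) < \<rho>" using norm_proj[of I y] y by simp
        have "Fc (\<iota> (proj I y)) = Fc (\<iota> y)" using FcF[OF Py] FcF[OF y(2)] \<rho>2(3)[of y] y(2) by (simp add: \<rho>_def)
        then show ?thesis by (simp add: y \<iota>_def proj_cj)
      qed
    qed
    then show ?thesis by simp
  qed
  define E where "E Z = Fc Z - QQ I Z" for Z
  have E_hol: "holo E (ball 0 \<rho>)" unfolding E_def by (intro holo_diff Fc holo_QQ)
  have E_real: "cmod (E (\<iota> z)) \<le> C * norm z ^ 3" if z: "norm z < \<rho>" for z
  proof -
    have "E (\<iota> z) = complex_of_real (F z - Re (quad I z))" by (simp add: E_def FcF[OF z] QQ_\<iota>)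
    then have "cmod (E (\<iota> z)) = \<bar>F z - Re (quad I z)\<bar>" by (simp only: norm_of_real)
    then show ?thesis using \<rho>2(2)[of z] z by (simp add: \<rho>_def)
  qed
  obtain \<rho>3 K where \<rho>3: "\<rho>3 > 0" "\<rho>3 \<le> \<rho>" and K: "\<And>Z. norm Z < \<rho>3 \<Longrightarrow> cmod (E Z) \<le> K * norm Z ^ 3"
    by (rule cubic_of_real_cubic[OF E_hol \<rho> E_real]) blast+
  define m where "m = min \<rho>' \<rho>3"
  have m: "m > 0" "m \<le> \<rho>'" "m \<le> \<rho>3" using \<rho>' \<rho>3 by (auto simp: m_def)
  \<comment> \<open>The first bound maps the ball of radius 100 well into the ball of radius m. The
    second makes |K| \<epsilon> at most 1 / 10^11; adding 1 to |K| keeps the denominator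
    nonzero.\<close>
  define \<epsilon> where "\<epsilon> = min (m / 200) (1 / (10 ^ 11 * (\<bar>K\<bar> + 1)))"
  have \<epsilon>: "\<epsilon> > 0" "100 * \<epsilon> < m" using m by (auto simp: \<epsilon>_def)
  have "(\<bar>K\<bar> + 1) * \<epsilon> \<le> (\<bar>K\<bar> + 1) * (1 / (10 ^ 11 * (\<bar>K\<bar> + 1)))" by (intro mult_left_mono) (auto simp: \<epsilon>_def)
  also have "\<dots> = 1 / 10 ^ 11" by (simp add: field_simps)
  finally have K\<epsilon>: "\<bar>K\<bar> * \<epsilon> \<le> 1 / 10 ^ 11" using \<epsilon>(1) by (simp add: algebra_simps)
  define e where "e = complex_of_real \<epsilon>"
  have e: "e \<noteq> 0" "cmod e = \<epsilon>" "cnj e = e" using \<epsilon> by (simp_all add: e_def)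
  have scaled: "norm (e *\<^sub>C Z) < m" if "Z \<in> ball 0 100" for Z :: "(complex^'n) \<times> (complex^'n)"
  proof -
    have "\<epsilon> * norm Z \<le> \<epsilon> * 100" using that \<epsilon> by (intro mult_left_mono) auto
    then have "\<epsilon> * norm Z < m" using \<epsilon> by linarith
    then show ?thesis by (simp add: e)
  qed
  have in_\<rho>: "e *\<^sub>C Z \<in> ball 0 \<rho>" "norm (e *\<^sub>C Z) < \<rho> / 2" if "Z \<in> ball 0 100" for Z :: "(complex^'n) \<times> (complex^'n)"
    using scaled[OF that] m \<rho>' \<rho> by auto
  define Fe where "Fe Z = Fc (e *\<^sub>C Z) / e\<^sup>2" for Z
  have dscale: "((\<lambda>Z. e *\<^sub>C Z) has_derivative (\<lambda>W. e *\<^sub>C W)) (at Z)" for Z :: "(complex^'n) \<times> (complex^'n)"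
    by (rule bounded_linear_imp_has_derivative[OF bounded_linear_cscale_right])
  have fdFe: "fd Fe Z W = fd Fc (e *\<^sub>C Z) W / e" if Z: "Z \<in> ball 0 100" for Z W
  proof -
    have "(Fe has_derivative (\<lambda>W. fd Fc (e *\<^sub>C Z) (e *\<^sub>C W) / e\<^sup>2)) (at Z)"
      unfolding Fe_def
      by (rule bounded_linear.has_derivative[OF bounded_linear_divide has_derivative_compose[OF dscale holo_has_derivative[OF Fc in_\<rho>(1)[OF Z]]]])
    from fun_cong[OF fd_eq[OF this], of W] show ?thesis
      using e(1) by (simp add: holo_fd_cscale[OF Fc in_\<rho>(1)[OF Z]] power2_eq_square)
  qed
  have hessFe: "hess Fe Z A B = hess Fc (e *\<^sub>C Z) A B" if Z: "Z \<in> ball 0 100" for Z A B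
  proof -
    have "fd (\<lambda>Z. fd Fe Z A) Z = fd (\<lambda>Z. fd Fc (e *\<^sub>C Z) A / e) Z"
      by (rule fd_cong[OF open_ball Z]) (rule fdFe)
    also have "((\<lambda>Z. fd Fc (e *\<^sub>C Z) A / e) has_derivative (\<lambda>W. fd (\<lambda>Y. fd Fc Y A) (e *\<^sub>C Z) (e *\<^sub>C W) / e)) (at Z)"
      by (rule bounded_linear.has_derivative[OF bounded_linear_divide has_derivative_compose[OF dscale holo_has_derivative[OF holo_fd[OF open_ball Fc] in_\<rho>(1)[OF Z]]]])
    note fd_eq[OF this]
    finally have "hess Fe Z A B = fd (\<lambda>Y. fd Fc Y A) (e *\<^sub>C Z) (e *\<^sub>C B) / e" by (simp add: hess_def)
    then show ?thesis
      using e(1) by (simp add: hess_def holo_fd_cscale[OF holo_fd[OF open_ball Fc] in_\<rho>(1)[OF Z]])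
  qed
  interpret core Fe I a b "\<bar>K\<bar> * \<epsilon>"
  proof unfold_locales
    show "a \<in> I" "b \<in> I" "a \<noteq> b" by (rule ab)+
    show "holo Fe (ball 0 100)"
      unfolding Fe_def
    proof (intro holo_divide holo_const)
      show "holo (\<lambda>Z. Fc (e *\<^sub>C Z)) (ball 0 100)"
        by (rule holo_compose[OF Fc holo_cscale_const[OF holo_id] in_\<rho>(1)])
    qed (use e in simp)
    show "cmod (Fe Z - QQ I Z) \<le> \<bar>K\<bar> * \<epsilon> * norm Z ^ 3" if Z: "Z \<in> ball 0 100" for Z
    proof -
      have "Fe Z - QQ I Z = E (e *\<^sub>C Z) / e\<^sup>2" using e(1) by (simp add: Fe_def E_def QQ_scale field_simps)
      then have "cmod (Fe Z - QQ I Z) = cmod (E (e *\<^sub>C Z)) / \<epsilon>\<^sup>2" by (simp add: norm_divide norm_power e)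
      also have "\<dots> \<le> \<bar>K\<bar> * norm (e *\<^sub>C Z) ^ 3 / \<epsilon>\<^sup>2"
        using scaled[OF Z] m
        by (intro divide_right_mono order_trans[OF K] mult_right_mono) auto
      also have "\<dots> = \<bar>K\<bar> * \<epsilon> * norm Z ^ 3" using \<epsilon>(1) by (simp add: e power_mult_distrib power2_eq_square power3_eq_cube)
      finally show ?thesis .
    qed
    show "Fe (sw Z) = cnj (Fe Z)" if Z: "Z \<in> ball 0 100" for Z
      using sym[OF in_\<rho>(2)[OF Z]] by (simp add: Fe_def sw_cscale e)
    show "0 \<le> \<bar>K\<bar> * \<epsilon>" using \<epsilon> by simp
    show "\<bar>K\<bar> * \<epsilon> \<le> 1 / 10 ^ 11" by (rule K\<epsilon>)
    show "Fe (proj I z, proj I w) = Fe (z, w)" if Z: "(z, w) \<in> ball 0 100" for z w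
      using invc[of "e *\<^sub>C z" "e *\<^sub>C w"] in_\<rho>(2)[OF Z] by (simp add: Fe_def cscale_Pair clinear_cscale[OF clinear_proj])
    show "hess Fe (z, cj z) (u, 0) (0, cj u) = 0"
      if z: "norm z < 10" "Fe (z, cj z) = 0" "fd Fe (z, cj z) (v, 0) \<noteq> 0" "fd Fe (z, cj z) (u, 0) = 0" for z u v
    proof -
      have Z: "(z, cj z) \<in> ball 0 100" using norm_Pair_cj[of z] z(1) by simp
      have eq: "e *\<^sub>C (z, cj z) = \<iota> (e *\<^sub>C z)" by (simp add: \<iota>_def cscale_Pair cj_cscale e)
      have "norm (e *\<^sub>C z) < \<rho>'" using norm_fst_snd(1)[of "e *\<^sub>C (z, cj z)"] scaled[OF Z] m by simp
      then have "hess Fc (\<iota> (e *\<^sub>C z)) (u, 0) (0, cj u) = 0"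
        using z(2-4) e(1) by (intro levi[of _ v]) (auto simp: Fe_def fdFe[OF Z] eq)
      then show ?thesis by (simp add: hessFe[OF Z] eq)
    qed
  qed
  obtain \<Phi> \<Psi> U V where UV: "open U" "open V" "0 \<in> U" "0 \<in> V" "homeomorphism U V \<Phi> \<Psi>"
    and \<Phi>: "holo \<Phi> U" "holo \<Psi> V" "\<Phi> 0 = 0" "fd \<Phi> 0 = (\<lambda>v. v)"
    and nf: "\<forall>\<^sub>F z in nhds 0. Fe (\<Phi> z, cj (\<Phi> z)) = 0 \<longleftrightarrow> Re (quad I z) = 0"
    using normal_form by (elim exE conjE)
  define c where "c = inverse e"
  have c: "e * c = 1" "c * e = 1" using e by (auto simp: c_def)
  \<comment> \<open>Conjugation by the dilation does not change the derivative at 0, and the cone Re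
    q = 0 is invariant under real scaling.\<close>
  define \<Phi>' where "\<Phi>' x = e *\<^sub>C \<Phi> (c *\<^sub>C x)" for x
  define \<Psi>' where "\<Psi>' x = e *\<^sub>C \<Psi> (c *\<^sub>C x)" for x
  define U' where "U' = {x. c *\<^sub>C x \<in> U}"
  define V' where "V' = {x. c *\<^sub>C x \<in> V}"
  have open': "open {x :: complex^'n. c *\<^sub>C x \<in> S}" if "open S" for S
    using open_vimage[OF that holo_continuous_on[OF holo_cscale_const[OF holo_id]]] by (simp add: vimage_def)
  have \<Phi>'_hol: "holo \<Phi>' U'"
    unfolding \<Phi>'_def U'_def by (intro holo_cscale_const holo_compose[OF \<Phi>(1)] holo_id) simp
  have \<Psi>'_hol: "holo \<Psi>' V'"
    unfolding \<Psi>'_def V'_def by (intro holo_cscale_const holo_compose[OF \<Phi>(2)] holo_id) simp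
  have hom: "\<And>x. x \<in> U \<Longrightarrow> \<Phi> x \<in> V" "\<And>x. x \<in> V \<Longrightarrow> \<Psi> x \<in> U" "\<And>x. x \<in> U \<Longrightarrow> \<Psi> (\<Phi> x) = x" "\<And>x. x \<in> V \<Longrightarrow> \<Phi> (\<Psi> x) = x"
    using UV(5) by (auto simp: homeomorphism_def)
  have "homeomorphism U' V' \<Phi>' \<Psi>'"
    by (rule homeomorphismI)
      (use hom c holo_continuous_on[OF \<Phi>'_hol] holo_continuous_on[OF \<Psi>'_hol] in \<open>auto simp: \<Phi>'_def \<Psi>'_def U'_def V'_def\<close>)
  moreover have U'0: "0 \<in> U'" "0 \<in> V'" "\<Phi>' 0 = 0" using UV \<Phi>(3) by (auto simp: U'_def V'_def \<Phi>'_def)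
  moreover have "open U'" "open V'" unfolding U'_def V'_def by (intro open' UV)+
  moreover have "fd \<Phi>' 0 = (\<lambda>v. v)"
  proof (rule fd_eq)
    have "(\<Phi> has_derivative (\<lambda>v. v)) (at (c *\<^sub>C 0))" using holo_has_derivative[OF \<Phi>(1) UV(3)] \<Phi>(4) by simp
    from bounded_linear.has_derivative[OF bounded_linear_cscale_right[of e]
        has_derivative_compose[OF bounded_linear_imp_has_derivative[OF bounded_linear_cscale_right[of c]] this]]
    show "(\<Phi>' has_derivative (\<lambda>v. v)) (at 0)" using c by (simp add: \<Phi>'_def[abs_def])
  qed
  moreover have "\<forall>\<^sub>F x in nhds 0. F (\<Phi>' x) = 0 \<longleftrightarrow> Re (quad I x) = 0"
  proof -
    have "((\<lambda>x. c *\<^sub>C x) \<longlongrightarrow> c *\<^sub>C (0 :: complex^'n)) (nhds 0)" by (intro tendsto_intros filterlim_ident)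
    then have lim: "filterlim (\<lambda>x. c *\<^sub>C x) (nhds 0) (nhds (0 :: complex^'n))" by simp
    have 1: "\<forall>\<^sub>F x in nhds 0. Fe (\<Phi> (c *\<^sub>C x), cj (\<Phi> (c *\<^sub>C x))) = 0 \<longleftrightarrow> Re (quad I (c *\<^sub>C x)) = 0"
      using nf lim by (rule eventually_compose_filterlim)
    have "isCont \<Phi>' 0" using holo_has_derivative[OF \<Phi>'_hol U'0(1)] has_derivative_continuous by blast
    then have "(\<Phi>' \<longlongrightarrow> \<Phi>' 0) (nhds 0)" by (simp add: continuous_within tendsto_at_iff_tendsto_nhds)
    then have "((\<lambda>x. norm (\<Phi>' x)) \<longlongrightarrow> 0) (nhds 0)" using U'0(3) tendsto_norm by fastforce
    then have 2: "\<forall>\<^sub>F x in nhds 0. norm (\<Phi>' x) < \<rho>" using \<rho> order_tendstoD(2) by blast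
    show ?thesis
      using 1 2
    proof eventually_elim
      case (elim x)
      have "e *\<^sub>C (\<Phi> (c *\<^sub>C x), cj (\<Phi> (c *\<^sub>C x))) = \<iota> (\<Phi>' x)" by (simp add: \<iota>_def \<Phi>'_def cscale_Pair cj_cscale e)
      then have "Fe (\<Phi> (c *\<^sub>C x), cj (\<Phi> (c *\<^sub>C x))) = complex_of_real (F (\<Phi>' x)) / e\<^sup>2"
        using FcF[OF elim(2)] by (simp only: Fe_def)
      then have "F (\<Phi>' x) = 0 \<longleftrightarrow> Re (quad I (c *\<^sub>C x)) = 0" using elim(1) e(1) by simp
      also have "quad I (c *\<^sub>C x) = complex_of_real ((inverse \<epsilon>)\<^sup>2) * quad I x" by (simp add: quad_scale c_def e_def)
      also have "Re (complex_of_real ((inverse \<epsilon>)\<^sup>2) * quad I x) = 0 \<longleftrightarrow> Re (quad I x) = 0"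
        using \<epsilon>(1) by (simp del: of_real_power)
      finally show ?case .
    qed
  qed
  ultimately show ?thesis using \<Phi>'_hol \<Psi>'_hol by blast
qed

lemma clinear_matrix:
  fixes D :: "complex^'n \<Rightarrow> complex^'m"
  assumes "clinear D"
  shows "D = (\<lambda>h. (\<chi> i j. D (axis j 1) $ i) *v h)"
proof
  fix h
  have "D h $ i = (\<Sum>j\<in>UNIV. h $ j * D (axis j 1) $ i)" for i
    by (rule clinear_vec_expansion[OF clinear_compose[OF assms clinear_vec_nth]])
  then show "D h = (\<chi> i j. D (axis j 1) $ i) *v h"
    by (simp add: vec_eq_iff matrix_vector_mult_def mult.commute)
qed

lemma holo_holomorphic_map_on: "holo f S \<Longrightarrow> holomorphic_map_on f S"
  unfolding holomorphic_map_on_def holo_def using clinear_matrix by metis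

theorem theorem1:
  fixes n c :: nat
    and idx :: "nat \<Rightarrow> 'n::finite"
    and F :: "complex^'n \<Rightarrow> real"
    and H :: "complex^'n \<Rightarrow> complex"
    and M :: "(complex^'n) set"
  assumes idx: "bij_betw idx {1..n} UNIV"
    and n: "n \<ge> 2"
    and nc: "n - c \<ge> 2"
    and F_analytic: "real_analytic_at (\<lambda>z. complex_of_real (F z)) 0"
    and M: "germ_eq M {z. F z = 0}"
    and levi_flat: "levi_flat_germ F"
    and F: "\<forall>\<^sub>F z in nhds 0.
              complex_of_real (F z) = complex_of_real (Re (\<Sum>j=1..n-c. (z $ idx j)\<^sup>2)) + H z"
    and H_analytic: "real_analytic_at H 0"
    and H_real: "\<forall>\<^sub>F z in nhds 0. H z = cnj (H z)"
    and H_indep: "\<forall>j\<in>{n-c+1..n}. \<forall>\<^sub>F z in nhds 0.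
                    wirtinger H (idx j) z = 0 \<and> wirtinger_bar H (idx j) z = 0"
    and H_order: "H \<in> O[nhds 0](\<lambda>z. complex_of_real (norm z ^ 3))"
  shows "\<exists>(\<Phi> :: complex^'n \<Rightarrow> complex^'n) (A :: complex^'n^'n).
           biholomorphic_germ \<Phi> \<and>
           (\<Phi> has_derivative (\<lambda>h. A *v h)) (at 0) \<and>
           (\<forall>j\<in>{1..n-c}. \<forall>k\<in>{1..n-c}. A $ idx j $ idx k = (if j = k then 1 else 0)) \<and>
           (\<forall>j\<in>{n-c+1..n}. \<forall>k\<in>{1..n-c}. A $ idx j $ idx k = 0) \<and>
           (\<forall>j\<in>{n-c+1..n}. \<forall>k\<in>{n-c+1..n}. A $ idx j $ idx k = (if j = k then 1 else 0)) \<and>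
           germ_eq (\<Phi> -` M) {x. Re (\<Sum>j=1..n-c. (x $ idx j)\<^sup>2) = 0}"
proof -
  have inj: "inj_on idx {1..n}" and surj: "idx ` {1..n} = UNIV" using idx by (auto simp: bij_betw_def)
  define I where "I = idx ` {1..n-c}"
  have inj': "inj_on idx {1..n-c}" by (rule inj_on_subset[OF inj]) auto
  have q: "(\<Sum>j=1..n-c. (z $ idx j)\<^sup>2) = quad I z" for z
    unfolding quad_def I_def by (subst sum.reindex[OF inj']) simp
  have ab: "idx 1 \<in> I" "idx 2 \<in> I" "idx 1 \<noteq> idx 2"
    using nc n inj_onD[OF inj, of 1 2] by (auto simp: I_def)
  obtain C where C: "\<forall>\<^sub>F z in nhds 0. norm (H z) \<le> C * norm (complex_of_real (norm z ^ 3))"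
    using landau_o.bigE[OF H_order] by blast
  have cubic: "\<forall>\<^sub>F z in nhds 0. \<bar>F z - Re (quad I z)\<bar> \<le> C * norm z ^ 3"
    using F C
  proof eventually_elim
    case (elim z)
    have "complex_of_real (F z - Re (quad I z)) = H z" using elim(1) unfolding q by simp
    then have "norm (H z) = \<bar>F z - Re (quad I z)\<bar>" by (metis norm_of_real)
    then show ?case using elim(2) by (simp add: norm_power)
  qed
  \<comment> \<open>H has vanishing derivatives in the directions outside I, so it is constant on
    the segment from \<open>proj I z\<close> to z, which stays in the ball.\<close>
  have inv: "\<forall>\<^sub>F z in nhds 0. F (proj I z) = F z"
  proof -
    obtain \<rho>1 Fc where \<rho>1: "\<rho>1 > 0" and Fc: "holo Fc (ball 0 \<rho>1)" "\<And>z. norm z < \<rho>1 \<Longrightarrow> Fc (\<iota> z) = complex_of_real (F z)"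
      by (rule real_analytic_complexification[OF F_analytic]) blast
    define E where "E Z = Fc Z - QQ I Z" for Z
    have E: "holo E (ball 0 \<rho>1)" unfolding E_def by (intro holo_diff Fc holo_QQ)
    have "\<forall>\<^sub>F z in nhds 0. \<forall>j\<in>{n-c+1..n}. wirtinger H (idx j) z = 0 \<and> wirtinger_bar H (idx j) z = 0"
      using H_indep by (intro eventually_ball_finite) auto
    then have "\<forall>\<^sub>F z in nhds 0. (\<forall>j\<in>{n-c+1..n}. wirtinger H (idx j) z = 0 \<and> wirtinger_bar H (idx j) z = 0) \<and>
        complex_of_real (F z) = complex_of_real (Re (quad I z)) + H z"
      using F unfolding q by eventually_elim simp
    then obtain \<rho>2 where \<rho>2: "\<rho>2 > 0" "\<And>z. norm z < \<rho>2 \<Longrightarrow> \<forall>j\<in>{n-c+1..n}. wirtinger H (idx j) z = 0 \<and> wirtinger_bar H (idx j) z = 0"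
      "\<And>z. norm z < \<rho>2 \<Longrightarrow> complex_of_real (F z) = complex_of_real (Re (quad I z)) + H z"
      unfolding eventually_nhds_metric by (auto simp: dist_norm)
    define \<rho> where "\<rho> = min (\<rho>1 / 2) \<rho>2"
    have \<rho>: "\<rho> > 0" using \<rho>1 \<rho>2 by (simp add: \<rho>_def)
    \<comment> \<open>Vanishing Wirtinger derivatives carry information only where H is
      differentiable, since \<open>frechet_derivative\<close> is a mere choice elsewhere. Writing H
      as a holomorphic map on real points provides this.\<close>
    have HE: "H z = E (\<iota> z)" if "z \<in> ball 0 \<rho>" for z
    proof -
      have "norm z < \<rho>1" using that \<rho>1 by (simp add: \<rho>_def)
      then show ?thesis using \<rho>2(3)[of z] Fc(2)[of z] that by (simp add: E_def QQ_\<iota> \<rho>_def)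
    qed
    have \<iota>: "\<iota> z \<in> ball 0 \<rho>1" if "z \<in> ball 0 \<rho>" for z using norm_\<iota>[of z] that by (simp add: \<rho>_def)
    have dH: "(H has_derivative fd H z) (at z)" if z: "z \<in> ball 0 \<rho>" for z
    proof -
      have "(H has_derivative (\<lambda>h. fd E (\<iota> z) (\<iota> h))) (at z)"
        using has_derivative_\<iota>[OF E \<iota>[OF z]] has_derivative_cong_open[OF open_ball z, of H "\<lambda>z. E (\<iota> z)"] HE by simp
      then show ?thesis using fd_eq by metis
    qed
    have dir: "fd H z (axis i 1) = 0 \<and> fd H z (axis i \<i>) = 0" if z: "z \<in> ball 0 \<rho>" and i: "i \<notin> I" for z i
    proof -
      obtain j where j: "i = idx j" "j \<in> {1..n}" using surj by blast
      then have "j \<in> {n-c+1..n}" using i by (auto simp: I_def)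
      then have "wirtinger H i z = 0" "wirtinger_bar H i z = 0" using \<rho>2(2)[of z] z j by (auto simp: \<rho>_def)
      then show ?thesis by (auto simp: wirtinger_def wirtinger_bar_def)
    qed
    have perp: "fd H z (w - proj I w) = 0" if z: "z \<in> ball 0 \<rho>" for z w
    proof -
      interpret l: linear "fd H z" using has_derivative_linear[OF dH[OF z]] .
      define x where "x = w - proj I w"
      have "x = (\<Sum>i\<in>UNIV. Re (x $ i) *\<^sub>R axis i 1 + Im (x $ i) *\<^sub>R axis i \<i>)"
        by (simp add: vec_eq_iff axis_def sum.distrib if_distrib[of "\<lambda>x. _ *\<^sub>R x"] complex_eq_iff cong: if_cong)
      then have "fd H z x = (\<Sum>i\<in>UNIV. Re (x $ i) *\<^sub>R fd H z (axis i 1) + Im (x $ i) *\<^sub>R fd H z (axis i \<i>))"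
        using l.sum l.add l.scale by (metis (no_types, lifting) sum.cong)
      also have "\<dots> = 0"
      proof (rule sum.neutral, rule ballI)
        fix i
        show "Re (x $ i) *\<^sub>R fd H z (axis i 1) + Im (x $ i) *\<^sub>R fd H z (axis i \<i>) = 0"
          using dir[OF z, of i] by (cases "i \<in> I") (auto simp: x_def proj_def)
      qed
      finally show ?thesis by (simp add: x_def)
    qed
    have "H (proj I z) = H z" if z: "z \<in> ball 0 \<rho>" for z
    proof -
      define p where "p s = proj I z + s *\<^sub>R (z - proj I z)" for s :: real
      have p_in: "p s \<in> ball 0 \<rho>" if "s \<in> {0..1}" for s
      proof -
        have "p s = (1 - s) *\<^sub>R proj I z + s *\<^sub>R z" by (simp add: p_def algebra_simps)
        then show ?thesis
          using convexD[OF convex_ball[of 0 \<rho>] proj_in_ball[OF z, of I] z, of "1 - s" s] that by simp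
      qed
      have "\<exists>c. \<forall>s\<in>{0..1}. H (p s) = c"
      proof (rule has_derivative_zero_constant)
        fix s :: real assume s: "s \<in> {0..1}"
        have "(p has_derivative (\<lambda>t. t *\<^sub>R (z - proj I z))) (at s)"
          unfolding p_def by (auto intro!: derivative_eq_intros)
        from has_derivative_compose[OF this dH[OF p_in[OF s]]]
        have "((\<lambda>s. H (p s)) has_derivative (\<lambda>t. fd H (p s) (t *\<^sub>R (z - proj I z)))) (at s)" .
        moreover have "fd H (p s) (t *\<^sub>R (z - proj I z)) = 0" for t
          using perp[OF p_in[OF s], of z] linear_cmul[OF has_derivative_linear[OF dH[OF p_in[OF s]]]] by simp
        ultimately show "((\<lambda>s. H (p s)) has_derivative (\<lambda>t. 0)) (at s within {0..1})"
          by (simp add: has_derivative_at_withinI)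
      qed simp
      then have "H (p 0) = H (p 1)" by auto
      then show ?thesis by (simp add: p_def)
    qed
    then have "F (proj I z) = F z" if "norm z < \<rho>" for z
    proof -
      have "norm (proj I z) < \<rho>2" "norm z < \<rho>2" using that norm_proj[of I z] by (auto simp: \<rho>_def)
      then have "complex_of_real (F (proj I z)) = complex_of_real (F z)"
        using \<rho>2(3) \<open>\<And>z. z \<in> ball 0 \<rho> \<Longrightarrow> H (proj I z) = H z\<close>[of z] that by simp
      then show ?thesis by simp
    qed
    then show ?thesis unfolding eventually_nhds_metric using \<rho> by (intro exI[of _ \<rho>]) (auto simp: dist_norm)
  qed
  obtain \<Phi> \<Psi> U V where UV: "open U" "open V" "0 \<in> U" "0 \<in> V" "homeomorphism U V \<Phi> \<Psi>"
    and \<Phi>: "holo \<Phi> U" "holo \<Psi> V" "\<Phi> 0 = 0" "fd \<Phi> 0 = (\<lambda>v. v)"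
    and nf: "\<forall>\<^sub>F z in nhds 0. F (\<Phi> z) = 0 \<longleftrightarrow> Re (quad I z) = 0"
    using levi_flat_normal_form[OF ab F_analytic levi_flat cubic inv] by (elim exE conjE)
  have d\<Phi>: "(\<Phi> has_derivative (\<lambda>v. v)) (at 0)" using holo_has_derivative[OF \<Phi>(1) UV(3)] \<Phi>(4) by simp
  have "germ_eq (\<Phi> -` M) {x. Re (quad I x) = 0}"
  proof -
    have "isCont \<Phi> 0" using d\<Phi> has_derivative_continuous by blast
    then have "(\<Phi> \<longlongrightarrow> \<Phi> 0) (nhds 0)" by (simp add: continuous_within tendsto_at_iff_tendsto_nhds)
    then have "filterlim \<Phi> (nhds 0) (nhds 0)" using \<Phi>(3) by simp
    then have "\<forall>\<^sub>F x in nhds 0. \<Phi> x \<in> M \<longleftrightarrow> F (\<Phi> x) = 0"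
      using M unfolding germ_eq_def by (auto dest: eventually_compose_filterlim)
    then show ?thesis using nf unfolding germ_eq_def by eventually_elim simp
  qed
  moreover have "biholomorphic_germ \<Phi>"
    unfolding biholomorphic_germ_def
    using UV \<Phi>(3) holo_holomorphic_map_on[OF \<Phi>(1)] holo_holomorphic_map_on[OF \<Phi>(2)] by blast
  \<comment> \<open>The map constructed is tangent to the identity, so the upper right block left
    free by the statement is zero here.\<close>
  moreover have "(\<Phi> has_derivative (\<lambda>h. (mat 1 :: complex^'n^'n) *v h)) (at 0)" using d\<Phi> by simp
  moreover have "(mat 1 :: complex^'n^'n) $ idx j $ idx k = (if j = k then 1 else 0)" if "j \<in> {1..n}" "k \<in> {1..n}" for j k
    using inj_onD[OF inj, of j k] that by (auto simp: mat_def)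
  ultimately show ?thesis
    unfolding q by (intro exI[of _ \<Phi>] exI[of _ "mat 1"]) auto
qed

end
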